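(* Let $\mathcal G=(\mathcal V,\mathcal E,\alpha,\le)$ be a finite connected GKM moment graph with a highest vertex $w$ over a finite-dimensional vector space $V$ over a field $k$, let $S=S_k(V)$, and let $\mathcal B$ be the intersection cohomology of $\mathcal G$ with stalks $\mathcal B^x$ ($x\in\mathcal V$). Assume that $\mathcal B$ is self-dual of degree $l\in\mathbb Z$, i.e. $\operatorname{Hom}^\bullet_S(\mathcal B,S)\cong\mathcal B\{l\}$ as graded modules over the structure algebra $\mathcal Z$ of $\mathcal G$. Let $x\in\mathcal V$. Then $\mathcal B^x\cong S$ (as graded $S$-modules) if and only if for all $y\ge x$ there are exactly $l$ edges of $\mathcal G$ containing $y$.
   Context: **Moment graphs.** A moment graph $\mathcal G=(\mathcal V,\mathcal E,\alpha,\le)$ over $V$ is a graph with vertex set $\mathcal V$ and edge set $\mathcal E$, a labelling $\alpha:\mathcal E\to V\setminus\{0\}$, and a partial order $\le$ on $\mathcal V$ such that the two endpoints of every edge are comparable. Two vertices are connected by at most one edge, and $\le$ is generated by the relations coming from edges (comparable vertices are linked by a directed path). $E:x\to y$ denotes an edge with endpoints $x<y$. $\mathcal G$ is a GKM-graph if the labels of any two distinct edges containing a common vertex are linearly independent. A highest vertex is $w\in\mathcal V$ with $x\le w$ for all $x\in\mathcal V$. **Structure algebra.** $S=S_k(V)$ is the symmetric algebra, graded with $\deg V=1$. All $S$-modules are $\mathbb Z$-graded and homomorphisms are homogeneous of degree $0$. For a graded module $M$, $M_{\{n\}}$ is the component of degree $n$ and $M\{m\}$ is the shift with $M\{m\}_{\{n\}}=M_{\{m+n\}}$.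 $\mathcal Z=\{(z_x)\in\bigoplus_{x\in\mathcal V}S\mid z_x\equiv z_y\bmod\alpha(E)\text{ for every edge }E\text{ with endpoints }x,y\}$, a graded $S$-algebra under coordinatewise multiplication. **Sheaves.** A sheaf $\mathscr M$ on $\mathcal G$ consists of finitely generated, graded, torsion free $S$-modules $\mathscr M^x$ ($x\in\mathcal V$), finitely generated graded $S$-modules $\mathscr M^E$ with $\alpha(E)\mathscr M^E=0$ ($E\in\mathcal E$), and homomorphisms $\rho_{x,E}:\mathscr M^x\to\mathscr M^E$ for each vertex $x$ of $E$. For $\Lambda\subset\mathcal V$, $\Gamma(\Lambda,\mathscr M)$ is the set of $(m_x)\in\bigoplus_{x\in\Lambda}\mathscr M^x$ with $\rho_{x,E}(m_x)=\rho_{y,E}(m_y)$ for all edges $E$ with endpoints $x,y\in\Lambda$; $\Gamma(\mathscr M)=\Gamma(\mathcal V,\mathscr M)$, a graded $\mathcal Z$-module under coordinatewise multiplication. For $x\in\mathcal V$ let $\mathcal E_{\delta x}$ be the set of edges $E:x\to y$ (with $y>x$), let $\mathscr M^{\delta x}\subset\bigoplus_{E\in\mathcal E_{\delta x}}\mathscr M^E$ be the image of $\Gamma(\{y\mid y>x\},\mathscr M)$ under $(m_y)\mapsto(\rho_{y,E}(m_y))_{E:x\to y}$, and let $\rho_{x,\delta x}=(\rho_{x,E})_{E\in\mathcal E_{\delta x}}:\mathscr M^x\to\bigoplus_{E\in\mathcal E_{\delta x}}\mathscr M^E$. **Intersection cohomology.** The Braden--MacPherson sheaf $\mathscr B$ is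 the (up to isomorphism unique) sheaf on $\mathcal G$ such that: (1) $\mathscr B^w\cong S$; (2) for each edge $E:x\to y$ the map $\rho_{y,E}:\mathscr B^y\to\mathscr B^E$ is surjective with kernel $\alpha(E)\mathscr B^y$; (3) for each $x\ne w$ the image of $\rho_{x,\delta x}$ is $\mathscr B^{\delta x}$, and $\rho_{x,\delta x}:\mathscr B^x\to\mathscr B^{\delta x}$ is a projective cover in the category of graded $S$-modules. The intersection cohomology is $\mathcal B=\Gamma(\mathscr B)$, and $\mathcal B^x=\mathscr B^x$. **Duality.** $\operatorname{Hom}^\bullet_S(M,S)=\bigoplus_{n\in\mathbb Z}\operatorname{Hom}_S(M,S\{n\})$, a graded $\mathcal Z$-module via $(z.f)(m)=f(z.m)$. *)

theory Defs
  imports Complex_Main "HOL-Algebra.QuotRing" "HOL-Algebra.Module" "HOL-Library.Poly_Mapping"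
begin

section \<open>Graded rings and graded modules\<close>

text \<open>One record type serves for \<open>\<int>\<close>-graded modules, rings and algebras: as in HOL-Algebra, a module
  record carries the (irrelevant) ring fields, and a ring record carries scalars. \<open>hpart M n\<close> is
  the homogeneous component of degree \<open>n\<close>.\<close>

record ('a, 'b) graded = "('a, 'b) module" +
  hpart :: "int \<Rightarrow> 'b set"

definition is_grading :: "('a, 'b) graded \<Rightarrow> bool" where
  "is_grading M \<longleftrightarrow>
     (\<forall>n. subgroup (hpart M n) (add_monoid M)) \<and>
     (\<forall>m \<in> carrier M. \<exists>!c. (\<forall>n. c n \<in> hpart M n) \<and> finite {n. c n \<noteq> \<zero>\<^bsub>M\<^esub>} \<and>
        m = (\<Oplus>\<^bsub>M\<^esub> n \<in> {n. c n \<noteq> \<zero>\<^bsub>M\<^esub>}. c n))"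

definition graded_module :: "('r, 'a) graded \<Rightarrow> ('a, 'b) graded \<Rightarrow> bool" where
  "graded_module R M \<longleftrightarrow> Module.module R M \<and> is_grading M \<and>
     (\<forall>i j. \<forall>a \<in> hpart R i. \<forall>m \<in> hpart M j. a \<odot>\<^bsub>M\<^esub> m \<in> hpart M (i + j))"

text \<open>Homogeneous homomorphisms of degree 0.\<close>

definition linear_maps :: "('r, 'a) graded \<Rightarrow> ('a, 'b) graded \<Rightarrow> ('a, 'c) graded \<Rightarrow> ('b \<Rightarrow> 'c) set"
  where
  "linear_maps R M N = {f \<in> carrier M \<rightarrow> carrier N.
     (\<forall>m \<in> carrier M. \<forall>m' \<in> carrier M. f (m \<oplus>\<^bsub>M\<^esub> m') = f m \<oplus>\<^bsub>N\<^esub> f m') \<and>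
     (\<forall>a \<in> carrier R. \<forall>m \<in> carrier M. f (a \<odot>\<^bsub>M\<^esub> m) = a \<odot>\<^bsub>N\<^esub> f m)}"

definition graded_hom :: "('r, 'a) graded \<Rightarrow> ('a, 'b) graded \<Rightarrow> ('a, 'c) graded \<Rightarrow> ('b \<Rightarrow> 'c) set"
  where
  "graded_hom R M N = {f \<in> linear_maps R M N. \<forall>n. f ` hpart M n \<subseteq> hpart N n}"

definition graded_iso :: "('r, 'a) graded \<Rightarrow> ('a, 'b) graded \<Rightarrow> ('a, 'c) graded \<Rightarrow> bool" where
  "graded_iso R M N \<longleftrightarrow> (\<exists>f \<in> graded_hom R M N. bij_betw f (carrier M) (carrier N))"

definition shift :: "('a, 'b) graded \<Rightarrow> int \<Rightarrow> ('a, 'b) graded" where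
  "shift M m = M\<lparr>hpart := (\<lambda>n. hpart M (m + n))\<rparr>"

definition graded_restrict :: "('a, 'b) graded \<Rightarrow> 'b set \<Rightarrow> ('a, 'b) graded" where
  "graded_restrict M U = M\<lparr>carrier := U, hpart := (\<lambda>n. U \<inter> hpart M n)\<rparr>"

definition graded_submodule :: "('r, 'a) graded \<Rightarrow> ('a, 'b) graded \<Rightarrow> 'b set \<Rightarrow> bool" where
  "graded_submodule R M U \<longleftrightarrow> submodule U R M \<and> is_grading (graded_restrict M U)"

text \<open>Only used for finite index sets, where the direct sum is the product. The coordinatewise
  ring structure is included so that it also yields the product of copies of a ring.\<close>

definition direct_sum :: "'i set \<Rightarrow> ('i \<Rightarrow> ('a, 'b) graded) \<Rightarrow> ('a, 'i \<Rightarrow> 'b) graded" where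
  "direct_sum I M =
     \<lparr>carrier = (\<Pi>\<^sub>E i\<in>I. carrier (M i)),
      mult = (\<lambda>f g. \<lambda>i\<in>I. f i \<otimes>\<^bsub>M i\<^esub> g i),
      one = (\<lambda>i\<in>I. \<one>\<^bsub>M i\<^esub>),
      zero = (\<lambda>i\<in>I. \<zero>\<^bsub>M i\<^esub>),
      add = (\<lambda>f g. \<lambda>i\<in>I. f i \<oplus>\<^bsub>M i\<^esub> g i),
      smult = (\<lambda>a f. \<lambda>i\<in>I. a \<odot>\<^bsub>M i\<^esub> f i),
      hpart = (\<lambda>n. \<Pi>\<^sub>E i\<in>I. hpart (M i) n)\<rparr>"

definition with_scalars :: "('z \<Rightarrow> 'b \<Rightarrow> 'b) \<Rightarrow> ('a, 'b) graded \<Rightarrow> ('z, 'b) graded" where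
  "with_scalars act M =
     \<lparr>carrier = carrier M, mult = mult M, one = one M, zero = zero M, add = add M,
      smult = act, hpart = hpart M\<rparr>"

definition finitely_generated :: "('r, 'a) graded \<Rightarrow> ('a, 'b) graded \<Rightarrow> bool" where
  "finitely_generated R M \<longleftrightarrow> (\<exists>A. finite A \<and> A \<subseteq> carrier M \<and>
     (\<forall>m \<in> carrier M. \<exists>c \<in> A \<rightarrow> carrier R. m = (\<Oplus>\<^bsub>M\<^esub> a\<in>A. c a \<odot>\<^bsub>M\<^esub> a)))"

definition torsion_free :: "('r, 'a) graded \<Rightarrow> ('a, 'b) graded \<Rightarrow> bool" where
  "torsion_free R M \<longleftrightarrow> (\<forall>a \<in> carrier R. \<forall>m \<in> carrier M.
     a \<odot>\<^bsub>M\<^esub> m = \<zero>\<^bsub>M\<^esub> \<longrightarrow> a = \<zero>\<^bsub>R\<^esub> \<or> m = \<zero>\<^bsub>M\<^esub>)"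

text \<open>Lifting property against graded epimorphisms. HOL cannot quantify over the types of the test
  modules inside a definition; for a graded ring \<open>R\<close> the two types chosen lose nothing. The free graded module on the
  nonzero homogeneous elements of \<open>P\<close> can be realised on finitely supported functions from \<open>P\<close> to
  \<open>R\<close>, i.e. on the type of \<open>N\<close>, and it surjects onto \<open>Q = P\<close>. Lifting the identity exhibits \<open>P\<close>
  as a graded direct summand of a graded free module, so \<open>P\<close> has the lifting property against
  test modules on all types.\<close>

definition graded_projective :: "('r, 'a) graded \<Rightarrow> ('a, 'b) graded \<Rightarrow> bool" where
  "graded_projective R P \<longleftrightarrow> graded_module R P \<and>
     (\<forall>(N :: ('a, 'b \<Rightarrow> 'a) graded) (Q :: ('a, 'b) graded). graded_module R N \<longrightarrow> graded_module R Q \<longrightarrow>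
        (\<forall>g \<in> graded_hom R N Q. \<forall>f \<in> graded_hom R P Q. g ` carrier N = carrier Q \<longrightarrow>
           (\<exists>h \<in> graded_hom R P N. \<forall>p \<in> carrier P. g (h p) = f p)))"

definition projective_cover ::
    "('r, 'a) graded \<Rightarrow> ('a, 'b) graded \<Rightarrow> ('a, 'c) graded \<Rightarrow> ('b \<Rightarrow> 'c) \<Rightarrow> bool" where
  "projective_cover R P M f \<longleftrightarrow>
     graded_projective R P \<and> f \<in> graded_hom R P M \<and> f ` carrier P = carrier M \<and>
     (\<forall>U. graded_submodule R P U \<and> f ` U = carrier M \<longrightarrow> U = carrier P)"

text \<open>\<open>\<Oplus>\<^sub>n Hom\<^sub>R(M, R{n})\<close>, realised inside the \<open>R\<close>-linear maps \<open>M \<rightarrow> R\<close> (the sum is direct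
  there), with scalars acting through an action on \<open>M\<close>.\<close>

definition graded_dual ::
    "('r, 'r) graded \<Rightarrow> ('r, 'b) graded \<Rightarrow> ('z \<Rightarrow> 'b \<Rightarrow> 'b) \<Rightarrow> ('z, 'b \<Rightarrow> 'r) graded" where
  "graded_dual R M act =
     \<lparr>carrier = {f \<in> linear_maps R M R \<inter> extensional (carrier M). \<exists>N c. finite N \<and>
        (\<forall>n \<in> N. c n \<in> graded_hom R M (shift R n)) \<and>
        (\<forall>m \<in> carrier M. f m = (\<Oplus>\<^bsub>R\<^esub> n\<in>N. c n m))},
      mult = undefined,
      one = undefined,
      zero = (\<lambda>m \<in> carrier M. \<zero>\<^bsub>R\<^esub>),
      add = (\<lambda>f g. \<lambda>m \<in> carrier M. f m \<oplus>\<^bsub>R\<^esub> g m),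
      smult = (\<lambda>z f. \<lambda>m \<in> carrier M. f (act z m)),
      hpart = (\<lambda>n. graded_hom R M (shift R n) \<inter> extensional (carrier M))\<rparr>"


section \<open>The symmetric algebra\<close>

text \<open>The free commutative \<open>k\<close>-algebra on the set \<open>V\<close> modulo the relations that make
  \<open>v \<mapsto> X\<^sub>v\<close> linear. Here \<open>V\<close> is the type \<open>'v\<close> with scalar multiplication \<open>scale\<close>.\<close>

type_synonym ('k, 'v) free_alg = "('v \<Rightarrow>\<^sub>0 nat) \<Rightarrow>\<^sub>0 'k"
type_synonym ('k, 'v) sym = "('k, 'v) free_alg set"

definition free_alg_ring :: "('k::field, 'v) free_alg ring" where
  "free_alg_ring = \<lparr>carrier = UNIV, mult = (*), one = 1, zero = 0, add = (+)\<rparr>"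

definition gen :: "'v \<Rightarrow> ('k::field, 'v) free_alg" where
  "gen v = Poly_Mapping.single (Poly_Mapping.single v 1) 1"

definition const :: "'k::field \<Rightarrow> ('k, 'v) free_alg" where
  "const c = Poly_Mapping.single 0 c"

definition linear_relations ::
    "('k::field \<Rightarrow> 'v::ab_group_add \<Rightarrow> 'v) \<Rightarrow> ('k, 'v) free_alg set" where
  "linear_relations scale =
     {gen (u + v) - gen u - gen v | u v. True} \<union> {gen (scale c v) - const c * gen v | c v. True}"

definition sym_ideal :: "('k::field \<Rightarrow> 'v::ab_group_add \<Rightarrow> 'v) \<Rightarrow> ('k, 'v) free_alg set" where
  "sym_ideal scale = genideal free_alg_ring (linear_relations scale)"

definition monomial_degree :: "('v \<Rightarrow>\<^sub>0 nat) \<Rightarrow> nat" where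
  "monomial_degree t = (\<Sum>v \<in> Poly_Mapping.keys t. Poly_Mapping.lookup t v)"

definition sym_alg ::
    "('k::field \<Rightarrow> 'v::ab_group_add \<Rightarrow> 'v) \<Rightarrow> (('k, 'v) sym, ('k, 'v) sym) graded" where
  "sym_alg scale = (let Q = free_alg_ring Quot sym_ideal scale in
     \<lparr>carrier = carrier Q, mult = mult Q, one = one Q, zero = zero Q, add = add Q,
      smult = mult Q,
      hpart = (\<lambda>n. (\<lambda>p. sym_ideal scale +>\<^bsub>free_alg_ring\<^esub> p) `
                {p. \<forall>t \<in> Poly_Mapping.keys p. int (monomial_degree t) = n})\<rparr>)"

definition sym_incl :: "('k::field \<Rightarrow> 'v::ab_group_add \<Rightarrow> 'v) \<Rightarrow> 'v \<Rightarrow> ('k, 'v) sym" where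
  "sym_incl scale v = sym_ideal scale +>\<^bsub>free_alg_ring\<^esub> gen v"


section \<open>Moment graphs\<close>

text \<open>Two vertices are joined by at most one edge, so edges are two-element sets of vertices.\<close>

record ('x, 'v) moment_graph =
  verts :: "'x set"
  edges :: "'x set set"
  label :: "'x set \<Rightarrow> 'v"
  le :: "('x \<times> 'x) set"

definition below :: "('x, 'v) moment_graph \<Rightarrow> 'x \<Rightarrow> 'x \<Rightarrow> bool" where
  "below G x y \<longleftrightarrow> (x, y) \<in> le G \<and> x \<noteq> y"

definition arrows :: "('x, 'v) moment_graph \<Rightarrow> ('x \<times> 'x) set" where
  "arrows G = {(x, y). {x, y} \<in> edges G \<and> below G x y}"

definition is_moment_graph :: "('x, 'v::ab_group_add) moment_graph \<Rightarrow> bool" where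
  "is_moment_graph G \<longleftrightarrow>
     le G \<subseteq> verts G \<times> verts G \<and> partial_order_on (verts G) (le G) \<and>
     (\<forall>E \<in> edges G. \<exists>x \<in> verts G. \<exists>y \<in> verts G. E = {x, y} \<and> below G x y) \<and>
     le G = (arrows G)\<^sup>* \<inter> verts G \<times> verts G \<and>
     (\<forall>E \<in> edges G. label G E \<noteq> 0)"

definition is_GKM ::
    "('k::field \<Rightarrow> 'v::ab_group_add \<Rightarrow> 'v) \<Rightarrow> ('x, 'v) moment_graph \<Rightarrow> bool" where
  "is_GKM scale G \<longleftrightarrow> (\<forall>E \<in> edges G. \<forall>F \<in> edges G. E \<noteq> F \<and> E \<inter> F \<noteq> {} \<longrightarrow>
     label G E \<noteq> label G F \<and> \<not> Modules.module.dependent scale {label G E, label G F})"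

definition is_connected :: "('x, 'v) moment_graph \<Rightarrow> bool" where
  "is_connected G \<longleftrightarrow> (\<forall>x \<in> verts G. \<forall>y \<in> verts G. (x, y) \<in> {(x, y). {x, y} \<in> edges G}\<^sup>*)"

definition highest_vertex :: "('x, 'v) moment_graph \<Rightarrow> 'x \<Rightarrow> bool" where
  "highest_vertex G w \<longleftrightarrow> w \<in> verts G \<and> (\<forall>x \<in> verts G. (x, w) \<in> le G)"

definition up_edges :: "('x, 'v) moment_graph \<Rightarrow> 'x \<Rightarrow> 'x set set" where
  "up_edges G x = {{x, y} | y. {x, y} \<in> edges G \<and> below G x y}"

definition structure_algebra ::
    "('k::field \<Rightarrow> 'v::ab_group_add \<Rightarrow> 'v) \<Rightarrow> ('x, 'v) moment_graph
      \<Rightarrow> (('k, 'v) sym, 'x \<Rightarrow> ('k, 'v) sym) graded" where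
  "structure_algebra scale G = (let S = sym_alg scale; P = direct_sum (verts G) (\<lambda>_. S) in
     graded_restrict P {z \<in> carrier P. \<forall>x y. {x, y} \<in> edges G \<longrightarrow>
        z x \<ominus>\<^bsub>S\<^esub> z y \<in> PIdl\<^bsub>S\<^esub> (sym_incl scale (label G {x, y}))})"


section \<open>Sheaves on moment graphs\<close>

record ('x, 's, 'm, 'n) sheaf =
  stalk :: "'x \<Rightarrow> ('s, 'm) graded"
  edge_stalk :: "'x set \<Rightarrow> ('s, 'n) graded"
  rho :: "'x \<Rightarrow> 'x set \<Rightarrow> 'm \<Rightarrow> 'n"

definition is_sheaf ::
    "('k::field \<Rightarrow> 'v::ab_group_add \<Rightarrow> 'v) \<Rightarrow> ('x, 'v) moment_graph
      \<Rightarrow> ('x, ('k, 'v) sym, 'm, 'n) sheaf \<Rightarrow> bool" where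
  "is_sheaf scale G M \<longleftrightarrow> (let S = sym_alg scale in
     (\<forall>x \<in> verts G. graded_module S (stalk M x) \<and> finitely_generated S (stalk M x) \<and>
        torsion_free S (stalk M x)) \<and>
     (\<forall>E \<in> edges G. graded_module S (edge_stalk M E) \<and> finitely_generated S (edge_stalk M E) \<and>
        (\<forall>m \<in> carrier (edge_stalk M E).
           sym_incl scale (label G E) \<odot>\<^bsub>edge_stalk M E\<^esub> m = \<zero>\<^bsub>edge_stalk M E\<^esub>) \<and>
        (\<forall>x \<in> E. rho M x E \<in> graded_hom S (stalk M x) (edge_stalk M E))))"

definition sections ::
    "('x, 'v) moment_graph \<Rightarrow> ('x, 's, 'm, 'n) sheaf \<Rightarrow> 'x set \<Rightarrow> ('s, 'x \<Rightarrow> 'm) graded" where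
  "sections G M L = (let P = direct_sum L (stalk M) in
     graded_restrict P {m \<in> carrier P. \<forall>x \<in> L. \<forall>y \<in> L. {x, y} \<in> edges G \<longrightarrow>
        rho M x {x, y} (m x) = rho M y {x, y} (m y)})"

text \<open>Coordinatewise action of the structure algebra on global sections.\<close>

definition Z_action ::
    "('x, 'v) moment_graph \<Rightarrow> ('x, 's, 'm, 'n) sheaf \<Rightarrow> ('x \<Rightarrow> 's) \<Rightarrow> ('x \<Rightarrow> 'm) \<Rightarrow> ('x \<Rightarrow> 'm)" where
  "Z_action G M z m = (\<lambda>x \<in> verts G. z x \<odot>\<^bsub>stalk M x\<^esub> m x)"

definition global_sections ::
    "('x, 'v) moment_graph \<Rightarrow> ('x, 's, 'm, 'n) sheaf \<Rightarrow> ('x \<Rightarrow> 's, 'x \<Rightarrow> 'm) graded" where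
  "global_sections G M = with_scalars (Z_action G M) (sections G M (verts G))"

text \<open>In \<open>delta_stalk\<close>, \<open>the_elem (E - {x})\<close> is the upper endpoint of the edge \<open>E\<close> above \<open>x\<close>.\<close>

definition delta_stalk ::
    "('x, 'v) moment_graph \<Rightarrow> ('x, 's, 'm, 'n) sheaf \<Rightarrow> 'x \<Rightarrow> ('s, 'x set \<Rightarrow> 'n) graded" where
  "delta_stalk G M x = graded_restrict (direct_sum (up_edges G x) (edge_stalk M))
     ((\<lambda>m. \<lambda>E \<in> up_edges G x. rho M (the_elem (E - {x})) E (m (the_elem (E - {x})))) `
        carrier (sections G M {y \<in> verts G. below G x y}))"

definition rho_delta ::
    "('x, 'v) moment_graph \<Rightarrow> ('x, 's, 'm, 'n) sheaf \<Rightarrow> 'x \<Rightarrow> 'm \<Rightarrow> ('x set \<Rightarrow> 'n)" where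
  "rho_delta G M x m = (\<lambda>E \<in> up_edges G x. rho M x E m)"

definition is_Braden_MacPherson ::
    "('k::field \<Rightarrow> 'v::ab_group_add \<Rightarrow> 'v) \<Rightarrow> ('x, 'v) moment_graph \<Rightarrow> 'x
      \<Rightarrow> ('x, ('k, 'v) sym, 'm, 'n) sheaf \<Rightarrow> bool" where
  "is_Braden_MacPherson scale G w B \<longleftrightarrow> (let S = sym_alg scale in
     is_sheaf scale G B \<and>
     graded_iso S (stalk B w) S \<and>
     (\<forall>x y. {x, y} \<in> edges G \<and> below G x y \<longrightarrow>
        rho B y {x, y} ` carrier (stalk B y) = carrier (edge_stalk B {x, y}) \<and>
        {m \<in> carrier (stalk B y). rho B y {x, y} m = \<zero>\<^bsub>edge_stalk B {x, y}\<^esub>} =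
          {sym_incl scale (label G {x, y}) \<odot>\<^bsub>stalk B y\<^esub> m | m. m \<in> carrier (stalk B y)}) \<and>
     (\<forall>x \<in> verts G. x \<noteq> w \<longrightarrow>
        rho_delta G B x ` carrier (stalk B x) = carrier (delta_stalk G B x) \<and>
        projective_cover S (stalk B x) (delta_stalk G B x) (rho_delta G B x)))"

text \<open>\<open>Hom\<^sup>\<bullet>\<^sub>S(\<Gamma>(M), S) \<cong> \<Gamma>(M){l}\<close> as graded modules over the structure algebra.\<close>

definition self_dual ::
    "('k::field \<Rightarrow> 'v::ab_group_add \<Rightarrow> 'v) \<Rightarrow> ('x, 'v) moment_graph
      \<Rightarrow> ('x, ('k, 'v) sym, 'm, 'n) sheaf \<Rightarrow> int \<Rightarrow> bool" where
  "self_dual scale G M l \<longleftrightarrow>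
     graded_iso (structure_algebra scale G)
       (graded_dual (sym_alg scale) (sections G M (verts G)) (Z_action G M))
       (shift (global_sections G M) l)"

end

(*
  A degree 0 section beta, nonzero at every vertex, identifies "B^x is free of rank one" with
  "B^x = S beta_x" (smoothness of x), a property inherited by all y >= x.  Self-duality turns
  homogeneous forms on B^x into global sections supported at x, and conversely, shifting degrees by l.

  If B^x = S beta_x, the sections supported at x are the multiples of a_x beta_x, where a_x is the
  product of all labels at x; comparing degrees with Hom(S, S) gives deg a_x = l.

  Conversely, let x have valency l and let all y > x be smooth.  For p in B^x the section a_x p at x
  corresponds to a form on the global sections; let H p be its value at beta.  Then H has degree 0
  and c = H beta_x is a constant.
  If c <> 0, then B^x is the sum of S beta_x and the kernel of the restriction to the upper edges, so
  minimality of the projective cover gives B^x = S beta_x.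
  If c = 0, every H p is divisible by the product of the labels of the n upper edges.  The quotient is
  a form of degree -n on B^x; the section dual to it is the product of the lower labels times a
  degree 0 element kappa, and kappa vanishes because degree 0 elements are multiples of beta_x,
  which restricts nontrivially to the upper edges.  Hence H = 0.  But for a form f on B^x the dual
  section q satisfies H q = a_x f(beta_x), so all forms vanish at beta_x, which is absurd for a
  projective module.
*)
theory Submission imports Defs "HOL-Library.Countable_Set" begin

text \<open>The pivot is the behaviour of H along the edge E from x to an upper neighbour y.
  Smoothness of y makes p agree on E with some s beta_x. If p vanishes on E, then a_x p is the label
  of E times an element that already extends by zero, so that label divides H p; hence in general H
  p is congruent to s c modulo the label. The scalar s depends on E. When c is invertible, H p / c
  replaces all of these scalars at once; when c = 0, the same congruence says that every upper label
  divides H p. The passage between forms and supported sections uses one element of the structure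
  algebra, zero at x and a_x at all other vertices: being annihilated by it characterizes support at
  x, and this is preserved by an isomorphism of modules over the structure algebra. Cancelling
  labels needs S to be a domain in which each label is prime and the labels at a vertex are coprime.
  As S is given by generators and relations, this is read off after substituting coordinates in a
  basis that contains the given label.\<close>

lemma poly_mapping_add_induct [case_names zero single add]:
  fixes p :: "'a \<Rightarrow>\<^sub>0 'b::comm_monoid_add"
  assumes "P 0" "\<And>t c. P (Poly_Mapping.single t c)" "\<And>p q. P p \<Longrightarrow> P q \<Longrightarrow> P (p + q)"
  shows "P p"
proof -
  have *: "P (\<Sum>t\<in>A. Poly_Mapping.single t (Poly_Mapping.lookup p t))" if "finite A" for A
    using that by (induction) (auto intro: assms)
  have "p = (\<Sum>t\<in>Poly_Mapping.keys p. Poly_Mapping.single t (Poly_Mapping.lookup p t))"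
    by (rule poly_mapping_eqI) (auto simp: lookup_sum lookup_single when_def in_keys_iff)
  then show ?thesis using *[of "Poly_Mapping.keys p"] by simp
qed

section \<open>Substitution homomorphisms of polynomial algebras\<close>

definition mono_subst :: "('i \<Rightarrow> 'a) \<Rightarrow> ('i \<Rightarrow>\<^sub>0 nat) \<Rightarrow> 'a::comm_monoid_mult" where
  "mono_subst c t = (\<Prod>v\<in>Poly_Mapping.keys t. c v ^ Poly_Mapping.lookup t v)"

lemma mono_subst_superset:
  assumes "finite A" "Poly_Mapping.keys t \<subseteq> A"
  shows "mono_subst c t = (\<Prod>v\<in>A. c v ^ Poly_Mapping.lookup t v)"
  unfolding mono_subst_def using assms
  by (intro prod.mono_neutral_left) (auto simp: in_keys_iff)

lemma mono_subst_0 [simp]: "mono_subst c 0 = 1"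
  by (simp add: mono_subst_def)

lemma mono_subst_add: "mono_subst c (s + t) = mono_subst c s * mono_subst c t"
proof -
  let ?A = "Poly_Mapping.keys s \<union> Poly_Mapping.keys t"
  have "finite ?A" by simp
  then show ?thesis
    using Poly_Mapping.keys_add[of s t]
    by (subst (1 2 3) mono_subst_superset[of ?A])
      (auto simp: lookup_add power_add prod.distrib)
qed

lemma mono_subst_single [simp]: "mono_subst c (Poly_Mapping.single v n) = c v ^ n"
  by (cases "n = 0") (auto simp: mono_subst_def)

text \<open>The \<open>k\<close>-algebra homomorphism that sends the variable \<open>v\<close> to
  \<open>c v\<close>, evaluated term by term.\<close>

definition poly_subst :: "('i \<Rightarrow> ('k::field, 'j) free_alg) \<Rightarrow> ('k, 'i) free_alg \<Rightarrow> ('k, 'j) free_alg" where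
  "poly_subst c p = (\<Sum>t\<in>Poly_Mapping.keys p. const (Poly_Mapping.lookup p t) * mono_subst c t)"

lemma const_simps [simp]: "const 0 = 0" "const 1 = 1"
  by (auto simp: const_def)

lemma const_add: "const (a + b) = const a + const b"
  by (simp add: const_def single_add)

lemma const_mult: "const (a * b) = const a * const b"
  by (simp add: const_def mult_single)

lemma single_eq_const_mult:
  "Poly_Mapping.single t c = const c * Poly_Mapping.single t 1"
  by (simp add: const_def mult_single)

lemma poly_subst_single [simp]: "poly_subst c (Poly_Mapping.single t a) = const a * mono_subst c t"
  by (cases "a = 0") (auto simp: poly_subst_def)

lemma poly_subst_0 [simp]: "poly_subst c 0 = 0"
  by (simp add: poly_subst_def)

lemma poly_subst_add: "poly_subst c (p + q) = poly_subst c p + poly_subst c q"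
  unfolding poly_subst_def
  by (rule setsum_keys_plus_distrib) (auto simp: const_add distrib_right)

lemma poly_subst_const [simp]: "poly_subst c (const a) = const a"
  by (simp add: const_def[of a])

lemma poly_subst_gen [simp]: "poly_subst c (gen v) = c v"
  by (simp add: gen_def)

lemma poly_subst_mult: "poly_subst c (p * q) = poly_subst c p * poly_subst c q"
proof (induction p rule: poly_mapping_add_induct)
  case (single t a)
  show ?case
  proof (induction q rule: poly_mapping_add_induct)
    case (single s b)
    then show ?case by (simp add: mult_single mono_subst_add const_mult ac_simps)
  qed (simp_all add: poly_subst_add distrib_left)
qed (simp_all add: poly_subst_add distrib_right)

lemma poly_subst_diff: "poly_subst c (p - q) = poly_subst c p - poly_subst c q"
  using poly_subst_add[of c "p - q" q] by simp

lemma poly_subst_sum: "poly_subst c (sum f A) = (\<Sum>i\<in>A. poly_subst c (f i))"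
  by (induction A rule: infinite_finite_induct) (auto simp: poly_subst_add)

lemma mono_gen: "mono_subst gen t = (Poly_Mapping.single t 1 :: ('k::field, 'v) free_alg)"
proof (induction t rule: poly_mapping_add_induct)
  case (single v n)
  have "gen v ^ n = (Poly_Mapping.single (Poly_Mapping.single v n) 1 :: ('k, 'v) free_alg)"
    by (induction n) (auto simp: gen_def mult_single simp flip: single_add)
  then show ?case by simp
next
  case (add s t)
  then show ?case by (simp add: mono_subst_add mult_single)
qed auto

lemma free_alg_induct [case_names const gen add mult]:
  fixes p :: "('k::field, 'v) free_alg"
  assumes "\<And>c. P (const c)" "\<And>v. P (gen v)" "\<And>p q. P p \<Longrightarrow> P q \<Longrightarrow> P (p + q)"
    "\<And>p q. P p \<Longrightarrow> P q \<Longrightarrow> P (p * q)"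
  shows "P p"
proof (induction p rule: poly_mapping_add_induct)
  case zero
  show ?case using assms(1)[of 0] by simp
next
  case (single t c)
  have 1: "P 1" using assms(1)[of 1] by simp
  have "P (gen v ^ n)" for v n
    by (induction n) (simp_all add: 1 assms)
  note gp = this
  have "P (\<Prod>v\<in>A. gen v ^ Poly_Mapping.lookup t v)" if "finite A" for A
    using that
  proof (induction rule: finite_induct)
    case (insert v A)
    then show ?case by (simp add: assms(4) gp)
  qed (simp add: 1)
  then have "P (Poly_Mapping.single t 1)" by (simp flip: mono_gen add: mono_subst_def)
  then show ?case by (subst single_eq_const_mult) (intro assms)
qed (rule assms)

subsection \<open>Homogeneous polynomials\<close>

definition homogeneous :: "int \<Rightarrow> ('k::field, 'v) free_alg \<Rightarrow> bool" where
  "homogeneous n p \<longleftrightarrow> (\<forall>t \<in> Poly_Mapping.keys p. int (monomial_degree t) = n)"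

lemma monomial_degree_add: "monomial_degree (s + t) = monomial_degree s + monomial_degree t"
  unfolding monomial_degree_def by (rule setsum_keys_plus_distrib[where f = "\<lambda>_ x. x"]) auto

lemma monomial_degree_0 [simp]: "monomial_degree 0 = 0"
  by (simp add: monomial_degree_def)

lemma monomial_degree_single [simp]: "monomial_degree (Poly_Mapping.single v n) = n"
  by (cases "n = 0") (auto simp: monomial_degree_def)

lemma homogeneous_0 [simp]: "homogeneous n 0"
  by (simp add: homogeneous_def)

lemma homogeneous_const: "homogeneous 0 (const c)"
  by (cases "c = 0") (auto simp: homogeneous_def const_def)

lemma homogeneous_gen: "homogeneous 1 (gen v)"
  by (simp add: homogeneous_def gen_def)

lemma homogeneous_add: "homogeneous n p \<Longrightarrow> homogeneous n q \<Longrightarrow> homogeneous n (p + q)"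
  unfolding homogeneous_def using Poly_Mapping.keys_add[of p q] by blast

lemma homogeneous_uminus: "homogeneous n p \<Longrightarrow> homogeneous n (- p)"
  by (simp add: homogeneous_def in_keys_iff)

lemma homogeneous_sum: "(\<And>i. i \<in> A \<Longrightarrow> homogeneous n (f i)) \<Longrightarrow> homogeneous n (sum f A)"
  by (induction A rule: infinite_finite_induct) (auto intro: homogeneous_add)

lemma homogeneous_mult: "homogeneous m p \<Longrightarrow> homogeneous n q \<Longrightarrow> homogeneous (m + n) (p * q)"
  unfolding homogeneous_def
  by (auto dest!: subsetD[OF Poly_Mapping.keys_mult[of p q]] simp: monomial_degree_add)

lemma homogeneous_mono_subst:
  assumes "\<And>v. homogeneous 1 (c v)"
  shows "homogeneous (int (monomial_degree t)) (mono_subst c t)"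
proof (induction t rule: poly_mapping_add_induct)
  case zero
  show ?case using homogeneous_const[of 1] by simp
next
  case (single v n)
  have "homogeneous (int n) (c v ^ n)"
  proof (induction n)
    case 0
    show ?case using homogeneous_const[of 1] by simp
  next
    case (Suc n)
    show ?case using homogeneous_mult[OF assms[of v] Suc.IH] by simp
  qed
  then show ?case by simp
next
  case (add s t)
  then show ?case
    using homogeneous_mult[OF add.IH] by (simp add: mono_subst_add monomial_degree_add)
qed

lemma homogeneous_poly_subst:
  assumes "\<And>v. homogeneous 1 (c v)" "homogeneous n p"
  shows "homogeneous n (poly_subst c p)"
  unfolding poly_subst_def
proof (intro homogeneous_sum)
  fix t assume t: "t \<in> Poly_Mapping.keys p"
  show "homogeneous n (const (Poly_Mapping.lookup p t) * mono_subst c t)"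
  proof -
    have "int (monomial_degree t) = n" using t assms(2) by (simp add: homogeneous_def)
    moreover have "homogeneous (0 + int (monomial_degree t)) (const (Poly_Mapping.lookup p t) * mono_subst c t)"
      by (intro homogeneous_mult homogeneous_const homogeneous_mono_subst assms)
    ultimately show ?thesis by simp
  qed
qed

lemma homogeneous_sum_eq_0:
  fixes f :: "int \<Rightarrow> ('k::field, 'v) free_alg"
  assumes "finite N" "\<And>n. n \<in> N \<Longrightarrow> homogeneous n (f n)" "sum f N = 0" "n \<in> N"
  shows "f n = 0"
proof (rule poly_mapping_eqI)
  fix t
  show "Poly_Mapping.lookup (f n) t = Poly_Mapping.lookup 0 t"
  proof (cases "int (monomial_degree t) = n")
    case True
    have "0 = (\<Sum>i\<in>N. Poly_Mapping.lookup (f i) t)"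
      by (simp flip: lookup_sum add: assms(3))
    also have "\<dots> = (\<Sum>i\<in>N. if i = n then Poly_Mapping.lookup (f n) t else 0)"
    proof (intro sum.cong refl)
      fix i assume "i \<in> N"
      then have "homogeneous i (f i)" by (rule assms(2))
      then show "Poly_Mapping.lookup (f i) t = (if i = n then Poly_Mapping.lookup (f n) t else 0)"
        unfolding homogeneous_def True[symmetric] by (metis in_keys_iff)
    qed
    finally show ?thesis using assms by simp
  next
    case False
    then show ?thesis using assms(2)[OF assms(4)] by (auto simp: homogeneous_def in_keys_iff)
  qed
qed

lemma homogeneous_decomposition:
  fixes p :: "('k::field, 'v) free_alg"
  obtains N f where "finite N" "\<And>n. homogeneous n (f n)" "p = sum f N"
    "\<And>n. n \<notin> N \<Longrightarrow> f n = 0"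
proof -
  define f where "f n = (\<Sum>t \<in> {t \<in> Poly_Mapping.keys p. int (monomial_degree t) = n}.
    Poly_Mapping.single t (Poly_Mapping.lookup p t))" for n
  define N where "N = (\<lambda>t. int (monomial_degree t)) ` Poly_Mapping.keys p"
  have "p = (\<Sum>t\<in>Poly_Mapping.keys p. Poly_Mapping.single t (Poly_Mapping.lookup p t))"
    by (rule poly_mapping_eqI) (auto simp: lookup_sum lookup_single when_def in_keys_iff)
  also have "\<dots> = sum f N"
    unfolding f_def N_def by (intro sum.group[symmetric]) auto
  finally have "p = sum f N" .
  moreover have "homogeneous n (f n)" for n
    unfolding f_def by (intro homogeneous_sum) (auto simp: homogeneous_def split: if_splits)
  moreover have "f n = 0" if "n \<notin> N" for n
    using that unfolding f_def N_def by (intro sum.neutral) auto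
  moreover have "finite N" by (simp add: N_def)
  ultimately show ?thesis using that by blast
qed

lemma homogeneous_nonpos:
  fixes p :: "('k::field, 'v) free_alg"
  assumes "homogeneous n p" "n \<le> 0"
  shows "\<exists>c. p = const c \<and> (n < 0 \<longrightarrow> c = 0)"
proof -
  have t0: "t = 0" if "int (monomial_degree t) \<le> 0" for t :: "'v \<Rightarrow>\<^sub>0 nat"
  proof (rule poly_mapping_eqI)
    fix v
    have "monomial_degree t = 0"
      using that by linarith
    then have "(\<Sum>v \<in> Poly_Mapping.keys t. Poly_Mapping.lookup t v) = 0"
      unfolding monomial_degree_def .
    then show "Poly_Mapping.lookup t v = Poly_Mapping.lookup 0 v"
      by (auto simp: in_keys_iff)
  qed
  have k: "t = 0 \<and> n = 0" if "t \<in> Poly_Mapping.keys p" for t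
  proof -
    have "int (monomial_degree t) = n" using that assms by (auto simp: homogeneous_def)
    moreover from this have "t = 0" using assms(2) by (intro t0) simp
    ultimately show ?thesis by simp
  qed
  have "Poly_Mapping.lookup p t = 0" if "t \<noteq> 0" for t
    using k[of t] that by (auto simp: in_keys_iff)
  then have "p = const (Poly_Mapping.lookup p 0)"
    by (intro poly_mapping_eqI) (simp add: const_def lookup_single when_def)
  moreover have "Poly_Mapping.lookup p 0 = 0" if "n < 0"
    using k[of 0] that by (auto simp: in_keys_iff)
  ultimately show ?thesis by blast
qed

section \<open>The symmetric algebra\<close>

lemma free_alg_ring_cring: "cring (free_alg_ring :: ('k::field, 'v) free_alg ring)"
proof (rule cringI)
  show "abelian_group (free_alg_ring :: ('k, 'v) free_alg ring)"
    by (rule abelian_groupI)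
      (auto simp: free_alg_ring_def ac_simps intro: exI[of _ "- _"] bexI[of _ "- _"])
  show "Group.comm_monoid (free_alg_ring :: ('k, 'v) free_alg ring)"
    by (rule comm_monoidI) (auto simp: free_alg_ring_def ac_simps)
qed (auto simp: free_alg_ring_def distrib_right)

lemma free_alg_ring_simps [simp]:
  "carrier free_alg_ring = UNIV" "mult free_alg_ring = (*)" "one free_alg_ring = 1"
  "zero free_alg_ring = 0" "add free_alg_ring = (+)"
  by (simp_all add: free_alg_ring_def)

lemma free_alg_ring_uminus [simp]: "a_inv free_alg_ring p = - p"
proof -
  interpret cring free_alg_ring by (rule free_alg_ring_cring)
  show ?thesis by (rule minus_equality) auto
qed

lemma free_alg_ring_minus [simp]: "a_minus free_alg_ring p q = p - q"
  by (simp add: a_minus_def)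

section \<open>The ideal of linear relations: primality and homogeneity\<close>

locale symmetric_algebra = finite_dimensional_vector_space scale Basis
  for scale :: "'a::field \<Rightarrow> 'b::ab_group_add \<Rightarrow> 'b" and Basis
begin

abbreviation I :: "('a, 'b) free_alg set" where "I \<equiv> sym_ideal scale"

lemma ideal_I: "ideal I free_alg_ring"
proof -
  interpret R: cring free_alg_ring by (rule free_alg_ring_cring)
  show ?thesis unfolding sym_ideal_def by (rule R.genideal_ideal) simp
qed

lemma I_relations: "linear_relations scale \<subseteq> I"
proof -
  interpret R: cring free_alg_ring by (rule free_alg_ring_cring)
  show ?thesis unfolding sym_ideal_def by (rule R.genideal_self) simp
qed

lemma I_minimal:
  assumes "ideal J free_alg_ring" "linear_relations scale \<subseteq> J"
  shows "I \<subseteq> J"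
proof -
  interpret R: cring free_alg_ring by (rule free_alg_ring_cring)
  show ?thesis unfolding sym_ideal_def by (rule R.genideal_minimal) fact+
qed

lemma I_0: "0 \<in> I"
  using additive_subgroup.zero_closed[OF ideal.axioms(1)[OF ideal_I]] by simp

lemma I_add: "p \<in> I \<Longrightarrow> q \<in> I \<Longrightarrow> p + q \<in> I"
  using additive_subgroup.a_closed[OF ideal.axioms(1)[OF ideal_I]] by fastforce

lemma I_mult: "p \<in> I \<Longrightarrow> q * p \<in> I"
  using ideal.I_l_closed[OF ideal_I, of p q] by simp

lemma I_uminus: "p \<in> I \<Longrightarrow> - p \<in> I"
  using I_mult[of p "- 1"] by simp

lemma gen_add_I: "gen (u + v) - gen u - gen v \<in> I"
  using I_relations unfolding linear_relations_def by blast

lemma gen_scale_I: "gen (scale c v) - const c * gen v \<in> I"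
  using I_relations unfolding linear_relations_def by blast

lemma gen_0_I: "gen 0 \<in> I"
  using I_uminus[OF gen_add_I[of 0 0]] by simp

lemma gen_linear_combination_I:
  "finite A \<Longrightarrow> gen (\<Sum>b\<in>A. scale (r b) b) - (\<Sum>b\<in>A. const (r b) * gen b) \<in> I"
proof (induction A rule: finite_induct)
  case empty
  show ?case using gen_0_I by simp
next
  case (insert b A)
  let ?s = "\<Sum>b\<in>A. scale (r b) b"
  have "(gen (scale (r b) b + ?s) - gen (scale (r b) b) - gen ?s) +
    (gen (scale (r b) b) - const (r b) * gen b) + (gen ?s - (\<Sum>b\<in>A. const (r b) * gen b)) \<in> I"
    by (intro I_add gen_add_I gen_scale_I insert)
  then show ?case using insert by (simp add: algebra_simps)
qed

text \<open>For \<open>D\<close> the whole basis, the substitution \<open>coord_subst\<close> identifies the symmetric algebra with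
  polynomials in the coordinates, over a countable ordered set of variables so that the result is
  an integral domain; leaving out a basis vector \<open>a\<close> from \<open>D\<close> yields the quotient by \<open>a\<close>.\<close>

definition coord_subst :: "'b set \<Rightarrow> 'b set \<Rightarrow> ('a, 'b) free_alg \<Rightarrow> ('a, nat) free_alg" where
  "coord_subst C D =
    poly_subst (\<lambda>v. \<Sum>b\<in>D. const (representation C v b) * gen (to_nat_on C b))"

text \<open>For a finite basis \<open>C\<close> and \<open>D = C\<close> this inverts
  \<open>coord_subst\<close> modulo the linear relations: the variable \<open>i\<close> stands for
  the basis vector numbered \<open>i\<close>.\<close>

definition coord_lift :: "'b set \<Rightarrow> ('a, nat) free_alg \<Rightarrow> ('a, 'b) free_alg" where
  "coord_lift C = poly_subst (\<lambda>i. gen (from_nat_into C i))"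

text \<open>The kernel of a substitution is an ideal, and it contains the defining relations because
  coordinates with respect to a basis are linear in the vector.\<close>

lemma coord_subst_I:
  assumes "independent C" "span C = UNIV" "p \<in> I"
  shows "coord_subst C D p = 0"
proof -
  let ?K = "{p. coord_subst C D p = 0}"
  interpret R: cring "free_alg_ring :: ('a, 'b) free_alg ring" by (rule free_alg_ring_cring)
  have gen: "coord_subst C D (gen v) = (\<Sum>b\<in>D. const (representation C v b) * gen (to_nat_on C b))" for v
    by (simp add: coord_subst_def)
  have "ideal ?K free_alg_ring"
  proof (intro idealI R.ring_axioms)
    show "subgroup ?K (add_monoid free_alg_ring)"
    proof (intro R.add.subgroupI)
      fix p assume "p \<in> ?K"
      then have "coord_subst C D (0 - p) = 0" unfolding coord_subst_def poly_subst_diff by simp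
      then show "\<ominus>\<^bsub>free_alg_ring\<^esub> p \<in> ?K" by simp
    qed (auto simp: coord_subst_def poly_subst_add intro!: exI[of _ 0])
  qed (auto simp: coord_subst_def poly_subst_mult)
  moreover have "linear_relations scale \<subseteq> ?K"
    using assms(1,2)
    by (auto simp: linear_relations_def coord_subst_def poly_subst_diff poly_subst_mult
      representation_add representation_scale const_add const_mult sum.distrib
      sum_distrib_left distrib_right mult.assoc)
  ultimately show ?thesis using I_minimal assms(3) by blast
qed

lemma coord_lift_subst:
  assumes C: "independent C" "span C = UNIV" "finite C"
    and a: "a \<in> C \<or> a = 0"
  shows "\<exists>q. p - coord_lift C (coord_subst C (C - {a}) p) - q * gen a \<in> I"
proof (induction p rule: free_alg_induct)
  case (const c)
  show ?case by (rule exI[of _ 0]) (simp add: coord_lift_def coord_subst_def I_0)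
next
  case (gen v)
  let ?r = "representation C v"
  have v: "(\<Sum>b\<in>C. scale (?r b) b) = v"
    using C by (intro sum_representation_eq) auto
  have "coord_lift C (coord_subst C (C - {a}) (gen v)) = (\<Sum>b\<in>C - {a}. const (?r b) * gen b)"
    using C by (simp add: coord_lift_def coord_subst_def poly_subst_sum poly_subst_mult
      countable_finite from_nat_into_to_nat_on)
  moreover have "\<exists>q. (\<Sum>b\<in>C. const (?r b) * gen b) - (\<Sum>b\<in>C - {a}. const (?r b) * gen b) - q * gen a \<in> I"
  proof (cases "a \<in> C")
    case True
    then show ?thesis using C by (intro exI[of _ "const (?r a)"]) (simp add: sum.remove[of C a] I_0)
  next
    case False
    then show ?thesis using I_0 by (intro exI[of _ 0]) simp
  qed
  then obtain q where "(\<Sum>b\<in>C. const (?r b) * gen b) - (\<Sum>b\<in>C - {a}. const (?r b) * gen b) - q * gen a \<in> I" ..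
  from I_add[OF gen_linear_combination_I[OF C(3), of ?r] this]
  have "gen v - (\<Sum>b\<in>C - {a}. const (?r b) * gen b) - q * gen a \<in> I"
    by (simp add: v algebra_simps)
  ultimately show ?case by auto
next
  case (add p q)
  then obtain s t where "p - coord_lift C (coord_subst C (C - {a}) p) - s * gen a \<in> I"
    "q - coord_lift C (coord_subst C (C - {a}) q) - t * gen a \<in> I" by blast
  from I_add[OF this] show ?case
    by (intro exI[of _ "s + t"]) (simp add: coord_lift_def coord_subst_def poly_subst_add algebra_simps)
next
  case (mult p q)
  let ?f = "\<lambda>p. coord_lift C (coord_subst C (C - {a}) p)"
  from mult obtain s t where "p - ?f p - s * gen a \<in> I" "q - ?f q - t * gen a \<in> I" by blast
  \<comment> \<open>Telescoping: p q - f p f q = q (p - f p) + f p (q - f q).\<close>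
  then have "q * (p - ?f p - s * gen a) + ?f p * (q - ?f q - t * gen a) \<in> I"
    by (intro I_add I_mult)
  then show ?case
    by (intro exI[of _ "q * s + ?f p * t"])
      (simp add: coord_lift_def coord_subst_def poly_subst_mult algebra_simps)
qed

lemma coord_subst_ker:
  assumes "independent C" "span C = UNIV" "finite C" "a \<in> C \<or> a = 0"
    and "coord_subst C (C - {a}) p = 0"
  shows "\<exists>q. p - q * gen a \<in> I"
  using coord_lift_subst[OF assms(1-4), of p] assms(5) by (simp add: coord_lift_def)

lemma coord_subst_gen_multiple:
  assumes "independent C" "span C = UNIV" "a \<in> C \<or> a = 0" "p - q * gen a \<in> I"
  shows "coord_subst C (C - {a}) p = 0"
proof -
  have "coord_subst C (C - {a}) (gen a) = 0"
    using assms by (auto simp: coord_subst_def representation_basis representation_zero)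
  then show ?thesis
    using coord_subst_I[OF assms(1,2,4), of "C - {a}"]
    by (simp add: coord_subst_def poly_subst_diff poly_subst_mult)
qed

lemma obtain_basis:
  obtains C where "independent C" "span C = UNIV" "finite C" "a \<in> C \<or> a = 0"
proof -
  have i: "independent ({a} - {0})"
    by (cases "a = 0") (auto simp: dependent_def)
  let ?C = "extend_basis ({a} - {0})"
  have "independent ?C" by (rule independent_extend_basis[OF i])
  moreover have "span ?C = UNIV" by (rule span_extend_basis[OF i])
  moreover have "finite ?C" using finiteI_independent calculation(1) by blast
  moreover have "a \<in> ?C \<or> a = 0" using extend_basis_superset[OF i] by auto
  ultimately show ?thesis using that by blast
qed

text \<open>In a basis containing \<open>a\<close>, setting the coordinate of \<open>a\<close> to
  zero embeds the quotient by \<open>gen a\<close> into polynomials in the remaining coordinates,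
  where a product vanishes only if a factor does.\<close>

lemma gen_multiples_prime:
  assumes "p * p' - q * gen a \<in> I"
  shows "\<exists>q. p - q * gen a \<in> I \<or> p' - q * gen a \<in> I"
proof -
  obtain C where C: "independent C" "span C = UNIV" "finite C" "a \<in> C \<or> a = 0"
    by (rule obtain_basis)
  have "coord_subst C (C - {a}) p * coord_subst C (C - {a}) p' = 0"
    using coord_subst_gen_multiple[OF C(1,2,4) assms] by (simp add: coord_subst_def poly_subst_mult)
  then have "coord_subst C (C - {a}) p = 0 \<or> coord_subst C (C - {a}) p' = 0"
    by (simp only: mult_eq_0_iff)
  then show ?thesis using coord_subst_ker[OF C] by blast
qed

text \<open>This is the case \<open>a = 0\<close> of the primality of linear forms.\<close>

lemma I_prime:
  assumes "p * q \<in> I"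
  shows "p \<in> I \<or> q \<in> I"
proof -
  obtain r where "p - r * gen 0 \<in> I \<or> q - r * gen 0 \<in> I"
    using gen_multiples_prime[of p q 0 0] assms by auto
  moreover have "r * gen 0 \<in> I" by (intro I_mult gen_0_I)
  ultimately show ?thesis using I_add by fastforce
qed

text \<open>Setting the coordinate of \<open>a\<close> to zero turns \<open>gen b\<close> into the
  linear form whose coefficients are the coordinates of \<open>b\<close> away from \<open>a\<close>.
  It vanishes, and distinct basis vectors have distinct variables, so each of these coordinates is
  zero.\<close>

lemma gen_multiple_dependent:
  assumes "gen b - q * gen a \<in> I"
  shows "\<exists>r. b = scale r a"
proof -
  obtain C where C: "independent C" "span C = UNIV" "finite C" "a \<in> C \<or> a = 0"
    by (rule obtain_basis)
  let ?r = "representation C b"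
  have 0: "(\<Sum>c\<in>C - {a}. const (?r c) * gen (to_nat_on C c) :: ('a, nat) free_alg) = 0"
    using coord_subst_gen_multiple[OF C(1,2,4) assms] by (simp add: coord_subst_def)
  have r0: "?r c = 0" if "c \<in> C - {a}" for c
  proof -
    have inj: "inj_on (to_nat_on C) C" using C(3) by (simp add: countable_finite inj_on_to_nat_on)
    have "0 = Poly_Mapping.lookup (\<Sum>c\<in>C - {a}. const (?r c) * gen (to_nat_on C c) :: ('a, nat) free_alg)
      (Poly_Mapping.single (to_nat_on C c) 1)" by (simp only: 0 lookup_zero)
    also have "\<dots> = (\<Sum>c'\<in>C - {a}. if c' = c then ?r c' else 0)"
      unfolding lookup_sum
    proof (intro sum.cong refl)
      fix c' assume "c' \<in> C - {a}"
      then have "to_nat_on C c' = to_nat_on C c \<longleftrightarrow> c' = c" using that inj by (auto dest: inj_onD)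
      moreover have "Poly_Mapping.single i (Suc 0) = Poly_Mapping.single j (Suc 0) \<longleftrightarrow> i = j" for i j :: nat
        by (metis lookup_single_eq lookup_single_not_eq nat.distinct(1))
      ultimately show "Poly_Mapping.lookup (const (?r c') * gen (to_nat_on C c') :: ('a, nat) free_alg)
        (Poly_Mapping.single (to_nat_on C c) 1) = (if c' = c then ?r c' else 0)"
        by (auto simp: const_def gen_def mult_single lookup_single when_def)
    qed
    also have "\<dots> = ?r c" using that C(3) by simp
    finally show ?thesis by simp
  qed
  have "b = (\<Sum>c\<in>C. scale (?r c) c)" using C by (simp add: sum_representation_eq)
  also have "\<dots> = (\<Sum>c\<in>C \<inter> {a}. scale (?r c) c)"
    using C(3) r0 by (intro sum.mono_neutral_right) auto
  also have "\<dots> = scale (if a \<in> C then ?r a else 0) a" by auto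
  finally show ?thesis by blast
qed

lemma gen_in_I: "gen b \<in> I \<Longrightarrow> b = 0"
  using gen_multiple_dependent[of b 0 0] by simp

lemma const_in_I:
  assumes "const c \<in> I"
  shows "c = 0"
proof -
  obtain C where C: "independent C" "span C = UNIV" using obtain_basis[of 0] by metis
  have "(const c :: ('a, nat) free_alg) = 0"
    using coord_subst_I[OF C assms, of C] by (simp add: coord_subst_def)
  then show ?thesis unfolding const_def by (metis lookup_single_eq lookup_zero)
qed

text \<open>The substitution of coordinates preserves degrees and has kernel \<open>I\<close>, so
  \<open>I\<close> inherits homogeneity from the zero ideal of the polynomial ring.\<close>

lemma homogeneous_sum_in_I:
  assumes "finite N" "\<And>n. n \<in> N \<Longrightarrow> homogeneous n (f n)" "sum f N \<in> I" "n \<in> N"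
  shows "f n \<in> I"
proof -
  obtain C where C: "independent C" "span C = UNIV" "finite C" "0 \<in> C \<or> 0 = (0::'b)"
    by (rule obtain_basis)
  have "coord_subst C (C - {0}) (f n) = 0"
  proof (rule homogeneous_sum_eq_0[where f = "\<lambda>n. coord_subst C (C - {0}) (f n)", OF assms(1) _ _ assms(4)])
    show "homogeneous m (coord_subst C (C - {0}) (f m))" if "m \<in> N" for m
      unfolding coord_subst_def
    proof (intro homogeneous_poly_subst homogeneous_sum assms(2)[OF that])
      fix v b
      show "homogeneous 1 (const (representation C v b) * gen (to_nat_on C b) :: ('a, nat) free_alg)"
        using homogeneous_mult[OF homogeneous_const homogeneous_gen] by simp
    qed
    show "(\<Sum>n\<in>N. coord_subst C (C - {0}) (f n)) = 0"
      using coord_subst_I[OF C(1,2) assms(3), of "C - {0}"] by (simp add: coord_subst_def poly_subst_sum)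
  qed
  then obtain q where "f n - q * gen 0 \<in> I" using coord_subst_ker[OF C] by blast
  from I_add[OF this I_mult[OF gen_0_I, of q]] show ?thesis by simp
qed

end

section \<open>Graded modules\<close>

definition gcomp :: "('a, 'b) graded \<Rightarrow> int \<Rightarrow> 'b \<Rightarrow> 'b" where
  "gcomp M n m = (THE c. (\<forall>n. c n \<in> hpart M n) \<and> finite {n. c n \<noteq> \<zero>\<^bsub>M\<^esub>} \<and>
     m = (\<Oplus>\<^bsub>M\<^esub> n \<in> {n. c n \<noteq> \<zero>\<^bsub>M\<^esub>}. c n)) n"

lemma (in abelian_group) finsum_nonzero:
  assumes "finite A" "{n. c n \<noteq> \<zero>} \<subseteq> A" "c \<in> A \<rightarrow> carrier G"
  shows "(\<Oplus>n\<in>{n. c n \<noteq> \<zero>}. c n) = finsum G c A"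
  using assms by (intro add.finprod_mono_neutral_cong_left) auto

locale graded_group = abelian_group M for M :: "('a, 'b) graded" (structure) +
  assumes grading: "is_grading M"
begin

lemma hpart_subgroup: "subgroup (hpart M n) (add_monoid M)"
  using grading by (simp add: is_grading_def)

lemma hpart_carrier: "m \<in> hpart M n \<Longrightarrow> m \<in> carrier M"
  using subgroup.subset[OF hpart_subgroup[of n]] by auto

lemma hpart_add: "m \<in> hpart M n \<Longrightarrow> m' \<in> hpart M n \<Longrightarrow> m \<oplus> m' \<in> hpart M n"
  using subgroup.m_closed[OF hpart_subgroup[of n], of m m'] by auto

lemma hpart_zero [simp]: "\<zero> \<in> hpart M n"
  using subgroup.one_closed[OF hpart_subgroup[of n]] by auto

lemma hpart_uminus: "m \<in> hpart M n \<Longrightarrow> \<ominus> m \<in> hpart M n"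
  using subgroup.m_inv_closed[OF hpart_subgroup[of n], of m] by (simp add: a_inv_def)

lemma hpart_finsum: "(\<And>i. i \<in> A \<Longrightarrow> f i \<in> hpart M n) \<Longrightarrow> finsum M f A \<in> hpart M n"
proof (induction A rule: infinite_finite_induct)
  case (insert i A)
  then have "f \<in> A \<rightarrow> carrier M" "f i \<in> carrier M" using hpart_carrier by auto
  with insert show ?case by (auto intro: hpart_add)
qed auto

lemma decomposition_unique:
  assumes "\<And>n. c n \<in> hpart M n" "finite A" "\<And>n. n \<notin> A \<Longrightarrow> c n = \<zero>" "m = finsum M c A"
  shows "gcomp M n m = c n"
proof -
  let ?P = "\<lambda>c. (\<forall>n. c n \<in> hpart M n) \<and> finite {n. c n \<noteq> \<zero>\<^bsub>M\<^esub>} \<and>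
     m = (\<Oplus>\<^bsub>M\<^esub> n \<in> {n. c n \<noteq> \<zero>\<^bsub>M\<^esub>}. c n)"
  have c: "c n \<in> carrier M" for n using assms(1) hpart_carrier by blast
  have "m \<in> carrier M" unfolding assms(4) using c by (intro finsum_closed) auto
  then have ex1: "\<exists>!c. ?P c" using grading by (simp add: is_grading_def)
  have sub: "{n. c n \<noteq> \<zero>} \<subseteq> A" using assms(3) by auto
  have "(\<Oplus>n\<in>{n. c n \<noteq> \<zero>}. c n) = m"
    using finsum_nonzero[OF assms(2) sub] c assms(4) by auto
  then have "?P c" using assms(1) finite_subset[OF sub assms(2)] by auto
  then have "(THE c. ?P c) = c" using the1_equality[OF ex1] by blast
  then show ?thesis unfolding gcomp_def by simp
qed

lemma decomposition:
  assumes "m \<in> carrier M"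
  obtains A where "finite A" "\<And>n. n \<notin> A \<Longrightarrow> gcomp M n m = \<zero>" "m = (\<Oplus>n\<in>A. gcomp M n m)"
    "\<And>n. gcomp M n m \<in> hpart M n"
proof -
  have "\<exists>c. (\<forall>n. c n \<in> hpart M n) \<and> finite {n. c n \<noteq> \<zero>} \<and> m = (\<Oplus>n\<in>{n. c n \<noteq> \<zero>}. c n)"
    using grading assms unfolding is_grading_def by blast
  then obtain c where c: "\<And>n. c n \<in> hpart M n" "finite {n. c n \<noteq> \<zero>}" "m = (\<Oplus>n\<in>{n. c n \<noteq> \<zero>}. c n)"
    by blast
  have "gcomp M n m = c n" for n by (rule decomposition_unique[OF c(1,2) _ c(3)]) simp
  then have "(\<lambda>n. gcomp M n m) = c" by auto
  then have "c = (\<lambda>n. gcomp M n m)" by simp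
  from c[unfolded this] show ?thesis by (intro that) auto
qed

lemma gcomp_hpart: "m \<in> carrier M \<Longrightarrow> gcomp M n m \<in> hpart M n"
  by (metis decomposition)

lemma gcomp_closed: "m \<in> carrier M \<Longrightarrow> gcomp M n m \<in> carrier M"
  using gcomp_hpart hpart_carrier by blast

lemma gcomp_hom:
  assumes "m \<in> hpart M d"
  shows "gcomp M n m = (if n = d then m else \<zero>)"
  using assms hpart_carrier[OF assms]
  by (intro decomposition_unique[where A = "{d}"]) auto

lemma gcomp_zero [simp]: "gcomp M n \<zero> = \<zero>"
  using gcomp_hom[of \<zero>] by auto

lemma gcomp_add:
  assumes "m \<in> carrier M" "m' \<in> carrier M"
  shows "gcomp M n (m \<oplus> m') = gcomp M n m \<oplus> gcomp M n m'"
proof -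
  obtain A where A: "finite A" "\<And>n. n \<notin> A \<Longrightarrow> gcomp M n m = \<zero>" "m = (\<Oplus>n\<in>A. gcomp M n m)"
    using decomposition[OF assms(1)] by metis
  obtain A' where A': "finite A'" "\<And>n. n \<notin> A' \<Longrightarrow> gcomp M n m' = \<zero>" "m' = (\<Oplus>n\<in>A'. gcomp M n m')"
    using decomposition[OF assms(2)] by metis
  note cl = gcomp_closed[OF assms(1)] gcomp_closed[OF assms(2)]
  have 1: "(\<Oplus>n\<in>A \<union> A'. gcomp M n m) = m"
    using A A' cl by (subst A(3)) (intro add.finprod_mono_neutral_cong_left[symmetric], auto)
  have 2: "(\<Oplus>n\<in>A \<union> A'. gcomp M n m') = m'"
    using A A' cl by (subst A'(3)) (intro add.finprod_mono_neutral_cong_left[symmetric], auto)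
  show ?thesis
  proof (rule decomposition_unique[where A = "A \<union> A'"])
    show "m \<oplus> m' = (\<Oplus>n\<in>A \<union> A'. gcomp M n m \<oplus> gcomp M n m')"
      using cl by (subst finsum_addf) (auto simp: 1 2)
  qed (use A A' gcomp_hpart hpart_add assms in auto)
qed

lemma graded_induct [consumes 1, case_names add hom]:
  assumes "m \<in> carrier M"
    and add: "\<And>m m'. m \<in> carrier M \<Longrightarrow> m' \<in> carrier M \<Longrightarrow> P m \<Longrightarrow> P m' \<Longrightarrow> P (m \<oplus> m')"
    and hom: "\<And>n m. m \<in> hpart M n \<Longrightarrow> P m"
  shows "P m"
proof -
  obtain A where A: "finite A" "m = (\<Oplus>n\<in>A. gcomp M n m)" "\<And>n. gcomp M n m \<in> hpart M n"
    using decomposition[OF assms(1)] by metis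
  have "P (\<Oplus>n\<in>B. gcomp M n m)" if "finite B" for B
    using that
  proof (induction B rule: finite_induct)
    case empty
    then show ?case using hom[OF hpart_zero] by simp
  next
    case (insert n B)
    have cl: "gcomp M n m \<in> carrier M" for n using A(3) hpart_carrier by blast
    then show ?case using insert by (auto intro!: add hom[OF A(3)] finsum_closed)
  qed
  then show ?thesis using A by metis
qed

lemma gcomp_eq_imp_hpart:
  assumes "m \<in> carrier M" "\<And>n. n \<noteq> d \<Longrightarrow> gcomp M n m = \<zero>"
  shows "m \<in> hpart M d"
proof -
  obtain A where A: "finite A" "m = (\<Oplus>n\<in>A. gcomp M n m)" "\<And>n. gcomp M n m \<in> hpart M n"
    using decomposition[OF assms(1)] by metis
  have "(\<Oplus>n\<in>A. gcomp M n m) \<in> hpart M d"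
    using assms(2) A(3) by (intro hpart_finsum) (metis hpart_zero)
  then show ?thesis using A by simp
qed

lemma gcomp_finsum:
  assumes "finite N" "\<And>i. i \<in> N \<Longrightarrow> c i \<in> hpart M (e i)"
  shows "gcomp M n (finsum M c N) = (\<Oplus>i\<in>N. if e i = n then c i else \<zero>)"
  using assms
proof (induction N rule: finite_induct)
  case (insert i N)
  have cl: "c \<in> N \<rightarrow> carrier M" "c i \<in> carrier M" using insert hpart_carrier by auto
  then have "(\<lambda>i. if e i = n then c i else \<zero>) \<in> N \<rightarrow> carrier M" by auto
  moreover have "gcomp M n (c i) = (if e i = n then c i else \<zero>)"
    using gcomp_hom[of "c i" "e i" n] insert.prems by auto
  ultimately show ?case using insert cl by (simp add: gcomp_add)
qed simp

text \<open>The offset \<open>e\<close> allows the family to be indexed by degrees before a shift: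
  the images of the components of a form under the duality are indexed by \<open>i\<close> and lie
  in degree \<open>i + l\<close>.\<close>

lemma finsum_hpart_imp_zero:
  assumes "finite N" "\<And>i. i \<in> N \<Longrightarrow> c i \<in> hpart M (i + e)" "finsum M c N \<in> hpart M (n + e)"
    and "j \<in> N" "j \<noteq> n"
  shows "c j = \<zero>"
proof -
  have cl: "c j \<in> carrier M" using assms hpart_carrier by blast
  have "\<zero> = gcomp M (j + e) (finsum M c N)" using assms by (simp add: gcomp_hom)
  also have "\<dots> = (\<Oplus>i\<in>N. if i + e = j + e then c i else \<zero>)"
    using assms by (intro gcomp_finsum) auto
  also have "\<dots> = (\<Oplus>i\<in>N. if j = i then c i else \<zero>)"
    by (intro arg_cong[where f = "\<lambda>f. finsum M f N"]) auto
  also have "\<dots> = c j"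
    using assms hpart_carrier by (intro add.finprod_singleton) auto
  finally show ?thesis by simp
qed

end

text \<open>Subtracting two decompositions reduces uniqueness to decompositions of zero. In the
  existence premise the family may be nonzero outside the chosen finite set; it is cut off there
  before the definition of a grading is met.\<close>

lemma graded_groupI:
  fixes M :: "('a, 'b) graded"
  assumes "abelian_group M"
    and sub: "\<And>n. hpart M n \<subseteq> carrier M" "\<And>n. \<zero>\<^bsub>M\<^esub> \<in> hpart M n"
    "\<And>n x y. x \<in> hpart M n \<Longrightarrow> y \<in> hpart M n \<Longrightarrow> x \<oplus>\<^bsub>M\<^esub> y \<in> hpart M n"
    "\<And>n x. x \<in> hpart M n \<Longrightarrow> \<ominus>\<^bsub>M\<^esub> x \<in> hpart M n"
    and ex: "\<And>m. m \<in> carrier M \<Longrightarrow>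
      \<exists>c A. finite A \<and> (\<forall>n. c n \<in> hpart M n) \<and> m = finsum M c A"
    and uniq: "\<forall>c A. finite A \<longrightarrow> (\<forall>n. c n \<in> hpart M n) \<longrightarrow> finsum M c A = \<zero>\<^bsub>M\<^esub> \<longrightarrow>
      (\<forall>n \<in> A. c n = \<zero>\<^bsub>M\<^esub>)"
  shows "graded_group M"
proof -
  interpret abelian_group M by fact
  show ?thesis
  proof (unfold_locales, unfold is_grading_def, intro conjI ballI allI)
    fix n
    show "subgroup (hpart M n) (add_monoid M)"
    proof (rule add.subgroupI)
      show "hpart M n \<noteq> {}" using sub(2) by auto
    qed (use sub in \<open>auto simp flip: a_inv_def\<close>)
  next
    fix m assume m: "m \<in> carrier M"
    let ?S = "\<lambda>c. {n. c n \<noteq> \<zero>\<^bsub>M\<^esub>}"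
    have cl: "c n \<in> carrier M" if "\<forall>n. c n \<in> hpart M n" for c :: "int \<Rightarrow> 'b" and n using that sub(1) by blast
    show "\<exists>!c. (\<forall>n. c n \<in> hpart M n) \<and> finite (?S c) \<and> m = (\<Oplus>\<^bsub>M\<^esub> n \<in> ?S c. c n)"
    proof (rule ex_ex1I)
      obtain c A where c: "finite A" "\<forall>n. c n \<in> hpart M n" "m = finsum M c A" using ex[OF m] by blast
      define c' where "c' n = (if n \<in> A then c n else \<zero>\<^bsub>M\<^esub>)" for n
      have "finsum M c' (?S c') = finsum M c A"
        using c cl[OF c(2)] by (intro add.finprod_mono_neutral_cong_left) (auto simp: c'_def)
      moreover have "finite (?S c')" by (rule finite_subset[OF _ c(1)]) (auto simp: c'_def)
      moreover have "\<forall>n. c' n \<in> hpart M n" using c(2) sub(2) by (simp add: c'_def)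
      ultimately show "\<exists>c. (\<forall>n. c n \<in> hpart M n) \<and> finite (?S c) \<and> m = (\<Oplus>\<^bsub>M\<^esub> n \<in> ?S c. c n)"
        unfolding c(3) by metis
    next
      fix c c' :: "int \<Rightarrow> 'b"
      assume c: "(\<forall>n. c n \<in> hpart M n) \<and> finite (?S c) \<and> m = (\<Oplus>\<^bsub>M\<^esub> n \<in> ?S c. c n)"
        and c': "(\<forall>n. c' n \<in> hpart M n) \<and> finite (?S c') \<and> m = (\<Oplus>\<^bsub>M\<^esub> n \<in> ?S c'. c' n)"
      let ?A = "?S c \<union> ?S c'"
      let ?d = "\<lambda>n. c n \<oplus>\<^bsub>M\<^esub> \<ominus>\<^bsub>M\<^esub> c' n"
      note cls = cl[of c] cl[of c']
      have 1: "finsum M c ?A = m"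
        using finsum_nonzero[of ?A c] c c' cls by auto
      have 2: "finsum M c' ?A = m"
        using finsum_nonzero[of ?A c'] c c' cls by auto
      have "finsum M ?d ?A \<oplus>\<^bsub>M\<^esub> finsum M c' ?A = (\<Oplus>\<^bsub>M\<^esub> n \<in> ?A. ?d n \<oplus>\<^bsub>M\<^esub> c' n)"
        using c c' cls by (intro finsum_addf[symmetric]) auto
      also have "\<dots> = finsum M c ?A"
        using c c' cls by (intro finsum_cong') (auto simp: a_assoc l_neg)
      finally have "finsum M ?d ?A \<oplus>\<^bsub>M\<^esub> m = m" using 1 2 by simp
      moreover have "finsum M ?d ?A \<in> carrier M" using c c' cls by (intro finsum_closed) auto
      ultimately have "finsum M ?d ?A = \<zero>\<^bsub>M\<^esub>" using m
        by (simp add: add.r_cancel_one)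
      moreover have "?d n \<in> hpart M n" for n using c c' sub(3,4) by blast
      moreover have "finite ?A" using c c' by blast
      ultimately have "?d n = \<zero>\<^bsub>M\<^esub>" if "n \<in> ?A" for n
        using uniq[rule_format, of ?A ?d n] that by blast
      then have "c n = c' n" if "n \<in> ?A" for n
        using that c c' cls minus_equality[of "c n" "\<ominus>\<^bsub>M\<^esub> c' n"] by simp
      moreover have "c n = c' n" if "n \<notin> ?A" for n using that by simp
      ultimately show "c = c'" by blast
    qed
  qed
qed

text \<open>Degree arguments use additivity alone, so linear forms, restriction maps and
  multiplication by a fixed scalar or a fixed element can be treated alike.\<close>

definition additive_on :: "('a, 'b) graded \<Rightarrow> ('c, 'd) graded \<Rightarrow> ('b \<Rightarrow> 'd) \<Rightarrow> bool" where
  "additive_on M N f \<longleftrightarrow> f \<in> carrier M \<rightarrow> carrier N \<and>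
    (\<forall>m \<in> carrier M. \<forall>m' \<in> carrier M. f (m \<oplus>\<^bsub>M\<^esub> m') = f m \<oplus>\<^bsub>N\<^esub> f m')"

lemma linear_maps_additive: "f \<in> linear_maps R M N \<Longrightarrow> additive_on M N f"
  by (auto simp: linear_maps_def additive_on_def)

lemma graded_hom_linear: "f \<in> graded_hom R M N \<Longrightarrow> f \<in> linear_maps R M N"
  by (simp add: graded_hom_def)

lemmas graded_hom_additive = linear_maps_additive[OF graded_hom_linear]

lemma additive_on_zero:
  assumes "additive_on M N f" "abelian_group M" "abelian_group N"
  shows "f \<zero>\<^bsub>M\<^esub> = \<zero>\<^bsub>N\<^esub>"
proof -
  interpret M: abelian_group M by fact
  interpret N: abelian_group N by fact
  have "f (\<zero>\<^bsub>M\<^esub> \<oplus>\<^bsub>M\<^esub> \<zero>\<^bsub>M\<^esub>) = f \<zero>\<^bsub>M\<^esub> \<oplus>\<^bsub>N\<^esub> f \<zero>\<^bsub>M\<^esub>"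
    using assms(1) M.zero_closed unfolding additive_on_def by blast
  moreover have "f \<zero>\<^bsub>M\<^esub> \<in> carrier N" using assms(1) by (auto simp: additive_on_def)
  ultimately show ?thesis by (simp add: N.add.l_cancel_one')
qed

lemma additive_on_finsum:
  assumes "additive_on M N f" "abelian_group M" "abelian_group N" "g \<in> A \<rightarrow> carrier M"
  shows "f (finsum M g A) = (\<Oplus>\<^bsub>N\<^esub>i\<in>A. f (g i))"
proof -
  interpret M: abelian_group M by fact
  interpret N: abelian_group N by fact
  show ?thesis using assms(4)
  proof (induction A rule: infinite_finite_induct)
    case (insert i A)
    then have "finsum M g A \<in> carrier M" "(\<lambda>i. f (g i)) \<in> A \<rightarrow> carrier N" "f (g i) \<in> carrier N"
      using assms(1) by (auto simp: additive_on_def)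
    moreover have "f (g i \<oplus>\<^bsub>M\<^esub> finsum M g A) = f (g i) \<oplus>\<^bsub>N\<^esub> f (finsum M g A)"
      using assms(1) insert.prems calculation(1) by (auto simp: additive_on_def)
    ultimately show ?case using insert by simp
  qed (simp_all add: additive_on_zero[OF assms(1-3)])
qed

lemma additive_on_gcomp:
  assumes "additive_on M N f" "graded_group M" "graded_group N"
    and "\<And>n. f ` hpart M n \<subseteq> hpart N (n + d)" "m \<in> carrier M"
  shows "f (gcomp M n m) = gcomp N (n + d) (f m)"
proof -
  interpret M: graded_group M by fact
  interpret N: graded_group N by fact
  have f0: "f \<zero>\<^bsub>M\<^esub> = \<zero>\<^bsub>N\<^esub>"
    using additive_on_zero[OF assms(1)] M.abelian_group_axioms N.abelian_group_axioms by blast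
  show ?thesis using assms(5)
  proof (induction m rule: M.graded_induct)
    case (add m m')
    note cl = M.gcomp_closed[OF add(1), of n] M.gcomp_closed[OF add(2), of n]
    have hom: "f (a \<oplus>\<^bsub>M\<^esub> b) = f a \<oplus>\<^bsub>N\<^esub> f b" "f a \<in> carrier N" if "a \<in> carrier M" "b \<in> carrier M" for a b
      using assms(1) that by (auto simp: additive_on_def)
    have "f (gcomp M n (m \<oplus>\<^bsub>M\<^esub> m')) = f (gcomp M n m) \<oplus>\<^bsub>N\<^esub> f (gcomp M n m')"
      by (simp only: M.gcomp_add[OF add(1,2)] hom(1)[OF cl])
    also have "\<dots> = gcomp N (n + d) (f (m \<oplus>\<^bsub>M\<^esub> m'))"
      by (simp only: add(3,4) hom(1)[OF add(1,2)] N.gcomp_add[OF hom(2)[OF add(1,2)] hom(2)[OF add(2,1)]])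
    finally show ?case .
  next
    case (hom k m)
    then have "f m \<in> hpart N (k + d)" using assms(4) by blast
    then show ?case using hom f0 by (simp add: M.gcomp_hom N.gcomp_hom)
  qed
qed

text \<open>Taking components commutes with \<open>f\<close> up to the shift by \<open>d\<close>.
  Components of \<open>f m\<close> outside degree \<open>n + d\<close> vanish, and injectivity
  carries this back to \<open>m\<close>. This is the source of every statement that a quotient by a
  homogeneous element has the expected degree.\<close>

lemma additive_on_reflects_hpart:
  assumes "additive_on M N f" "graded_group M" "graded_group N"
    and "\<And>n. f ` hpart M n \<subseteq> hpart N (n + d)"
    and inj: "\<And>m. m \<in> carrier M \<Longrightarrow> f m = \<zero>\<^bsub>N\<^esub> \<Longrightarrow> m = \<zero>\<^bsub>M\<^esub>"
    and m: "m \<in> carrier M" "f m \<in> hpart N (n + d)"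
  shows "m \<in> hpart M n"
proof -
  interpret M: graded_group M by fact
  interpret N: graded_group N by fact
  show ?thesis
  proof (rule M.gcomp_eq_imp_hpart[OF m(1)])
    fix k assume "k \<noteq> n"
    then have "f (gcomp M k m) = \<zero>\<^bsub>N\<^esub>"
      using additive_on_gcomp[OF assms(1-4) m(1), of k] N.gcomp_hom[OF m(2)] by simp
    then show "gcomp M k m = \<zero>\<^bsub>M\<^esub>" using inj M.gcomp_closed m(1) by blast
  qed
qed

section \<open>Shifts and direct sums\<close>

lemma shift_simps [simp]:
  "carrier (shift M d) = carrier M" "add (shift M d) = add M" "zero (shift M d) = zero M"
  "smult (shift M d) = smult M" "hpart (shift M d) n = hpart M (d + n)"
  "finsum (shift M d) = finsum M" "mult (shift M d) = mult M" "one (shift M d) = one M"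
  by (auto simp: shift_def finsum_def)

lemma abelian_group_shift: "abelian_group (shift M d) = abelian_group M"
  by (simp add: abelian_group_def abelian_monoid_def abelian_group_axioms_def)

lemma graded_group_shift:
  assumes "graded_group M"
  shows "graded_group (shift M d)"
proof -
  interpret graded_group M by fact
  interpret sh: abelian_group "shift M d" by (simp add: abelian_group_shift abelian_group_axioms)
  have a_inv: "a_inv (shift M d) x = a_inv M x" for x by (simp add: a_inv_def)
  have ex: "\<exists>c A. finite A \<and> (\<forall>n. c n \<in> hpart (shift M d) n) \<and> m = finsum (shift M d) c A"
    if "m \<in> carrier (shift M d)" for m
  proof -
    from that have m: "m \<in> carrier M" by simp
    obtain A where A: "finite A" "m = (\<Oplus>\<^bsub>M\<^esub>n\<in>A. gcomp M n m)" "\<And>n. gcomp M n m \<in> hpart M n"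
      using decomposition[OF m] by metis
    have "(\<Oplus>\<^bsub>M\<^esub>n\<in>(\<lambda>n. n - d) ` A. gcomp M (d + n) m) = (\<Oplus>\<^bsub>M\<^esub>n\<in>A. gcomp M (d + (n - d)) m)"
      using A(3) hpart_carrier by (intro finsum_reindex) (auto simp: inj_on_def)
    also have "\<dots> = m" using A(2) by simp
    finally have "m = finsum (shift M d) (\<lambda>n. gcomp M (d + n) m) ((\<lambda>n. n - d) ` A)" by simp
    moreover have "\<forall>n. gcomp M (d + n) m \<in> hpart (shift M d) n" using A(3) by simp
    ultimately show ?thesis using finite_imageI[OF A(1)]
      by (intro exI[of _ "\<lambda>n. gcomp M (d + n) m"] exI[of _ "(\<lambda>n. n - d) ` A"] conjI)
  qed
  have uniq: "\<forall>c A. finite A \<longrightarrow> (\<forall>n. c n \<in> hpart (shift M d) n) \<longrightarrow>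
    finsum (shift M d) c A = \<zero>\<^bsub>shift M d\<^esub> \<longrightarrow> (\<forall>n \<in> A. c n = \<zero>\<^bsub>shift M d\<^esub>)"
  proof (intro allI impI ballI)
    fix c A n
    assume c: "finite A" "\<forall>n. c n \<in> hpart (shift M d) n" "finsum (shift M d) c A = \<zero>\<^bsub>shift M d\<^esub>" "n \<in> A"
    have "c i \<in> hpart M (i + d)" for i
      using c(2)[rule_format, of i] by (simp add: add.commute[of i d])
    \<comment> \<open>Zero is homogeneous of every degree; the choice of \<open>n + 1\<close> leaves
      the component at \<open>n\<close> among those forced to vanish.\<close>
    moreover have "finsum M c A \<in> hpart M ((n + 1) + d)" using c(3) by simp
    ultimately show "c n = \<zero>\<^bsub>shift M d\<^esub>"
      using finsum_hpart_imp_zero[of A c d "n + 1" n] c(1,4) by simp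
  qed
  show ?thesis
  proof (rule graded_groupI[OF sh.abelian_group_axioms _ _ _ _ ex uniq])
    show "hpart (shift M d) n \<subseteq> carrier (shift M d)" for n
      using hpart_carrier by (simp add: subset_iff)
    show "\<ominus>\<^bsub>shift M d\<^esub> x \<in> hpart (shift M d) n" if "x \<in> hpart (shift M d) n" for x n
      using hpart_uminus that by (simp add: a_inv)
  qed (simp_all add: hpart_add)
qed

lemma graded_restrict_simps [simp]:
  "carrier (graded_restrict M U) = U" "add (graded_restrict M U) = add M"
  "zero (graded_restrict M U) = zero M" "smult (graded_restrict M U) = smult M"
  "hpart (graded_restrict M U) n = U \<inter> hpart M n"
  by (auto simp: graded_restrict_def)

lemma direct_sum_simps [simp]:
  "carrier (direct_sum I M) = (\<Pi>\<^sub>E i\<in>I. carrier (M i))"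
  "zero (direct_sum I M) = (\<lambda>i\<in>I. \<zero>\<^bsub>M i\<^esub>)"
  "f \<oplus>\<^bsub>direct_sum I M\<^esub> g = (\<lambda>i\<in>I. f i \<oplus>\<^bsub>M i\<^esub> g i)"
  "a \<odot>\<^bsub>direct_sum I M\<^esub> f = (\<lambda>i\<in>I. a \<odot>\<^bsub>M i\<^esub> f i)"
  "hpart (direct_sum I M) n = (\<Pi>\<^sub>E i\<in>I. hpart (M i) n)"
  by (auto simp: direct_sum_def)

lemma abelian_group_direct_sum:
  assumes "\<And>i. i \<in> I \<Longrightarrow> abelian_group (M i)"
  shows "abelian_group (direct_sum I M)"
proof (rule abelian_groupI)
  fix f assume f: "f \<in> carrier (direct_sum I M)"
  show "\<exists>g\<in>carrier (direct_sum I M). g \<oplus>\<^bsub>direct_sum I M\<^esub> f = \<zero>\<^bsub>direct_sum I M\<^esub>"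
  proof (rule bexI)
    have "\<ominus>\<^bsub>M i\<^esub> f i \<oplus>\<^bsub>M i\<^esub> f i = \<zero>\<^bsub>M i\<^esub>" if "i \<in> I" for i
      using f that by (intro abelian_group.l_neg[OF assms]) auto
    then show "(\<lambda>i\<in>I. \<ominus>\<^bsub>M i\<^esub> f i) \<oplus>\<^bsub>direct_sum I M\<^esub> f = \<zero>\<^bsub>direct_sum I M\<^esub>"
      by (auto intro!: restrict_ext)
    show "(\<lambda>i\<in>I. \<ominus>\<^bsub>M i\<^esub> f i) \<in> carrier (direct_sum I M)"
      using f by (auto intro!: abelian_group.a_inv_closed[OF assms])
  qed
  show "\<zero>\<^bsub>direct_sum I M\<^esub> \<oplus>\<^bsub>direct_sum I M\<^esub> f = f"
    using f by (auto intro!: extensionalityI[of _ I] abelian_groupE(5)[OF assms] simp: PiE_def Pi_iff)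
  fix g assume g: "g \<in> carrier (direct_sum I M)"
  show "f \<oplus>\<^bsub>direct_sum I M\<^esub> g \<in> carrier (direct_sum I M)"
    using f g by (auto intro!: abelian_groupE(1)[OF assms] simp: PiE_iff)
  show "f \<oplus>\<^bsub>direct_sum I M\<^esub> g = g \<oplus>\<^bsub>direct_sum I M\<^esub> f"
    using f g by (auto intro!: restrict_ext abelian_groupE(4)[OF assms] simp: PiE_iff)
  fix h assume h: "h \<in> carrier (direct_sum I M)"
  show "f \<oplus>\<^bsub>direct_sum I M\<^esub> g \<oplus>\<^bsub>direct_sum I M\<^esub> h = f \<oplus>\<^bsub>direct_sum I M\<^esub> (g \<oplus>\<^bsub>direct_sum I M\<^esub> h)"
    using f g h by (auto intro!: restrict_ext abelian_groupE(3)[OF assms] simp: PiE_iff)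
next
  show "\<zero>\<^bsub>direct_sum I M\<^esub> \<in> carrier (direct_sum I M)"
    using abelian_groupE(2)[OF assms] by simp
qed

lemma finsum_direct_sum:
  assumes "\<And>i. i \<in> I \<Longrightarrow> abelian_group (M i)" "f \<in> A \<rightarrow> carrier (direct_sum I M)" "i \<in> I"
  shows "finsum (direct_sum I M) f A i = (\<Oplus>\<^bsub>M i\<^esub>a\<in>A. f a i)"
proof (rule additive_on_finsum[OF _ abelian_group_direct_sum[OF assms(1)] assms(1)[OF assms(3)] assms(2)])
  show "additive_on (direct_sum I M) (M i) (\<lambda>f. f i)"
    using assms(3) by (auto simp: additive_on_def)
qed

lemma a_inv_direct_sum:
  assumes "\<And>i. i \<in> I \<Longrightarrow> abelian_group (M i)" "f \<in> carrier (direct_sum I M)"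
  shows "\<ominus>\<^bsub>direct_sum I M\<^esub> f = (\<lambda>i\<in>I. \<ominus>\<^bsub>M i\<^esub> f i)"
proof -
  interpret abelian_group "direct_sum I M" by (rule abelian_group_direct_sum[OF assms(1)])
  show ?thesis
  proof (rule minus_equality)
    have "\<ominus>\<^bsub>M i\<^esub> f i \<oplus>\<^bsub>M i\<^esub> f i = \<zero>\<^bsub>M i\<^esub>" if "i \<in> I" for i
      using assms(2) that by (intro abelian_group.l_neg[OF assms(1)]) auto
    then show "(\<lambda>i\<in>I. \<ominus>\<^bsub>M i\<^esub> f i) \<oplus>\<^bsub>direct_sum I M\<^esub> f = \<zero>\<^bsub>direct_sum I M\<^esub>"
      by (auto intro!: restrict_ext)
    show "(\<lambda>i\<in>I. \<ominus>\<^bsub>M i\<^esub> f i) \<in> carrier (direct_sum I M)"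
      using assms(2) by (auto intro!: abelian_group.a_inv_closed[OF assms(1)])
  qed (rule assms(2))
qed

lemma graded_group_direct_sum:
  assumes "finite I" "\<And>i. i \<in> I \<Longrightarrow> graded_group (M i)"
  shows "graded_group (direct_sum I M)"
proof -
  note gg = assms(2)
  have ab: "\<And>i. i \<in> I \<Longrightarrow> abelian_group (M i)" using gg graded_group.axioms(1) by blast
  let ?D = "direct_sum I M"
  interpret D: abelian_group ?D by (rule abelian_group_direct_sum[OF ab])
  have sub: "hpart ?D n \<subseteq> carrier ?D" for n
    using graded_group.hpart_carrier[OF gg] by (auto simp: PiE_iff)
  have ex: "\<exists>c A. finite A \<and> (\<forall>n. c n \<in> hpart ?D n) \<and> m = finsum ?D c A" if m: "m \<in> carrier ?D" for m
  proof -
    have mi: "m i \<in> carrier (M i)" if "i \<in> I" for i using m that by auto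
    have "\<exists>A. finite A \<and> (\<forall>n. n \<notin> A \<longrightarrow> gcomp (M i) n (m i) = \<zero>\<^bsub>M i\<^esub>) \<and>
      m i = (\<Oplus>\<^bsub>M i\<^esub>n\<in>A. gcomp (M i) n (m i))" if "i \<in> I" for i
      using graded_group.decomposition[OF gg[OF that] mi[OF that]] by metis
    then obtain A where A: "\<And>i. i \<in> I \<Longrightarrow> finite (A i)"
      "\<And>i n. i \<in> I \<Longrightarrow> n \<notin> A i \<Longrightarrow> gcomp (M i) n (m i) = \<zero>\<^bsub>M i\<^esub>"
      "\<And>i. i \<in> I \<Longrightarrow> m i = (\<Oplus>\<^bsub>M i\<^esub>n\<in>A i. gcomp (M i) n (m i))" by metis
    define c where "c n = (\<lambda>i\<in>I. gcomp (M i) n (m i))" for n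
    have c: "c n \<in> hpart ?D n" for n
      using graded_group.gcomp_hpart[OF gg mi] by (simp add: c_def)
    \<comment> \<open>Finiteness of \<open>I\<close> bounds the degrees that occur in all
      coordinates simultaneously.\<close>
    have fin: "finite (\<Union>i\<in>I. A i)" using assms(1) A(1) by blast
    have "finsum ?D c (\<Union>i\<in>I. A i) = m"
    proof (rule PiE_ext)
      have "c \<in> (\<Union>i\<in>I. A i) \<rightarrow> carrier ?D" using c sub by blast
      then have "finsum ?D c (\<Union>i\<in>I. A i) \<in> carrier ?D" by (rule D.finsum_closed)
      then show "finsum ?D c (\<Union>i\<in>I. A i) \<in> (\<Pi>\<^sub>E i\<in>I. carrier (M i))" by simp
      show "m \<in> (\<Pi>\<^sub>E i\<in>I. carrier (M i))" using m by simp
      fix i assume i: "i \<in> I"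
      interpret Mi: graded_group "M i" by (rule gg[OF i])
      have "finsum ?D c (\<Union>i\<in>I. A i) i = (\<Oplus>\<^bsub>M i\<^esub>n\<in>(\<Union>i\<in>I. A i). c n i)"
      proof (intro finsum_direct_sum ab i Pi_I)
        show "c n \<in> carrier ?D" for n using c[of n] sub[of n] by (rule subsetD[rotated])
      qed
      also have "\<dots> = (\<Oplus>\<^bsub>M i\<^esub>n\<in>(\<Union>i\<in>I. A i). gcomp (M i) n (m i))"
        using i by (simp add: c_def)
      also have "\<dots> = (\<Oplus>\<^bsub>M i\<^esub>n\<in>A i. gcomp (M i) n (m i))"
        using i A(2)[OF i] fin Mi.gcomp_closed[OF mi[OF i]]
        by (intro Mi.add.finprod_mono_neutral_cong_right) auto
      also have "\<dots> = m i" by (rule A(3)[OF i, symmetric])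
      finally show "finsum ?D c (\<Union>i\<in>I. A i) i = m i" .
    qed
    then show ?thesis using c fin by (intro exI[of _ c] exI[of _ "\<Union>i\<in>I. A i"]) simp
  qed
  have uniq: "\<forall>c A. finite A \<longrightarrow> (\<forall>n. c n \<in> hpart ?D n) \<longrightarrow> finsum ?D c A = \<zero>\<^bsub>?D\<^esub> \<longrightarrow>
      (\<forall>n \<in> A. c n = \<zero>\<^bsub>?D\<^esub>)"
  proof (intro allI impI ballI)
    fix c A n
    assume c: "finite A" "\<forall>n. c n \<in> hpart ?D n" "finsum ?D c A = \<zero>\<^bsub>?D\<^esub>" "n \<in> A"
    have "c n i = \<zero>\<^bsub>M i\<^esub>" if i: "i \<in> I" for i
    proof -
      interpret Mi: graded_group "M i" by (rule gg[OF i])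
      have ch: "c k i \<in> hpart (M i) (k + 0)" for k using c(2)[rule_format, of k] i by auto
      have "(\<Oplus>\<^bsub>M i\<^esub>n\<in>A. c n i) = finsum ?D c A i"
      proof (intro finsum_direct_sum[symmetric] ab i Pi_I)
        show "c n \<in> carrier ?D" for n using c(2)[rule_format, of n] sub[of n] by (rule subsetD[rotated])
      qed
      then have "(\<Oplus>\<^bsub>M i\<^esub>n\<in>A. c n i) \<in> hpart (M i) (n + 1 + 0)" using c(3) i by simp
      from Mi.finsum_hpart_imp_zero[OF c(1) ch this c(4)] show ?thesis by simp
    qed
    moreover have "c n \<in> extensional I" using c(2)[rule_format, of n] by (auto simp: PiE_def)
    ultimately show "c n = \<zero>\<^bsub>?D\<^esub>" by (auto intro!: extensionalityI[of _ I])
  qed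
  show ?thesis
  proof (rule graded_groupI[OF D.abelian_group_axioms sub _ _ _ ex uniq])
    show "\<zero>\<^bsub>?D\<^esub> \<in> hpart ?D n" for n
      using graded_group.hpart_zero[OF gg] by simp
    show "x \<oplus>\<^bsub>?D\<^esub> y \<in> hpart ?D n" if "x \<in> hpart ?D n" "y \<in> hpart ?D n" for n x y
      using that graded_group.hpart_add[OF gg] by (simp add: PiE_iff)
    show "\<ominus>\<^bsub>?D\<^esub> x \<in> hpart ?D n" if x: "x \<in> hpart ?D n" for n x
    proof -
      have "x \<in> carrier ?D" using x sub by blast
      then show ?thesis
        using x graded_group.hpart_uminus[OF gg] by (simp only: a_inv_direct_sum[OF ab]) (simp add: PiE_iff)
    qed
  qed
qed

section \<open>Modules over a non-negatively graded domain\<close>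

lemma (in abelian_monoid) finsum_mem:
  assumes "W \<subseteq> carrier G" "\<zero> \<in> W" "\<And>u v. u \<in> W \<Longrightarrow> v \<in> W \<Longrightarrow> u \<oplus> v \<in> W"
    and "\<And>b. b \<in> B \<Longrightarrow> g b \<in> W"
  shows "finsum G g B \<in> W"
  using assms(4)
proof (induction B rule: infinite_finite_induct)
  case (insert b B)
  then have "g \<in> B \<rightarrow> carrier G" "g b \<in> carrier G" using assms(1) by auto
  with insert assms(3) show ?case by simp
qed (simp_all add: assms(2))

text \<open>The features of the symmetric algebra on which the module theory rests. Degree 0 is a
  field, which is how the ground field enters: a nonzero scalar of degree 0 can be divided
  by.\<close>

locale graded_domain = domain S for S :: "('a, 'a) graded" (structure) +
  assumes smult_S: "smult S = mult S"
    and grading_S: "is_grading S"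
    and hpart_mult: "a \<in> hpart S i \<Longrightarrow> b \<in> hpart S j \<Longrightarrow> a \<otimes> b \<in> hpart S (i + j)"
    and hpart_neg: "n < 0 \<Longrightarrow> hpart S n = {\<zero>}"
    and one_hpart: "\<one> \<in> hpart S 0"
    and hpart_0_inv: "a \<in> hpart S 0 \<Longrightarrow> a \<noteq> \<zero> \<Longrightarrow> \<exists>b \<in> hpart S 0. b \<otimes> a = \<one>"

sublocale graded_domain \<subseteq> S: graded_group S
  by unfold_locales (rule grading_S)

locale graded_mod = graded_domain S for S (structure) and M :: "('a, 'b) graded" (structure) +
  assumes graded_module: "graded_module S M"

sublocale graded_mod \<subseteq> M: module S M
  using graded_module by (simp add: graded_module_def)

sublocale graded_mod \<subseteq> M: graded_group M
  using graded_module by unfold_locales (simp add: graded_module_def)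

context graded_domain
begin

lemma graded_modI: "graded_module S M \<Longrightarrow> graded_mod S M"
  by unfold_locales

lemma graded_module_S: "graded_module S S"
  unfolding graded_module_def
proof (intro conjI grading_S ballI allI)
  show "Module.module S S"
    by (rule moduleI) (auto simp: smult_S is_cring abelian_group_axioms l_distr r_distr m_assoc)
qed (simp add: smult_S hpart_mult)

lemma graded_module_shift:
  assumes "graded_module S M"
  shows "graded_module S (shift M d)"
proof -
  interpret graded_mod S M by (rule graded_modI) fact
  have "Module.module S (shift M d)"
    by (rule moduleI)
      (auto simp: is_cring abelian_group_shift M.abelian_group_axioms M.smult_l_distr
        M.smult_r_distr M.smult_assoc1)
  moreover have "is_grading (shift M d)"
    using graded_group_shift[OF M.graded_group_axioms] by (simp add: graded_group_def graded_group_axioms_def)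
  moreover have "a \<odot>\<^bsub>M\<^esub> m \<in> hpart M (d + (i + j))" if "a \<in> hpart S i" "m \<in> hpart M (d + j)" for i j a m
    using graded_module that unfolding graded_module_def by (metis add.left_commute)
  ultimately show ?thesis by (simp add: graded_module_def)
qed

lemma graded_module_direct_sum:
  assumes "finite I" "\<And>i. i \<in> I \<Longrightarrow> graded_module S (M i)"
  shows "graded_module S (direct_sum I M)"
proof -
  have mod: "Module.module S (M i)" if "i \<in> I" for i
    using assms(2)[OF that] by (simp add: graded_module_def)
  have gg: "graded_group (M i)" if "i \<in> I" for i
  proof -
    interpret graded_mod S "M i" by (rule graded_modI[OF assms(2)[OF that]])
    show ?thesis by (rule M.graded_group_axioms)
  qed
  have D: "graded_group (direct_sum I M)" by (rule graded_group_direct_sum[OF assms(1) gg])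
  have "Module.module S (direct_sum I M)"
  proof (rule moduleI)
    show "abelian_group (direct_sum I M)" using D graded_group.axioms(1) by blast
  next
    fix a x assume a: "a \<in> carrier S" and x: "x \<in> carrier (direct_sum I M)"
    show "a \<odot>\<^bsub>direct_sum I M\<^esub> x \<in> carrier (direct_sum I M)"
      using a x module.smult_closed[OF mod] by (simp add: PiE_iff)
    fix b assume b: "b \<in> carrier S"
    show "(a \<oplus> b) \<odot>\<^bsub>direct_sum I M\<^esub> x = a \<odot>\<^bsub>direct_sum I M\<^esub> x \<oplus>\<^bsub>direct_sum I M\<^esub> b \<odot>\<^bsub>direct_sum I M\<^esub> x"
      using a b x module.smult_l_distr[OF mod] by (auto intro!: restrict_ext simp: PiE_iff)
    show "(a \<otimes> b) \<odot>\<^bsub>direct_sum I M\<^esub> x = a \<odot>\<^bsub>direct_sum I M\<^esub> (b \<odot>\<^bsub>direct_sum I M\<^esub> x)"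
      using a b x module.smult_assoc1[OF mod] by (auto intro!: restrict_ext simp: PiE_iff)
  next
    fix x assume x: "x \<in> carrier (direct_sum I M)"
    show "\<one> \<odot>\<^bsub>direct_sum I M\<^esub> x = x"
      using x module.smult_one[OF mod] by (auto intro!: extensionalityI[of _ I] simp: PiE_iff)
  next
    fix a x y assume a: "a \<in> carrier S" and x: "x \<in> carrier (direct_sum I M)" and y: "y \<in> carrier (direct_sum I M)"
    show "a \<odot>\<^bsub>direct_sum I M\<^esub> (x \<oplus>\<^bsub>direct_sum I M\<^esub> y) =
      a \<odot>\<^bsub>direct_sum I M\<^esub> x \<oplus>\<^bsub>direct_sum I M\<^esub> a \<odot>\<^bsub>direct_sum I M\<^esub> y"
      using a x y module.smult_r_distr[OF mod] by (auto intro!: restrict_ext simp: PiE_iff)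
  qed (rule is_cring)
  moreover have "a \<odot>\<^bsub>M k\<^esub> m \<in> hpart (M k) (i + j)"
    if "k \<in> I" "a \<in> hpart S i" "m \<in> hpart (M k) j" for i j a m k
    using assms(2)[OF that(1)] that unfolding graded_module_def by blast
  ultimately show ?thesis
    using graded_group.grading[OF D] unfolding graded_module_def by (simp add: PiE_iff)
qed

end

context graded_mod
begin

lemma smult_hpart: "a \<in> hpart S i \<Longrightarrow> m \<in> hpart M j \<Longrightarrow> a \<odot>\<^bsub>M\<^esub> m \<in> hpart M (i + j)"
  using graded_module unfolding graded_module_def by blast

lemma gcomp_smult_left:
  assumes "a \<in> hpart S i" "m \<in> carrier M"
  shows "gcomp M (n + i) (a \<odot>\<^bsub>M\<^esub> m) = a \<odot>\<^bsub>M\<^esub> gcomp M n m"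
proof (rule additive_on_gcomp[symmetric, OF _ M.graded_group_axioms M.graded_group_axioms _ assms(2)])
  show "additive_on M M (\<lambda>m. a \<odot>\<^bsub>M\<^esub> m)"
    using S.hpart_carrier[OF assms(1)] by (auto simp: additive_on_def M.smult_r_distr)
  show "(\<lambda>m. a \<odot>\<^bsub>M\<^esub> m) ` hpart M n \<subseteq> hpart M (n + i)" for n
    using smult_hpart[OF assms(1), of _ n] by (auto simp: add.commute[of n i])
qed

lemma gcomp_smult_right:
  assumes "s \<in> carrier S" "m \<in> hpart M d"
  shows "gcomp M (n + d) (s \<odot>\<^bsub>M\<^esub> m) = gcomp S n s \<odot>\<^bsub>M\<^esub> m"
proof (rule additive_on_gcomp[symmetric, OF _ S.graded_group_axioms M.graded_group_axioms _ assms(1)])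
  show "additive_on S M (\<lambda>s. s \<odot>\<^bsub>M\<^esub> m)"
    using M.hpart_carrier[OF assms(2)] by (auto simp: additive_on_def M.smult_l_distr)
  show "(\<lambda>s. s \<odot>\<^bsub>M\<^esub> m) ` hpart S n \<subseteq> hpart M (n + d)" for n
    using smult_hpart[OF _ assms(2)] by auto
qed

text \<open>A graded submodule assembled from its homogeneous parts, so that minimality of a
  projective cover can be tested one degree at a time. Closure under scalars is checked on
  homogeneous ones, where the component of \<open>a v\<close> in degree \<open>n\<close> comes from
  the component of \<open>v\<close> in degree \<open>n - i\<close>.\<close>

lemma submodule_of_family:
  assumes U: "\<And>n. U n \<subseteq> hpart M n" "\<And>n. \<zero>\<^bsub>M\<^esub> \<in> U n"
    "\<And>n u v. u \<in> U n \<Longrightarrow> v \<in> U n \<Longrightarrow> u \<oplus>\<^bsub>M\<^esub> v \<in> U n"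
    "\<And>i n a u. a \<in> hpart S i \<Longrightarrow> u \<in> U n \<Longrightarrow> a \<odot>\<^bsub>M\<^esub> u \<in> U (i + n)"
  defines "V \<equiv> {m \<in> carrier M. \<forall>n. gcomp M n m \<in> U n}"
  shows "graded_submodule S M V"
proof -
  have Vc: "V \<subseteq> carrier M" by (auto simp: V_def)
  have U_V: "u \<in> V" if "u \<in> U n" for u n
  proof -
    have "u \<in> hpart M n" using that U(1) by blast
    then show ?thesis using that U(2) M.hpart_carrier by (simp add: V_def M.gcomp_hom)
  qed
  have Vadd: "u \<oplus>\<^bsub>M\<^esub> v \<in> V" if "u \<in> V" "v \<in> V" for u v
    using that U(3) by (simp add: V_def M.gcomp_add)
  have Vsmult: "a \<odot>\<^bsub>M\<^esub> v \<in> V" if "a \<in> carrier S" "v \<in> V" for a v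
    using that(1)
  proof (induction a rule: S.graded_induct)
    case (add a b)
    then show ?case using that(2) Vadd Vc by (auto simp: M.smult_l_distr)
  next
    case (hom i a)
    have "gcomp M n (a \<odot>\<^bsub>M\<^esub> v) \<in> U n" for n
      using gcomp_smult_left[OF hom, of v "n - i"] U(4)[OF hom, of "gcomp M (n - i) v" "n - i"] that(2)
      by (simp add: V_def)
    then show ?case using that(2) S.hpart_carrier[OF hom] by (simp add: V_def)
  qed
  have Vz: "\<zero>\<^bsub>M\<^esub> \<in> V" using U_V U(2) by blast
  have sub: "submodule V S M"
  proof (rule M.submoduleI[OF Vc Vz _ Vadd Vsmult])
    fix v assume v: "v \<in> V"
    then have "v \<in> carrier M" using Vc by blast
    then have "\<ominus>\<^bsub>M\<^esub> v = (\<ominus> \<one>) \<odot>\<^bsub>M\<^esub> v" by (simp add: M.smult_l_minus)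
    then show "\<ominus>\<^bsub>M\<^esub> v \<in> V" using Vsmult v by simp
  qed
  let ?R = "graded_restrict M V"
  have "Module.module S (M\<lparr>carrier := V\<rparr>)" by (rule submodule.submodule_is_module[OF sub M.module_axioms])
  then have "abelian_group (M\<lparr>carrier := V\<rparr>)" by (rule Module.module.axioms)
  then interpret R: abelian_group ?R
    by (simp add: abelian_group_def abelian_monoid_def abelian_group_axioms_def)
  have fs: "finsum ?R c A = finsum M c A" if "c \<in> A \<rightarrow> V" for c and A :: "int set"
    using that
  proof (induction A rule: infinite_finite_induct)
    case (insert i A)
    then have "c \<in> A \<rightarrow> carrier M" "c i \<in> carrier M" using Vc by auto
    with insert show ?case by simp
  qed simp_all
  have ai: "\<ominus>\<^bsub>?R\<^esub> v = \<ominus>\<^bsub>M\<^esub> v" if "v \<in> V" for v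
  proof (rule R.minus_equality)
    show "\<ominus>\<^bsub>M\<^esub> v \<oplus>\<^bsub>?R\<^esub> v = \<zero>\<^bsub>?R\<^esub>" using that Vc by (auto simp: M.l_neg)
    show "\<ominus>\<^bsub>M\<^esub> v \<in> carrier ?R" using M.submoduleE(3)[OF sub that] by simp
  qed (use that in simp)
  have ex: "\<exists>c A. finite A \<and> (\<forall>n. c n \<in> hpart ?R n) \<and> m = finsum ?R c A" if m: "m \<in> carrier ?R" for m
  proof -
    have m': "m \<in> carrier M" "\<And>n. gcomp M n m \<in> U n" using m by (auto simp: V_def)
    obtain A where A: "finite A" "m = (\<Oplus>\<^bsub>M\<^esub>n\<in>A. gcomp M n m)"
      using M.decomposition[OF m'(1)] by metis
    have h: "\<forall>n. gcomp M n m \<in> hpart ?R n" using m'(2) U_V U(1) by (simp add: subset_iff) blast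
    then have "finsum ?R (\<lambda>n. gcomp M n m) A = m" using A(2) by (subst fs) auto
    with h A(1) show ?thesis by (intro exI[of _ "\<lambda>n. gcomp M n m"] exI[of _ A]) simp
  qed
  have uniq: "\<forall>c A. finite A \<longrightarrow> (\<forall>n. c n \<in> hpart ?R n) \<longrightarrow> finsum ?R c A = \<zero>\<^bsub>?R\<^esub> \<longrightarrow>
      (\<forall>n \<in> A. c n = \<zero>\<^bsub>?R\<^esub>)"
  proof (intro allI impI ballI)
    fix c A n
    assume c: "finite A" "\<forall>n. c n \<in> hpart ?R n" "finsum ?R c A = \<zero>\<^bsub>?R\<^esub>" "n \<in> A"
    have "finsum M c A \<in> hpart M (n + 1 + 0)" using c(2,3) by (subst fs[symmetric]) auto
    moreover have "c k \<in> hpart M (k + 0)" for k using c(2) by simp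
    ultimately show "c n = \<zero>\<^bsub>?R\<^esub>"
      using M.finsum_hpart_imp_zero[of A c 0 "n + 1" n] c(1,4) by simp
  qed
  have "graded_group ?R"
  proof (rule graded_groupI[OF R.abelian_group_axioms _ _ _ _ ex uniq])
    show "x \<oplus>\<^bsub>?R\<^esub> y \<in> hpart ?R n" if "x \<in> hpart ?R n" "y \<in> hpart ?R n" for n x y
      using that Vadd M.hpart_add by simp
    show "\<ominus>\<^bsub>?R\<^esub> x \<in> hpart ?R n" if "x \<in> hpart ?R n" for n x
      using that M.hpart_uminus M.submoduleE(3)[OF sub] by (simp add: ai)
  qed (use Vz in auto)
  then show ?thesis using sub by (simp add: graded_submodule_def graded_group_def graded_group_axioms_def)
qed

end

section \<open>Projective covers and projective modules\<close>

context graded_domain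
begin

text \<open>Since \<open>f\<close> is additive, reaching the images of homogeneous elements reaches
  all of them, and minimality of the cover leaves no room outside the submodule assembled from
  \<open>U\<close>. This form of minimality is applied three times: to non-negative degrees, to
  multiples of \<beta> in degree 0, and to multiples of \<beta> in all degrees.\<close>

lemma projective_cover_family:
  assumes cover: "projective_cover S P Q f"
    and U: "\<And>n. U n \<subseteq> hpart P n" "\<And>n. \<zero>\<^bsub>P\<^esub> \<in> U n"
    "\<And>n u v. u \<in> U n \<Longrightarrow> v \<in> U n \<Longrightarrow> u \<oplus>\<^bsub>P\<^esub> v \<in> U n"
    "\<And>i n a u. a \<in> hpart S i \<Longrightarrow> u \<in> U n \<Longrightarrow> a \<odot>\<^bsub>P\<^esub> u \<in> U (i + n)"
    and lift: "\<And>n p. p \<in> hpart P n \<Longrightarrow> \<exists>u \<in> U n. f p = f u"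
  shows "U n = hpart P n"
proof -
  have "graded_module S P" using cover by (simp add: projective_cover_def graded_projective_def)
  then interpret P: graded_mod S P by (rule graded_modI)
  define V where "V = {m \<in> carrier P. \<forall>n. gcomp P n m \<in> U n}"
  have V: "graded_submodule S P V"
    unfolding V_def by (rule P.submodule_of_family) (fact U)+
  have hom: "f (m \<oplus>\<^bsub>P\<^esub> m') = f m \<oplus>\<^bsub>Q\<^esub> f m'" if "m \<in> carrier P" "m' \<in> carrier P" for m m'
    using cover that by (simp add: projective_cover_def graded_hom_def linear_maps_def)
  have "\<exists>v \<in> V. f p = f v" if "p \<in> carrier P" for p
    using that
  proof (induction p rule: P.M.graded_induct)
    case (add m m')
    then obtain v v' where v: "v \<in> V" "v' \<in> V" "f m = f v" "f m' = f v'" by blast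
    then have "v \<oplus>\<^bsub>P\<^esub> v' \<in> V" using U(3) by (simp add: V_def P.M.gcomp_add)
    moreover have "f (m \<oplus>\<^bsub>P\<^esub> m') = f (v \<oplus>\<^bsub>P\<^esub> v')"
      using add v by (simp add: hom V_def)
    ultimately show ?case by blast
  next
    case (hom n p)
    then obtain u where u: "u \<in> U n" "f p = f u" using lift by blast
    then have "u \<in> hpart P n" using U(1) by blast
    then have "u \<in> V" using u(1) U(2) P.M.hpart_carrier by (simp add: V_def P.M.gcomp_hom)
    then show ?case using u by blast
  qed
  then have "f ` carrier P \<subseteq> f ` V" by blast
  moreover have "f ` V \<subseteq> f ` carrier P" by (auto simp: V_def)
  ultimately have "f ` V = carrier Q" using cover by (simp add: projective_cover_def)
  then have VP: "V = carrier P" using cover V by (simp add: projective_cover_def)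
  have "p \<in> U n" if "p \<in> hpart P n" for p
  proof -
    have "p \<in> V" using that P.M.hpart_carrier VP by blast
    then have "gcomp P n p \<in> U n" by (simp add: V_def)
    then show ?thesis using that by (simp add: P.M.gcomp_hom)
  qed
  then show ?thesis using U(1) by blast
qed

text \<open>The components of finitely many generators. Generation is expressed by closed sets
  \<open>W\<close> because it is applied to the image of a homomorphism, whose closure properties
  are immediate.\<close>

lemma homogeneous_generators:
  assumes "graded_module S P" "finitely_generated S P"
  obtains A e where "finite A" "\<And>a. a \<in> A \<Longrightarrow> a \<in> hpart P (e a)"
    "\<And>W. W \<subseteq> carrier P \<Longrightarrow> A \<subseteq> W \<Longrightarrow> \<zero>\<^bsub>P\<^esub> \<in> W \<Longrightarrow> (\<And>u v. u \<in> W \<Longrightarrow> v \<in> W \<Longrightarrow> u \<oplus>\<^bsub>P\<^esub> v \<in> W) \<Longrightarrow>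
      (\<And>a u. a \<in> carrier S \<Longrightarrow> u \<in> W \<Longrightarrow> a \<odot>\<^bsub>P\<^esub> u \<in> W) \<Longrightarrow> W = carrier P"
proof -
  interpret P: graded_mod S P by (rule graded_modI) fact
  obtain A where A: "finite A" "A \<subseteq> carrier P"
    "\<forall>m \<in> carrier P. \<exists>c \<in> A \<rightarrow> carrier S. m = (\<Oplus>\<^bsub>P\<^esub> a\<in>A. c a \<odot>\<^bsub>P\<^esub> a)"
    using assms(2) by (auto simp: finitely_generated_def)
  have "\<exists>N. finite N \<and> a = (\<Oplus>\<^bsub>P\<^esub>n\<in>N. gcomp P n a)" if "a \<in> carrier P" for a
    using P.M.decomposition[OF that] by metis
  then obtain N where N: "\<And>a. a \<in> carrier P \<Longrightarrow> finite (N a)"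
    "\<And>a. a \<in> carrier P \<Longrightarrow> a = (\<Oplus>\<^bsub>P\<^esub>n\<in>N a. gcomp P n a)" by metis
  define A' where "A' = (\<Union>a\<in>A. (\<lambda>n. gcomp P n a) ` N a)"
  have "\<exists>n. b \<in> hpart P n" if "b \<in> A'" for b
    using that A(2) P.M.gcomp_hpart by (auto simp: A'_def)
  then obtain e where e: "\<And>b. b \<in> A' \<Longrightarrow> b \<in> hpart P (e b)" by metis
  have "W = carrier P"
    if W: "W \<subseteq> carrier P" "A' \<subseteq> W" "\<zero>\<^bsub>P\<^esub> \<in> W" "\<And>u v. u \<in> W \<Longrightarrow> v \<in> W \<Longrightarrow> u \<oplus>\<^bsub>P\<^esub> v \<in> W"
      "\<And>a u. a \<in> carrier S \<Longrightarrow> u \<in> W \<Longrightarrow> a \<odot>\<^bsub>P\<^esub> u \<in> W" for W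
  proof -
    note fs = P.M.finsum_mem[where W = W, OF W(1,3,4)]
    have AW: "a \<in> W" if a: "a \<in> A" for a
    proof -
      have "gcomp P n a \<in> W" if "n \<in> N a" for n using that a W(2) by (auto simp: A'_def)
      then have "(\<Oplus>\<^bsub>P\<^esub>n\<in>N a. gcomp P n a) \<in> W" by (intro fs)
      then show ?thesis using N(2)[of a] a A(2) by auto
    qed
    have "m \<in> W" if m: "m \<in> carrier P" for m
    proof -
      obtain c where c: "c \<in> A \<rightarrow> carrier S" "m = (\<Oplus>\<^bsub>P\<^esub> a\<in>A. c a \<odot>\<^bsub>P\<^esub> a)" using A(3) m by blast
      have "(\<Oplus>\<^bsub>P\<^esub> a\<in>A. c a \<odot>\<^bsub>P\<^esub> a) \<in> W" using c(1) AW W(5) by (intro fs) auto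
      then show ?thesis using c(2) by simp
    qed
    then show ?thesis using W(1) by blast
  qed
  moreover have "finite A'" using A(1,2) N(1) by (auto simp: A'_def)
  ultimately show ?thesis using that[of A' e] e by blast
qed

text \<open>Lifting the identity along the surjection from the free module on homogeneous generators.\<close>

lemma projective_dual_basis:
  fixes P :: "('a, 'b) graded"
  assumes "graded_projective S P" "finitely_generated S P"
  obtains A :: "'b set" and e \<phi> where "finite A" "A \<subseteq> carrier P"
    "\<forall>a \<in> A. \<phi> a \<in> graded_hom S P (shift S (e a))"
    "\<forall>p \<in> carrier P. p = (\<Oplus>\<^bsub>P\<^esub>a\<in>A. \<phi> a p \<odot>\<^bsub>P\<^esub> a)"
proof -
  have gP: "graded_module S P" using assms(1) by (simp add: graded_projective_def)
  interpret P: graded_mod S P by (rule graded_modI) fact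
  obtain A e where A: "finite A" "\<And>a. a \<in> A \<Longrightarrow> a \<in> hpart P (e a)"
    and gen: "\<And>W. W \<subseteq> carrier P \<Longrightarrow> A \<subseteq> W \<Longrightarrow> \<zero>\<^bsub>P\<^esub> \<in> W \<Longrightarrow> (\<And>u v. u \<in> W \<Longrightarrow> v \<in> W \<Longrightarrow> u \<oplus>\<^bsub>P\<^esub> v \<in> W) \<Longrightarrow>
      (\<And>a u. a \<in> carrier S \<Longrightarrow> u \<in> W \<Longrightarrow> a \<odot>\<^bsub>P\<^esub> u \<in> W) \<Longrightarrow> W = carrier P"
    by (rule homogeneous_generators[OF gP assms(2)]) blast
  have Ac: "a \<in> carrier P" if "a \<in> A" for a using A(2)[OF that] P.M.hpart_carrier by blast
  \<comment> \<open>The shift by \<open>- e a\<close> puts the basis vector at \<open>a\<close> into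
    degree \<open>e a\<close>, the degree of the generator it is sent to. Elements of
    \<open>F\<close> are functions from the type of \<open>P\<close> to \<open>S\<close>, the type
    of test modules in \<open>graded_projective\<close>.\<close>
  define F where "F = direct_sum A (\<lambda>a. shift S (- e a))"
  have F: "graded_module S F"
    unfolding F_def by (intro graded_module_direct_sum A graded_module_shift graded_module_S)
  interpret F: graded_mod S F by (rule graded_modI[OF F])
  have Fc: "u a \<in> carrier S" if "u \<in> carrier F" "a \<in> A" for u a using that by (auto simp: F_def)
  define g where "g u = (\<Oplus>\<^bsub>P\<^esub>a\<in>A. u a \<odot>\<^bsub>P\<^esub> a)" for u
  have g_closed: "g u \<in> carrier P" if "u \<in> carrier F" for u
    unfolding g_def using Fc[OF that] Ac by (intro P.M.finsum_closed) auto
  have g_add: "g (u \<oplus>\<^bsub>F\<^esub> v) = g u \<oplus>\<^bsub>P\<^esub> g v" if "u \<in> carrier F" "v \<in> carrier F" for u v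
  proof -
    have "g (u \<oplus>\<^bsub>F\<^esub> v) = (\<Oplus>\<^bsub>P\<^esub>a\<in>A. u a \<odot>\<^bsub>P\<^esub> a \<oplus>\<^bsub>P\<^esub> v a \<odot>\<^bsub>P\<^esub> a)"
      unfolding g_def using Fc[OF that(1)] Fc[OF that(2)] Ac
      by (intro P.M.finsum_cong') (auto simp: F_def P.M.smult_l_distr)
    also have "\<dots> = g u \<oplus>\<^bsub>P\<^esub> g v"
      unfolding g_def using Fc[OF that(1)] Fc[OF that(2)] Ac by (intro P.M.finsum_addf) auto
    finally show ?thesis .
  qed
  have g_smult: "g (s \<odot>\<^bsub>F\<^esub> u) = s \<odot>\<^bsub>P\<^esub> g u" if "s \<in> carrier S" "u \<in> carrier F" for s u
  proof -
    have "s \<odot>\<^bsub>P\<^esub> g u = (\<Oplus>\<^bsub>P\<^esub>a\<in>A. s \<odot>\<^bsub>P\<^esub> (u a \<odot>\<^bsub>P\<^esub> a))"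
      unfolding g_def using Fc[OF that(2)] Ac that(1) A(1) by (intro P.M.finsum_smult_ldistr) auto
    also have "\<dots> = g (s \<odot>\<^bsub>F\<^esub> u)"
      unfolding g_def using Fc[OF that(2)] Ac that(1)
      by (intro P.M.finsum_cong') (auto simp: F_def P.M.smult_assoc1 smult_S)
    finally show ?thesis by simp
  qed
  have g_hpart: "g u \<in> hpart P n" if u: "u \<in> hpart F n" for u n
    unfolding g_def
  proof (rule P.M.hpart_finsum)
    fix a assume a: "a \<in> A"
    then have "u a \<in> hpart S (- e a + n)" using u by (auto simp: F_def)
    from P.smult_hpart[OF this A(2)[OF a]] show "u a \<odot>\<^bsub>P\<^esub> a \<in> hpart P n" by simp
  qed
  have g_hom: "g \<in> graded_hom S F P"
    unfolding graded_hom_def linear_maps_def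
    using g_closed g_add g_smult g_hpart by (simp add: image_subset_iff)
  have "g ` carrier F = carrier P"
  proof (rule gen)
    show "g ` carrier F \<subseteq> carrier P" using g_closed by blast
    show "A \<subseteq> g ` carrier F"
    proof
      fix a assume a: "a \<in> A"
      let ?u = "\<lambda>b\<in>A. if a = b then \<one> else \<zero>"
      have "g ?u = (\<Oplus>\<^bsub>P\<^esub>b\<in>A. if a = b then b else \<zero>\<^bsub>P\<^esub>)"
        unfolding g_def using Ac by (intro P.M.finsum_cong') auto
      also have "\<dots> = a" using P.M.add.finprod_singleton[OF a A(1), of "\<lambda>b. b"] Ac by simp
      finally have "a = g ?u" by simp
      then show "a \<in> g ` carrier F" by (rule image_eqI[where f = g]) (simp add: F_def)
    qed
    have "g \<zero>\<^bsub>F\<^esub> = \<zero>\<^bsub>P\<^esub>"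
      by (rule additive_on_zero[OF graded_hom_additive[OF g_hom] F.M.abelian_group_axioms P.M.abelian_group_axioms])
    then show "\<zero>\<^bsub>P\<^esub> \<in> g ` carrier F" by (intro image_eqI[of _ _ "\<zero>\<^bsub>F\<^esub>"]) simp_all
    show "x \<oplus>\<^bsub>P\<^esub> y \<in> g ` carrier F" if "x \<in> g ` carrier F" "y \<in> g ` carrier F" for x y
    proof -
      obtain u v where "u \<in> carrier F" "v \<in> carrier F" "x = g u" "y = g v" using \<open>x \<in> _\<close> \<open>y \<in> _\<close> by blast
      then show ?thesis by (intro image_eqI[of _ _ "u \<oplus>\<^bsub>F\<^esub> v"]) (simp_all add: g_add)
    qed
    show "s \<odot>\<^bsub>P\<^esub> x \<in> g ` carrier F" if "s \<in> carrier S" "x \<in> g ` carrier F" for s x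
    proof -
      obtain u where "u \<in> carrier F" "x = g u" using \<open>x \<in> _\<close> by blast
      then show ?thesis using that(1) by (intro image_eqI[of _ _ "s \<odot>\<^bsub>F\<^esub> u"]) (simp_all add: g_smult)
    qed
  qed
  moreover have "(\<lambda>p. p) \<in> graded_hom S P P" by (auto simp: graded_hom_def linear_maps_def)
  ultimately obtain h where h: "h \<in> graded_hom S P F" "\<And>p. p \<in> carrier P \<Longrightarrow> g (h p) = p"
    using assms(1) F gP g_hom unfolding graded_projective_def by metis
  have "(\<lambda>p. h p a) \<in> graded_hom S P (shift S (- e a))" if a: "a \<in> A" for a
  proof -
    have hc: "h p \<in> carrier F" if "p \<in> carrier P" for p
      using h(1) that by (auto simp: graded_hom_def linear_maps_def)
    have "h (p \<oplus>\<^bsub>P\<^esub> q) a = h p a \<oplus> h q a" if "p \<in> carrier P" "q \<in> carrier P" for p q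
      using h(1) that a by (simp add: graded_hom_def linear_maps_def F_def)
    moreover have "h (s \<odot>\<^bsub>P\<^esub> p) a = s \<otimes> h p a" if "s \<in> carrier S" "p \<in> carrier P" for s p
      using h(1) that a by (simp add: graded_hom_def linear_maps_def F_def smult_S)
    moreover have "h p a \<in> hpart S (- e a + n)" if "p \<in> hpart P n" for p n
    proof -
      have "h p \<in> hpart F n" using h(1) that unfolding graded_hom_def by blast
      then show ?thesis using a by (auto simp: F_def)
    qed
    ultimately show ?thesis
      using Fc[OF hc a] by (simp add: graded_hom_def linear_maps_def smult_S image_subset_iff)
  qed
  moreover have "p = (\<Oplus>\<^bsub>P\<^esub>a\<in>A. h p a \<odot>\<^bsub>P\<^esub> a)" if "p \<in> carrier P" for p
    using h(2)[OF that] by (simp add: g_def)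
  moreover have "A \<subseteq> carrier P" using Ac by blast
  \<comment> \<open>The coordinate at \<open>a\<close> lowers degrees by \<open>e a\<close>, hence
    the sign in the witness.\<close>
  ultimately show ?thesis using A(1) by (intro that[of A "\<lambda>a p. h p a" "\<lambda>a. - e a"] ballI)
qed

end

section \<open>The symmetric algebra as a graded domain\<close>

context symmetric_algebra
begin

abbreviation S :: "(('a, 'b) sym, ('a, 'b) sym) graded" where "S \<equiv> sym_alg scale"

definition sym_class :: "('a, 'b) free_alg \<Rightarrow> ('a, 'b) sym" where
  "sym_class p = sym_ideal scale +>\<^bsub>free_alg_ring\<^esub> p"

lemma sym_class_eq_iff: "sym_class p = sym_class q \<longleftrightarrow> p - q \<in> I"
proof -
  interpret R: cring "free_alg_ring :: ('a, 'b) free_alg ring" by (rule free_alg_ring_cring)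
  show ?thesis
    using R.quotient_eq_iff_same_a_r_cos[OF ideal_I, of p q] by (simp add: sym_class_def)
qed

lemma carrier_S: "carrier S = range sym_class"
  by (auto simp: sym_alg_def Let_def FactRing_def A_RCOSETS_def' sym_class_def)

lemma S_simps:
  "sym_class p \<oplus>\<^bsub>S\<^esub> sym_class q = sym_class (p + q)"
  "sym_class p \<otimes>\<^bsub>S\<^esub> sym_class q = sym_class (p * q)"
  "\<one>\<^bsub>S\<^esub> = sym_class 1" "\<zero>\<^bsub>S\<^esub> = sym_class 0"
proof -
  interpret R: cring "free_alg_ring :: ('a, 'b) free_alg ring" by (rule free_alg_ring_cring)
  interpret id: ideal I free_alg_ring by (rule ideal_I)
  show "sym_class p \<oplus>\<^bsub>S\<^esub> sym_class q = sym_class (p + q)"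
    using id.a_rcos_sum[of p q] by (simp add: sym_alg_def Let_def FactRing_def sym_class_def)
  show "sym_class p \<otimes>\<^bsub>S\<^esub> sym_class q = sym_class (p * q)"
    using id.rcoset_mult_add[of p q] by (simp add: sym_alg_def Let_def FactRing_def sym_class_def)
  show "\<one>\<^bsub>S\<^esub> = sym_class 1"
    by (simp add: sym_alg_def Let_def FactRing_def sym_class_def)
  have "sym_class 0 = I" using id.a_rcos_const[OF I_0] by (simp add: sym_class_def)
  then show "\<zero>\<^bsub>S\<^esub> = sym_class 0"
    by (simp add: sym_alg_def Let_def FactRing_def)
qed

lemma hpart_S: "hpart S n = sym_class ` {p. homogeneous n p}"
  by (simp add: sym_alg_def Let_def sym_class_def[abs_def] homogeneous_def)

lemma sym_class_eq_zero_iff: "sym_class p = \<zero>\<^bsub>S\<^esub> \<longleftrightarrow> p \<in> I"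
  by (simp add: S_simps sym_class_eq_iff)

lemma domain_S: "domain S"
proof -
  have "Group.comm_monoid S"
    by (rule comm_monoidI) (auto simp: carrier_S S_simps ac_simps)
  moreover have "abelian_group S"
  proof (rule abelian_groupI)
    fix x assume "x \<in> carrier S"
    then obtain p where "x = sym_class p" by (auto simp: carrier_S)
    then show "\<exists>y\<in>carrier S. y \<oplus>\<^bsub>S\<^esub> x = \<zero>\<^bsub>S\<^esub>"
      by (intro bexI[of _ "sym_class (- p)"]) (simp_all add: carrier_S S_simps)
  qed (auto simp: carrier_S S_simps ac_simps)
  ultimately have "cring S"
    by (intro cringI) (auto simp: carrier_S S_simps distrib_right)
  moreover have "domain_axioms S"
  proof
    show "\<one>\<^bsub>S\<^esub> \<noteq> \<zero>\<^bsub>S\<^esub>"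
      using const_in_I[of 1] by (simp only: S_simps(3) sym_class_eq_zero_iff) auto
    fix x y assume xy: "x \<otimes>\<^bsub>S\<^esub> y = \<zero>\<^bsub>S\<^esub>" "x \<in> carrier S" "y \<in> carrier S"
    then obtain p q where pq: "x = sym_class p" "y = sym_class q" by (auto simp: carrier_S)
    with xy(1) have "p * q \<in> I" by (simp only: S_simps(2) sym_class_eq_zero_iff)
    then show "x = \<zero>\<^bsub>S\<^esub> \<or> y = \<zero>\<^bsub>S\<^esub>"
      using I_prime[of p q] by (simp only: pq sym_class_eq_zero_iff)
  qed
  ultimately show ?thesis by (simp add: domain_def)
qed

lemma finsum_S: "finsum S (\<lambda>n. sym_class (f n)) A = sym_class (sum f A)"
proof -
  interpret domain S by (rule domain_S)
  show ?thesis
  proof (induction A rule: infinite_finite_induct)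
    case (insert a A)
    moreover have "(\<lambda>n. sym_class (f n)) \<in> A \<rightarrow> carrier S" by (simp add: carrier_S)
    ultimately show ?case by (simp add: carrier_S S_simps)
  qed (simp_all add: S_simps)
qed

lemma a_inv_S: "\<ominus>\<^bsub>S\<^esub> sym_class p = sym_class (- p)"
proof -
  interpret domain S by (rule domain_S)
  show ?thesis by (rule minus_equality) (auto simp: carrier_S S_simps)
qed

text \<open>Polynomials split into homogeneous parts, and the splitting descends to the quotient
  because the ideal of relations is homogeneous.\<close>

lemma graded_group_S: "graded_group S"
proof -
  interpret domain S by (rule domain_S)
  have ex: "\<exists>c A. finite A \<and> (\<forall>n. c n \<in> hpart S n) \<and> m = finsum S c A" if m: "m \<in> carrier S" for m
  proof -
    obtain p where p: "m = sym_class p" using m by (auto simp: carrier_S)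
    obtain N f where "finite N" "\<And>n. homogeneous n (f n)" "p = sum f N"
      using homogeneous_decomposition[of p] by metis
    then show ?thesis
      unfolding p by (intro exI[of _ "\<lambda>n. sym_class (f n)"] exI[of _ N]) (simp add: finsum_S hpart_S)
  qed
  have uniq: "\<forall>c A. finite A \<longrightarrow> (\<forall>n. c n \<in> hpart S n) \<longrightarrow> finsum S c A = \<zero>\<^bsub>S\<^esub> \<longrightarrow>
      (\<forall>n \<in> A. c n = \<zero>\<^bsub>S\<^esub>)"
  proof (intro allI impI ballI)
    fix c A n
    assume c: "finite A" "\<forall>n. c n \<in> hpart S n" "finsum S c A = \<zero>\<^bsub>S\<^esub>" "n \<in> A"
    have "\<forall>n. \<exists>p. homogeneous n p \<and> c n = sym_class p" using c(2) by (auto simp: hpart_S)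
    then obtain f where f: "\<And>n. homogeneous n (f n)" "\<And>n. c n = sym_class (f n)" by metis
    have "finsum S c A = sym_class (sum f A)" using finsum_S[of f A] by (simp flip: f(2))
    then have "sym_class (sum f A) = \<zero>\<^bsub>S\<^esub>" using c(3) by (rule trans[OF sym])
    then have "sum f A \<in> I" by (simp only: sym_class_eq_zero_iff)
    then show "c n = \<zero>\<^bsub>S\<^esub>"
      using homogeneous_sum_in_I[OF c(1) f(1) _ c(4)] by (simp add: f(2) sym_class_eq_zero_iff)
  qed
  show ?thesis
  proof (rule graded_groupI[OF abelian_group_axioms _ _ _ _ ex uniq])
    show "\<ominus>\<^bsub>S\<^esub> x \<in> hpart S n" if "x \<in> hpart S n" for n x
      using that by (auto simp: hpart_S a_inv_S intro!: imageI homogeneous_uminus)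
    show "x \<oplus>\<^bsub>S\<^esub> y \<in> hpart S n" if "x \<in> hpart S n" "y \<in> hpart S n" for n x y
      using that by (auto simp: hpart_S S_simps intro!: imageI homogeneous_add)
    show "hpart S n \<subseteq> carrier S" for n by (auto simp: hpart_S carrier_S)
    show "\<zero>\<^bsub>S\<^esub> \<in> hpart S n" for n by (auto simp: hpart_S S_simps)
  qed
qed

lemma graded_domain_S: "graded_domain S"
proof -
  have "graded_domain_axioms S"
  proof
    show "smult S = mult S" by (simp add: sym_alg_def Let_def)
    show "is_grading S" by (rule graded_group.grading[OF graded_group_S])
    show "a \<otimes>\<^bsub>S\<^esub> b \<in> hpart S (i + j)" if "a \<in> hpart S i" "b \<in> hpart S j" for a b i j
      using that by (auto simp: hpart_S S_simps intro!: imageI homogeneous_mult)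
    show "hpart S n = {\<zero>\<^bsub>S\<^esub>}" if "n < 0" for n
    proof -
      have "p = 0" if "homogeneous n p" for p :: "('a, 'b) free_alg"
        using homogeneous_nonpos[OF that] \<open>n < 0\<close> by auto
      then have "{p :: ('a, 'b) free_alg. homogeneous n p} = {0}" by auto
      then show ?thesis by (simp add: hpart_S S_simps)
    qed
    show "\<one>\<^bsub>S\<^esub> \<in> hpart S 0" using homogeneous_const[of 1] by (auto simp: hpart_S S_simps)
    show "\<exists>b \<in> hpart S 0. b \<otimes>\<^bsub>S\<^esub> a = \<one>\<^bsub>S\<^esub>" if a: "a \<in> hpart S 0" "a \<noteq> \<zero>\<^bsub>S\<^esub>" for a
    proof -
      obtain p where p: "a = sym_class p" "homogeneous 0 p" using a(1) by (auto simp: hpart_S)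
      then obtain c where c: "a = sym_class (const c)" using homogeneous_nonpos[of 0 p] by auto
      with a(2) have "c \<noteq> 0" by (auto simp: S_simps)
      then have "sym_class (const (inverse c)) \<otimes>\<^bsub>S\<^esub> a = \<one>\<^bsub>S\<^esub>"
        by (simp add: c S_simps flip: const_mult)
      moreover have "sym_class (const (inverse c)) \<in> hpart S 0"
        using homogeneous_const by (auto simp: hpart_S)
      ultimately show ?thesis by blast
    qed
  qed
  then show ?thesis using domain_S by (simp add: graded_domain_def)
qed

lemma sym_incl_hpart: "sym_incl scale v \<in> hpart S 1"
  unfolding hpart_S sym_incl_def sym_class_def[symmetric]
  by (intro imageI) (simp add: homogeneous_gen)

lemma sym_incl_nonzero: "v \<noteq> 0 \<Longrightarrow> sym_incl scale v \<noteq> \<zero>\<^bsub>S\<^esub>"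
  using gen_in_I sym_class_eq_zero_iff[of "gen v"] by (auto simp: sym_incl_def sym_class_def)

text \<open>The linear form of \<open>a\<close> is prime, and it cannot divide that of
  \<open>b\<close>, since this would make \<open>b\<close> a scalar multiple of
  \<open>a\<close>.\<close>

lemma sym_incl_coprime:
  assumes "\<nexists>r. b = scale r a" "s \<in> carrier S"
    and "s \<otimes>\<^bsub>S\<^esub> sym_incl scale b \<in> PIdl\<^bsub>S\<^esub> (sym_incl scale a)"
  shows "s \<in> PIdl\<^bsub>S\<^esub> (sym_incl scale a)"
proof -
  have incl: "sym_incl scale v = sym_class (gen v)" for v by (simp add: sym_incl_def sym_class_def)
  have PIdl: "x \<in> PIdl\<^bsub>S\<^esub> (sym_incl scale a) \<longleftrightarrow> (\<exists>q. x = sym_class (q * gen a))" for x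
  proof -
    have "x \<in> PIdl\<^bsub>S\<^esub> (sym_incl scale a) \<longleftrightarrow> (\<exists>q. x = sym_class q \<otimes>\<^bsub>S\<^esub> sym_class (gen a))"
      by (auto simp: cgenideal_def carrier_S incl)
    then show ?thesis by (simp only: S_simps)
  qed
  obtain p where p: "s = sym_class p" using assms(2) by (auto simp: carrier_S)
  have "s \<otimes>\<^bsub>S\<^esub> sym_incl scale b = sym_class (p * gen b)" by (simp add: p incl S_simps)
  then obtain q where "p * gen b - q * gen a \<in> I"
    using assms(3) by (auto simp only: PIdl sym_class_eq_iff)
  from gen_multiples_prime[OF this] obtain r where "p - r * gen a \<in> I"
    using gen_multiple_dependent assms(1) by blast
  then have "s = sym_class (r * gen a)" by (simp only: p sym_class_eq_iff)
  then show ?thesis unfolding PIdl ..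
qed

end

sublocale symmetric_algebra \<subseteq> S: graded_domain "sym_alg scale"
  by (rule graded_domain_S)

section \<open>Degrees after cancellation of a homogeneous factor\<close>

context graded_domain
begin

lemma PIdl_iff: "s \<in> PIdl a \<longleftrightarrow> (\<exists>r \<in> carrier S. s = r \<otimes> a)"
  by (auto simp: cgenideal_def)

lemma mult_reflects_hpart:
  assumes "a \<in> hpart S d" "a \<noteq> \<zero>" "r \<in> carrier S" "r \<otimes> a \<in> hpart S (n + d)"
  shows "r \<in> hpart S n"
proof (rule additive_on_reflects_hpart[OF _ S.graded_group_axioms S.graded_group_axioms _ _ assms(3)])
  have a: "a \<in> carrier S" by (rule S.hpart_carrier[OF assms(1)])
  show "additive_on S S (\<lambda>r. r \<otimes> a)" using a by (auto simp: additive_on_def l_distr)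
  show "(\<lambda>r. r \<otimes> a) ` hpart S n \<subseteq> hpart S (n + d)" for n
    using hpart_mult[OF _ assms(1)] by auto
  show "m = \<zero>" if "m \<in> carrier S" "m \<otimes> a = \<zero>" for m
    using integral[OF that(2,1) a] assms(2) by blast
qed (rule assms(4))

end

context graded_mod
begin

lemma smult_reflects_hpart:
  assumes "torsion_free S M" "a \<in> hpart S d" "a \<noteq> \<zero>" "m \<in> carrier M" "a \<odot>\<^bsub>M\<^esub> m \<in> hpart M (n + d)"
  shows "m \<in> hpart M n"
proof (rule additive_on_reflects_hpart[OF _ M.graded_group_axioms M.graded_group_axioms _ _ assms(4)])
  have a: "a \<in> carrier S" by (rule S.hpart_carrier[OF assms(2)])
  show "additive_on M M (\<lambda>m. a \<odot>\<^bsub>M\<^esub> m)" using a by (auto simp: additive_on_def M.smult_r_distr)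
  show "(\<lambda>m. a \<odot>\<^bsub>M\<^esub> m) ` hpart M n \<subseteq> hpart M (n + d)" for n
    using smult_hpart[OF assms(2), of _ n] by (auto simp: add.commute[of n d])
  show "m = \<zero>\<^bsub>M\<^esub>" if "m \<in> carrier M" "a \<odot>\<^bsub>M\<^esub> m = \<zero>\<^bsub>M\<^esub>" for m
    using assms(1,3) a that unfolding torsion_free_def by blast
qed (rule assms(5))

lemma smult_eq_cancel:
  assumes "torsion_free S M" "s \<in> carrier S" "t \<in> carrier S" "m \<in> carrier M" "m \<noteq> \<zero>\<^bsub>M\<^esub>"
    and "s \<odot>\<^bsub>M\<^esub> m = t \<odot>\<^bsub>M\<^esub> m"
  shows "s = t"
proof -
  have "(s \<oplus> \<ominus> t) \<odot>\<^bsub>M\<^esub> m = \<zero>\<^bsub>M\<^esub>"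
    using assms by (simp add: M.smult_l_distr M.smult_l_minus M.r_neg)
  moreover have "s \<oplus> \<ominus> t \<in> carrier S" using assms by simp
  ultimately have "s \<oplus> \<ominus> t = \<zero>"
    using assms(1,4,5) unfolding torsion_free_def by blast
  then show ?thesis using assms(2,3) minus_equality[of s "\<ominus> t"] by simp
qed

lemma smult_diff_zero:
  assumes "s \<in> carrier S" "t \<in> carrier S" "m \<in> carrier M" "(s \<ominus> t) \<odot>\<^bsub>M\<^esub> m = \<zero>\<^bsub>M\<^esub>"
  shows "s \<odot>\<^bsub>M\<^esub> m = t \<odot>\<^bsub>M\<^esub> m"
proof -
  have "s \<odot>\<^bsub>M\<^esub> m = ((s \<ominus> t) \<oplus> t) \<odot>\<^bsub>M\<^esub> m" using assms by (simp add: minus_eq a_assoc l_neg)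
  also have "\<dots> = (s \<ominus> t) \<odot>\<^bsub>M\<^esub> m \<oplus>\<^bsub>M\<^esub> t \<odot>\<^bsub>M\<^esub> m" using assms by (intro M.smult_l_distr) auto
  finally show ?thesis using assms by simp
qed

end

section \<open>Braden--MacPherson sheaves\<close>

locale BM_sheaf = symmetric_algebra scale Basis
  for scale :: "'k::field \<Rightarrow> 'v::ab_group_add \<Rightarrow> 'v" and Basis +
  fixes G :: "('x, 'v) moment_graph"
    and B :: "('x, ('k, 'v) sym, 'm, 'n) sheaf" and w :: 'x
  assumes moment_graph: "is_moment_graph G" and finite_verts: "finite (verts G)"
    and GKM: "is_GKM scale G" and highest: "highest_vertex G w"
    and BM: "is_Braden_MacPherson scale G w B"
begin

definition lab :: "'x set \<Rightarrow> ('k, 'v) sym" where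
  "lab E = sym_incl scale (label G E)"

definition arrow :: "'x \<Rightarrow> 'x \<Rightarrow> bool" where
  "arrow x y \<longleftrightarrow> {x, y} \<in> edges G \<and> below G x y"

definition \<Gamma> :: "'x set \<Rightarrow> ('x \<Rightarrow> 'm) set" where
  "\<Gamma> L = carrier (sections G B L)"

subsection \<open>The graph\<close>

lemmas moment_graph_facts = moment_graph[unfolded is_moment_graph_def]

lemmas le_verts = moment_graph_facts[THEN conjunct1]
  and le_partial_order = moment_graph_facts[THEN conjunct2, THEN conjunct1]
  and edge_ends = moment_graph_facts[THEN conjunct2, THEN conjunct2, THEN conjunct1]
  and le_generated = moment_graph_facts[THEN conjunct2, THEN conjunct2, THEN conjunct2, THEN conjunct1]
  and label_nonzero = moment_graph_facts[THEN conjunct2, THEN conjunct2, THEN conjunct2, THEN conjunct2]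

lemma below_verts: "below G x y \<Longrightarrow> x \<in> verts G \<and> y \<in> verts G"
  using le_verts by (auto simp: below_def)

lemma below_trans: "below G x y \<Longrightarrow> below G y z \<Longrightarrow> below G x z"
  using le_partial_order unfolding below_def partial_order_on_def preorder_on_def
  by (meson antisymD transD)

lemma below_not_refl: "\<not> below G x x"
  by (simp add: below_def)

lemma arrow_verts: "arrow x y \<Longrightarrow> x \<in> verts G \<and> y \<in> verts G"
  using below_verts by (auto simp: arrow_def)

lemma edge_arrow:
  assumes "{x, y} \<in> edges G"
  shows "arrow x y \<or> arrow y x"
proof -
  obtain u v where "{x, y} = {u, v}" "below G u v"
    using bspec[OF edge_ends assms] by (elim bexE conjE)
  then have "arrow u v" using assms by (simp add: arrow_def)
  moreover have "x = u \<and> y = v \<or> x = v \<and> y = u"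
    using \<open>{x, y} = {u, v}\<close> by (simp only: doubleton_eq_iff)
  ultimately show ?thesis by blast
qed

lemma edge_cases:
  assumes "E \<in> edges G" "x \<in> E"
  shows "(\<exists>y. E = {x, y} \<and> arrow x y) \<or> (\<exists>y. E = {y, x} \<and> arrow y x)"
proof -
  obtain u v where uv: "E = {u, v}" "below G u v"
    using bspec[OF edge_ends assms(1)] by (elim bexE conjE)
  then have arrow: "arrow u v" using assms(1) by (simp add: arrow_def)
  have "x = u \<or> x = v" using uv(1) assms(2) by simp
  then show ?thesis
  proof
    assume "x = u"
    then show ?thesis using uv(1) arrow by (intro disjI1 exI[of _ v]) simp
  next
    assume "x = v"
    then show ?thesis using uv(1) arrow by (intro disjI2 exI[of _ u]) simp
  qed
qed

text \<open>Passing from \<open>x\<close> to a vertex above it shrinks the finite set of vertices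
  above. The induction therefore runs from the highest vertex downwards, the direction in which the
  sheaf is built.\<close>

lemma arrow_induct [consumes 1, case_names step]:
  assumes "x \<in> verts G"
    and "\<And>x. x \<in> verts G \<Longrightarrow> (\<And>y. below G x y \<Longrightarrow> P y) \<Longrightarrow> P x"
  shows "P x"
  using assms(1)
proof (induction "card {y. below G x y}" arbitrary: x rule: less_induct)
  case less
  show ?case
  proof (rule assms(2)[OF less.prems])
    fix y assume y: "below G x y"
    have "finite {y. below G x y}"
      by (rule finite_subset[OF _ finite_verts]) (use below_verts in auto)
    moreover have "{z. below G y z} \<subset> {z. below G x z}"
      using y below_trans below_not_refl by blast
    ultimately have "card {z. below G y z} < card {z. below G x z}" by (intro psubset_card_mono)
    then show "P y" using less.hyps[of y] below_verts[OF y] by simp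
  qed
qed

lemma w_vert: "w \<in> verts G"
  using highest by (simp add: highest_vertex_def)

lemma below_w: "x \<in> verts G \<Longrightarrow> x \<noteq> w \<Longrightarrow> below G x w"
  using highest by (simp add: highest_vertex_def below_def)

lemma not_above_w: "\<not> below G w x"
proof
  assume *: "below G w x"
  then have "below G x w" using below_w[of x] below_verts[OF *] by (auto simp: below_def)
  then show False using below_trans[OF *] below_not_refl by blast
qed

text \<open>The order is generated by the edges, so the relation between \<open>x\<close> and
  \<open>w\<close> comes from a directed path, and its first edge is taken.\<close>

lemma exists_arrow:
  assumes "x \<in> verts G" "x \<noteq> w"
  shows "\<exists>y. arrow x y"
proof -
  have "(x, w) \<in> (arrows G)\<^sup>*"
    using highest assms(1) le_generated unfolding highest_vertex_def by simp
  then obtain y where "(x, y) \<in> arrows G" using assms(2) by (cases rule: converse_rtranclE) blast+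
  then show ?thesis by (auto simp: arrows_def arrow_def)
qed

lemma le_induct [consumes 2, case_names refl step]:
  assumes "(x, y) \<in> le G" "x \<in> verts G" "P x"
    and "\<And>y z. P y \<Longrightarrow> arrow y z \<Longrightarrow> P z"
  shows "P y"
proof -
  have "(x, y) \<in> (arrows G)\<^sup>*" using assms(1) le_generated by simp
  then show ?thesis
  proof (induction rule: rtrancl_induct)
    case (step y z)
    then have "arrow y z" by (simp add: arrows_def arrow_def)
    with step.IH show ?case by (rule assms(4))
  qed (rule assms(3))
qed

lemma finite_edges: "finite (edges G)"
proof (rule finite_subset)
  show "edges G \<subseteq> Pow (verts G)" using edge_ends by fastforce
qed (simp add: finite_verts)

subsection \<open>Labels\<close>

lemma lab_hpart: "lab E \<in> hpart S 1"
  unfolding lab_def by (rule sym_incl_hpart)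

lemma lab_closed [simp]: "lab E \<in> carrier S"
  using lab_hpart S.S.hpart_carrier by blast

lemma lab_nonzero: "E \<in> edges G \<Longrightarrow> lab E \<noteq> \<zero>\<^bsub>S\<^esub>"
  unfolding lab_def using label_nonzero by (intro sym_incl_nonzero) simp

text \<open>The GKM condition at the common vertex \<open>v\<close> excludes proportional labels,
  and non-proportional linear forms are coprime.\<close>

lemma lab_coprime:
  assumes "E \<in> edges G" "F \<in> edges G" "E \<noteq> F" "v \<in> E" "v \<in> F" "s \<in> carrier S"
    and "s \<otimes>\<^bsub>S\<^esub> lab F \<in> PIdl\<^bsub>S\<^esub> (lab E)"
  shows "s \<in> PIdl\<^bsub>S\<^esub> (lab E)"
proof -
  have ne: "label G E \<noteq> label G F" and ind: "independent {label G E, label G F}"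
    using GKM assms(1-5) unfolding is_GKM_def by blast+
  have "label G F \<noteq> scale r (label G E)" for r
  proof
    assume "label G F = scale r (label G E)"
    then have "label G F \<in> span ({label G E, label G F} - {label G F})"
      using ne span_scale[OF span_base[of "label G E"]] by auto
    then show False using ind unfolding dependent_def by blast
  qed
  then show ?thesis
    using sym_incl_coprime[OF _ assms(6), of "label G F" "label G E"] assms(7) unfolding lab_def by blast
qed

definition lprod :: "'x set set \<Rightarrow> ('k, 'v) sym" where
  "lprod A = finprod S lab A"

lemma lprod_closed [simp]: "lprod A \<in> carrier S"
  unfolding lprod_def by (rule S.finprod_closed) auto

lemma lprod_insert: "finite A \<Longrightarrow> E \<notin> A \<Longrightarrow> lprod (insert E A) = lab E \<otimes>\<^bsub>S\<^esub> lprod A"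
  unfolding lprod_def by (rule S.finprod_insert) auto

lemma lprod_hpart: "finite A \<Longrightarrow> lprod A \<in> hpart S (int (card A))"
proof (induction A rule: finite_induct)
  case empty
  show ?case using S.one_hpart by (simp add: lprod_def)
next
  case (insert E A)
  then show ?case using S.hpart_mult[OF lab_hpart insert.IH] by (simp add: lprod_insert)
qed

lemma lprod_nonzero: "finite A \<Longrightarrow> A \<subseteq> edges G \<Longrightarrow> lprod A \<noteq> \<zero>\<^bsub>S\<^esub>"
proof (induction A rule: finite_induct)
  case empty
  show ?case using S.one_not_zero by (simp add: lprod_def)
next
  case (insert E A)
  then show ?case using lab_nonzero[of E] by (auto simp: lprod_insert S.integral_iff)
qed

lemma lprod_coprime:
  assumes "finite A" "A \<subseteq> edges G" "\<And>F. F \<in> A \<Longrightarrow> v \<in> F"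
    and E: "E \<in> edges G" "v \<in> E" "E \<notin> A"
    and "s \<in> carrier S" "s \<otimes>\<^bsub>S\<^esub> lprod A \<in> PIdl\<^bsub>S\<^esub> (lab E)"
  shows "s \<in> PIdl\<^bsub>S\<^esub> (lab E)"
  using assms(1-3,6-8)
proof (induction A arbitrary: s rule: finite_induct)
  case empty
  then show ?case by (simp add: lprod_def)
next
  case (insert F A)
  have sFA: "(s \<otimes>\<^bsub>S\<^esub> lab F) \<otimes>\<^bsub>S\<^esub> lprod A \<in> PIdl\<^bsub>S\<^esub> (lab E)"
    using insert.prems(4,5) by (simp add: lprod_insert[OF insert.hyps] S.m_assoc)
  have sF: "s \<otimes>\<^bsub>S\<^esub> lab F \<in> carrier S" using insert.prems(4) by simp
  have F: "A \<subseteq> edges G" "F \<in> edges G" "E \<noteq> F" "v \<in> F" "E \<notin> A" "\<And>F. F \<in> A \<Longrightarrow> v \<in> F"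
    using insert.prems(1-3) by auto
  have "s \<otimes>\<^bsub>S\<^esub> lab F \<in> PIdl\<^bsub>S\<^esub> (lab E)" by (rule insert.IH[OF F(1,6,5) sF sFA])
  then show ?case by (rule lab_coprime[OF E(1) F(2,3) E(2) F(4) insert.prems(4)])
qed

text \<open>The labels in \<open>A\<close> belong to edges at one vertex and are pairwise coprime,
  so once the product over the earlier edges is split off, the next label must divide the remaining
  factor.\<close>

lemma lprod_divides:
  assumes "finite A" "A \<subseteq> edges G" "\<And>F. F \<in> A \<Longrightarrow> v \<in> F"
    and "s \<in> carrier S" "\<And>E. E \<in> A \<Longrightarrow> s \<in> PIdl\<^bsub>S\<^esub> (lab E)"
  shows "\<exists>r \<in> carrier S. s = r \<otimes>\<^bsub>S\<^esub> lprod A"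
  using assms
proof (induction A rule: finite_induct)
  case empty
  then show ?case by (intro bexI[of _ s]) (simp_all add: lprod_def)
next
  case (insert F A)
  have "\<exists>r \<in> carrier S. s = r \<otimes>\<^bsub>S\<^esub> lprod A" using insert.prems by (intro insert.IH) simp_all
  then obtain r where r: "r \<in> carrier S" "s = r \<otimes>\<^bsub>S\<^esub> lprod A" by blast
  have rA: "r \<otimes>\<^bsub>S\<^esub> lprod A \<in> PIdl\<^bsub>S\<^esub> (lab F)" using insert.prems(4)[of F] r(2) by simp
  have sub: "A \<subseteq> edges G" "F \<in> edges G" using insert.prems(1) by auto
  have v: "v \<in> F" "\<And>F. F \<in> A \<Longrightarrow> v \<in> F" using insert.prems(2) by auto
  have "r \<in> PIdl\<^bsub>S\<^esub> (lab F)"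
    by (rule lprod_coprime[OF insert.hyps(1) sub(1) v(2) sub(2) v(1) insert.hyps(2) r(1) rA])
  then obtain t where t: "t \<in> carrier S" "r = t \<otimes>\<^bsub>S\<^esub> lab F" by (auto simp: S.PIdl_iff)
  then have "s = t \<otimes>\<^bsub>S\<^esub> lprod (insert F A)"
    using r by (simp add: lprod_insert[OF insert.hyps(1,2)] S.m_assoc)
  then show ?case using t(1) by blast
qed

lemma lprod_remove:
  assumes "finite A" "E \<in> A"
  shows "lprod A = lab E \<otimes>\<^bsub>S\<^esub> lprod (A - {E})"
  using lprod_insert[of "A - {E}" E] assms by (simp add: insert_absorb)

text \<open>The quotient by the label would have degree -1, where \<open>S\<close> is zero.\<close>

lemma hpart_0_PIdl_lab:
  assumes "s \<in> hpart S 0" "s \<in> PIdl\<^bsub>S\<^esub> (lab E)" "E \<in> edges G"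
  shows "s = \<zero>\<^bsub>S\<^esub>"
proof -
  obtain r where r: "r \<in> carrier S" "s = r \<otimes>\<^bsub>S\<^esub> lab E" using assms(2) by (auto simp: S.PIdl_iff)
  have "r \<in> hpart S (- 1)"
    by (rule S.mult_reflects_hpart[OF lab_hpart lab_nonzero[OF assms(3)] r(1)]) (use assms(1) r(2) in simp)
  then have "r = \<zero>\<^bsub>S\<^esub>" using S.hpart_neg[of "- 1"] by simp
  then show ?thesis using r by simp
qed

subsection \<open>Stalks\<close>

lemma sheaf: "is_sheaf scale G B"
  using BM by (simp add: is_Braden_MacPherson_def Let_def)

lemma stalk_mod: "x \<in> verts G \<Longrightarrow> graded_mod S (stalk B x)"
  using sheaf by (intro S.graded_modI) (simp add: is_sheaf_def Let_def)

lemma stalk_fg: "x \<in> verts G \<Longrightarrow> finitely_generated S (stalk B x)"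
  using sheaf by (simp add: is_sheaf_def Let_def)

lemma stalk_tf: "x \<in> verts G \<Longrightarrow> torsion_free S (stalk B x)"
  using sheaf by (simp add: is_sheaf_def Let_def)

lemma edge_mod: "E \<in> edges G \<Longrightarrow> graded_mod S (edge_stalk B E)"
  using sheaf by (intro S.graded_modI) (simp add: is_sheaf_def Let_def)

lemma lab_kills: "E \<in> edges G \<Longrightarrow> m \<in> carrier (edge_stalk B E) \<Longrightarrow>
  lab E \<odot>\<^bsub>edge_stalk B E\<^esub> m = \<zero>\<^bsub>edge_stalk B E\<^esub>"
  using sheaf by (simp add: is_sheaf_def Let_def lab_def)

lemma PIdl_lab_kills:
  assumes "E \<in> edges G" "m \<in> carrier (edge_stalk B E)" "s \<in> PIdl\<^bsub>S\<^esub> (lab E)"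
  shows "s \<odot>\<^bsub>edge_stalk B E\<^esub> m = \<zero>\<^bsub>edge_stalk B E\<^esub>"
proof -
  interpret Q: graded_mod S "edge_stalk B E" by (rule edge_mod[OF assms(1)])
  obtain r where "r \<in> carrier S" "s = r \<otimes>\<^bsub>S\<^esub> lab E" using assms(3) by (auto simp: S.PIdl_iff)
  then show ?thesis using assms lab_kills by (simp add: Q.M.smult_assoc1)
qed

lemma rho_hom: "E \<in> edges G \<Longrightarrow> x \<in> E \<Longrightarrow> rho B x E \<in> graded_hom S (stalk B x) (edge_stalk B E)"
  using sheaf by (simp add: is_sheaf_def Let_def)

context
  fixes x E assumes E: "E \<in> edges G" "x \<in> E"
begin

lemma edge_vert: "x \<in> verts G"
  using edge_cases[OF E] arrow_verts by auto

lemma rho_closed: "p \<in> carrier (stalk B x) \<Longrightarrow> rho B x E p \<in> carrier (edge_stalk B E)"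
  using rho_hom[OF E] by (auto simp: graded_hom_def linear_maps_def)

lemma rho_add: "p \<in> carrier (stalk B x) \<Longrightarrow> q \<in> carrier (stalk B x) \<Longrightarrow>
  rho B x E (p \<oplus>\<^bsub>stalk B x\<^esub> q) = rho B x E p \<oplus>\<^bsub>edge_stalk B E\<^esub> rho B x E q"
  using rho_hom[OF E] by (simp add: graded_hom_def linear_maps_def)

lemma rho_smult: "s \<in> carrier S \<Longrightarrow> p \<in> carrier (stalk B x) \<Longrightarrow>
  rho B x E (s \<odot>\<^bsub>stalk B x\<^esub> p) = s \<odot>\<^bsub>edge_stalk B E\<^esub> rho B x E p"
  using rho_hom[OF E] by (simp add: graded_hom_def linear_maps_def)

lemma rho_hpart: "p \<in> hpart (stalk B x) n \<Longrightarrow> rho B x E p \<in> hpart (edge_stalk B E) n"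
  using rho_hom[OF E] by (auto simp: graded_hom_def)

lemma rho_zero: "rho B x E \<zero>\<^bsub>stalk B x\<^esub> = \<zero>\<^bsub>edge_stalk B E\<^esub>"
proof -
  interpret P: graded_mod S "stalk B x" by (rule stalk_mod[OF edge_vert])
  interpret Q: graded_mod S "edge_stalk B E" by (rule edge_mod[OF E(1)])
  show ?thesis
    by (rule additive_on_zero[OF graded_hom_additive[OF rho_hom[OF E]] P.M.abelian_group_axioms Q.M.abelian_group_axioms])
qed

lemma rho_gcomp:
  assumes "p \<in> carrier (stalk B x)"
  shows "rho B x E (gcomp (stalk B x) n p) = gcomp (edge_stalk B E) n (rho B x E p)"
proof -
  interpret P: graded_mod S "stalk B x" by (rule stalk_mod[OF edge_vert])
  interpret Q: graded_mod S "edge_stalk B E" by (rule edge_mod[OF E(1)])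
  show ?thesis
    using additive_on_gcomp[OF graded_hom_additive[OF rho_hom[OF E]] P.M.graded_group_axioms
      Q.M.graded_group_axioms _ assms, of 0 n] rho_hpart by (simp add: image_subset_iff)
qed

end

lemma arrow_edge: "arrow x y \<Longrightarrow> {x, y} \<in> edges G"
  by (simp add: arrow_def)

lemma BM_arrow:
  assumes "arrow x y"
  shows "rho B y {x, y} ` carrier (stalk B y) = carrier (edge_stalk B {x, y})"
    and "{m \<in> carrier (stalk B y). rho B y {x, y} m = \<zero>\<^bsub>edge_stalk B {x, y}\<^esub>} =
          {lab {x, y} \<odot>\<^bsub>stalk B y\<^esub> m | m. m \<in> carrier (stalk B y)}"
  using BM assms unfolding is_Braden_MacPherson_def Let_def arrow_def lab_def by simp_all

lemma BM_vertex:
  assumes "x \<in> verts G" "x \<noteq> w"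
  shows "rho_delta G B x ` carrier (stalk B x) = carrier (delta_stalk G B x)"
    and cover: "projective_cover S (stalk B x) (delta_stalk G B x) (rho_delta G B x)"
  using BM assms unfolding is_Braden_MacPherson_def Let_def by simp_all

lemma rho_surj:
  assumes "arrow x y" "q \<in> carrier (edge_stalk B {x, y})"
  obtains p where "p \<in> carrier (stalk B y)" "rho B y {x, y} p = q"
proof -
  have "q \<in> rho B y {x, y} ` carrier (stalk B y)" using assms(2) BM_arrow(1)[OF assms(1)] by simp
  then show ?thesis using that by blast
qed

lemma rho_kernel:
  assumes "arrow x y" "p \<in> carrier (stalk B y)" "rho B y {x, y} p = \<zero>\<^bsub>edge_stalk B {x, y}\<^esub>"
  obtains q where "q \<in> carrier (stalk B y)" "p = lab {x, y} \<odot>\<^bsub>stalk B y\<^esub> q"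
proof -
  have "p \<in> {lab {x, y} \<odot>\<^bsub>stalk B y\<^esub> m | m. m \<in> carrier (stalk B y)}"
    unfolding BM_arrow(2)[OF assms(1), symmetric] using assms(2,3) by simp
  then show ?thesis using that by blast
qed

subsection \<open>Sections\<close>

text \<open>The gluing condition is symmetric in the two ends of an edge and the order orients every
  edge, so one direction suffices.\<close>

lemma \<Gamma>_iff: "m \<in> \<Gamma> L \<longleftrightarrow> m \<in> (\<Pi>\<^sub>E x\<in>L. carrier (stalk B x)) \<and>
  (\<forall>x \<in> L. \<forall>y \<in> L. arrow x y \<longrightarrow> rho B x {x, y} (m x) = rho B y {x, y} (m y))"
proof -
  have "m \<in> \<Gamma> L \<longleftrightarrow> m \<in> (\<Pi>\<^sub>E x\<in>L. carrier (stalk B x)) \<and>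
    (\<forall>x \<in> L. \<forall>y \<in> L. {x, y} \<in> edges G \<longrightarrow> rho B x {x, y} (m x) = rho B y {x, y} (m y))"
    by (simp add: \<Gamma>_def sections_def Let_def)
  moreover have "(\<forall>x \<in> L. \<forall>y \<in> L. {x, y} \<in> edges G \<longrightarrow> rho B x {x, y} (m x) = rho B y {x, y} (m y)) \<longleftrightarrow>
    (\<forall>x \<in> L. \<forall>y \<in> L. arrow x y \<longrightarrow> rho B x {x, y} (m x) = rho B y {x, y} (m y))" (is "?l \<longleftrightarrow> ?r")
  proof
    assume ?l
    then show ?r unfolding arrow_def by blast
  next
    assume r: ?r
    show ?l
    proof (intro ballI impI)
      fix x y assume xy: "x \<in> L" "y \<in> L" "{x, y} \<in> edges G"
      show "rho B x {x, y} (m x) = rho B y {x, y} (m y)"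
      proof (cases "arrow x y")
        case False
        then have "arrow y x" using edge_arrow[OF xy(3)] by simp
        then have "rho B y {y, x} (m y) = rho B x {y, x} (m x)" using r xy by blast
        moreover have "{y, x} = {x, y}" by blast
        ultimately show ?thesis by simp
      next
        case True
        then show ?thesis using r xy by blast
      qed
    qed
  qed
  ultimately show ?thesis by simp
qed

section \<open>Gluing over upper edges and extension of sections\<close>

definition dmap :: "'x \<Rightarrow> ('x \<Rightarrow> 'm) \<Rightarrow> ('x set \<Rightarrow> 'n)" where
  "dmap x m = (\<lambda>E \<in> up_edges G x. rho B (the_elem (E - {x})) E (m (the_elem (E - {x}))))"

lemma up_edges_iff: "E \<in> up_edges G x \<longleftrightarrow> (\<exists>y. arrow x y \<and> E = {x, y})"
  by (auto simp: up_edges_def arrow_def)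

lemma dmap_arrow: "arrow x y \<Longrightarrow> dmap x m {x, y} = rho B y {x, y} (m y)"
proof -
  assume a: "arrow x y"
  then have "{x, y} - {x} = {y}" using below_not_refl by (auto simp: arrow_def)
  moreover have "{x, y} \<in> up_edges G x" using a up_edges_iff by blast
  ultimately show ?thesis by (simp add: dmap_def)
qed

lemma rho_delta_arrow: "arrow x y \<Longrightarrow> rho_delta G B x p {x, y} = rho B x {x, y} p"
proof -
  assume "arrow x y"
  then have "{x, y} \<in> up_edges G x" using up_edges_iff by blast
  then show ?thesis by (simp add: rho_delta_def)
qed

lemma rho_delta_eq_dmap:
  "rho_delta G B x p = dmap x m \<longleftrightarrow> (\<forall>y. arrow x y \<longrightarrow> rho B x {x, y} p = rho B y {x, y} (m y))"
proof
  assume *: "rho_delta G B x p = dmap x m"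
  show "\<forall>y. arrow x y \<longrightarrow> rho B x {x, y} p = rho B y {x, y} (m y)"
  proof (intro allI impI)
    fix y assume xy: "arrow x y"
    show "rho B x {x, y} p = rho B y {x, y} (m y)"
      using fun_cong[OF *, of "{x, y}"] unfolding rho_delta_arrow[OF xy] dmap_arrow[OF xy] .
  qed
next
  assume *: "\<forall>y. arrow x y \<longrightarrow> rho B x {x, y} p = rho B y {x, y} (m y)"
  show "rho_delta G B x p = dmap x m"
  proof (rule extensionalityI[where A = "up_edges G x"])
    fix E assume "E \<in> up_edges G x"
    then obtain y where y: "arrow x y" "E = {x, y}" using up_edges_iff by blast
    show "rho_delta G B x p E = dmap x m E"
      unfolding y(2) rho_delta_arrow[OF y(1)] dmap_arrow[OF y(1)] using * y(1) by blast
  qed (simp_all add: rho_delta_def dmap_def)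
qed

lemma rho_delta_eqI:
  assumes "\<And>y. arrow x y \<Longrightarrow> rho B x {x, y} p = rho B x {x, y} q"
  shows "rho_delta G B x p = rho_delta G B x q"
  unfolding rho_delta_def
proof (rule restrict_ext)
  fix E assume "E \<in> up_edges G x"
  then obtain y where y: "arrow x y" "E = {x, y}" using up_edges_iff by blast
  then show "rho B x E p = rho B x E q" using assms[OF y(1)] by simp
qed

text \<open>Condition (3) of the Braden--MacPherson sheaf as an equality of images, used in both
  directions: a section above \<open>x\<close> acquires a value at \<open>x\<close>, and an element
  of the stalk at \<open>x\<close> continues to a section above \<open>x\<close>.\<close>

lemma delta_stalk_carrier:
  assumes "x \<in> verts G" "x \<noteq> w"
  shows "rho_delta G B x ` carrier (stalk B x) = dmap x ` \<Gamma> {y. below G x y}"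
proof -
  have "{y \<in> verts G. below G x y} = {y. below G x y}" using below_verts by blast
  then have "carrier (delta_stalk G B x) = dmap x ` \<Gamma> {y. below G x y}"
    by (simp add: delta_stalk_def dmap_def[abs_def] \<Gamma>_def)
  then show ?thesis using BM_vertex(1)[OF assms] by simp
qed

text \<open>The open sets of the topology on the vertices for which the sheaf is flabby.\<close>

definition upclosed :: "'x set \<Rightarrow> bool" where
  "upclosed L \<longleftrightarrow> L \<subseteq> verts G \<and> (\<forall>x \<in> L. \<forall>y. below G x y \<longrightarrow> y \<in> L)"

lemma \<Gamma>_insert:
  assumes L: "upclosed L" "m \<in> \<Gamma> L" and x: "x \<in> verts G" "x \<notin> L" "p \<in> carrier (stalk B x)"
    and "\<And>y. arrow x y \<Longrightarrow> y \<in> L \<Longrightarrow> rho B x {x, y} p = rho B y {x, y} (m y)"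
  shows "m(x := p) \<in> \<Gamma> (insert x L)"
  unfolding \<Gamma>_iff
proof (intro conjI ballI impI)
  show "m(x := p) \<in> (\<Pi>\<^sub>E y\<in>insert x L. carrier (stalk B y))"
    using L(2) x(3) unfolding \<Gamma>_iff by (auto simp: PiE_iff extensional_def)
  fix y z assume yz: "y \<in> insert x L" "z \<in> insert x L" "arrow y z"
  \<comment> \<open>No edge runs from \<open>L\<close> into \<open>x\<close>, for an up-closed set
    would then contain \<open>x\<close>; nor does one run from \<open>x\<close> to itself.\<close>
  have "z \<noteq> x"
  proof
    assume "z = x"
    then have "below G y x" "y \<noteq> x" using yz(3) by (auto simp: arrow_def below_def)
    then show False using yz(1) x(2) L(1) unfolding upclosed_def by blast
  qed
  then have z: "z \<in> L" using yz(2) by simp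
  show "rho B y {y, z} ((m(x := p)) y) = rho B z {y, z} ((m(x := p)) z)"
  proof (cases "y = x")
    case True
    then show ?thesis using assms(6)[of z] yz(3) z \<open>z \<noteq> x\<close> by simp
  next
    case False
    then have "rho B y {y, z} (m y) = rho B z {y, z} (m z)" using L(2) yz z unfolding \<Gamma>_iff by blast
    then show ?thesis using False \<open>z \<noteq> x\<close> by simp
  qed
qed

lemma \<Gamma>_restrict:
  assumes "m \<in> \<Gamma> L" "L' \<subseteq> L"
  shows "restrict m L' \<in> \<Gamma> L'"
  using assms unfolding \<Gamma>_iff by (auto simp: PiE_iff subset_iff)

text \<open>Flabbiness. A maximal vertex among the missing ones has everything above it in
  \<open>L\<close>, so condition (3) provides a value there that is compatible with all upper edges;
  edges towards lower vertices impose nothing yet.\<close>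

lemma extend_section:
  assumes "upclosed L" "m \<in> \<Gamma> L"
  shows "\<exists>m' \<in> \<Gamma> (verts G). \<forall>x \<in> L. m' x = m x"
  using assms
proof (induction "card (verts G - L)" arbitrary: L m rule: less_induct)
  case less
  show ?case
  proof (cases "L = verts G")
    case False
    then have "\<exists>x. x \<in> verts G - L" using less.prems unfolding upclosed_def by blast
    then obtain x where x: "x \<in> verts G" "x \<notin> L" and max: "\<And>y. below G x y \<Longrightarrow> y \<in> L"
    proof -
      have "\<exists>x. x \<in> verts G \<and> x \<notin> L \<and> (\<forall>y. below G x y \<longrightarrow> y \<in> L)"
      proof (rule ccontr)
        assume *: "\<not> ?thesis"
        have "x \<in> L" if "x \<in> verts G" for x
          using that
        proof (induction x rule: arrow_induct)
          case (step x)
          then show ?case using * by blast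
        qed
        then show False using \<open>\<exists>x. x \<in> verts G - L\<close> by blast
      qed
      then show ?thesis using that by blast
    qed
    have "\<exists>p \<in> carrier (stalk B x). \<forall>y. arrow x y \<longrightarrow> y \<in> L \<longrightarrow> rho B x {x, y} p = rho B y {x, y} (m y)"
    proof (cases "x = w")
      case True
      interpret P: graded_mod S "stalk B x" by (rule stalk_mod[OF x(1)])
      have "\<not> arrow x y" for y using True not_above_w by (simp add: arrow_def)
      then show ?thesis using P.M.zero_closed by blast
    next
      case False
      let ?L = "{y. below G x y}"
      have "restrict m ?L \<in> \<Gamma> ?L" using max by (intro \<Gamma>_restrict[OF less.prems(2)]) auto
      then have "dmap x (restrict m ?L) \<in> rho_delta G B x ` carrier (stalk B x)"
        unfolding delta_stalk_carrier[OF x(1) False] by (rule imageI)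
      then obtain p where p: "p \<in> carrier (stalk B x)" "rho_delta G B x p = dmap x (restrict m ?L)"
        by (elim imageE) simp
      then have "rho B x {x, y} p = rho B y {x, y} (m y)" if "arrow x y" for y
        using that unfolding rho_delta_eq_dmap by (simp add: arrow_def)
      then show ?thesis using p(1) by blast
    qed
    then obtain p where p: "p \<in> carrier (stalk B x)"
      "\<And>y. arrow x y \<Longrightarrow> y \<in> L \<Longrightarrow> rho B x {x, y} p = rho B y {x, y} (m y)" by blast
    have ins: "m(x := p) \<in> \<Gamma> (insert x L)" by (rule \<Gamma>_insert[OF less.prems x p])
    have up: "upclosed (insert x L)" using less.prems(1) x(1) max unfolding upclosed_def by blast
    have "card (verts G - insert x L) < card (verts G - L)"
      using x finite_verts by (intro psubset_card_mono) auto
    from less.hyps[OF this up ins] obtain m' where m': "m' \<in> \<Gamma> (verts G)"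
      "\<forall>y \<in> insert x L. m' y = (m(x := p)) y" by blast
    have "\<forall>y \<in> L. m' y = m y" using m'(2) x(2) by auto
    then show ?thesis using m'(1) by blast
  qed (use less.prems in blast)
qed

text \<open>Condition (3) continues \<open>p\<close> to all vertices above \<open>x\<close>, and
  flabbiness extends the result to the whole graph. Consequently a form on a stalk is determined by
  its effect on global sections.\<close>

lemma global_section_through:
  assumes x: "x \<in> verts G" and p: "p \<in> carrier (stalk B x)"
  obtains m where "m \<in> \<Gamma> (verts G)" "m x = p"
proof -
  let ?L = "{y. below G x y}"
  have up: "upclosed ?L" using below_verts below_trans by (auto simp: upclosed_def)
  have "\<exists>m \<in> \<Gamma> ?L. \<forall>y. arrow x y \<longrightarrow> rho B x {x, y} p = rho B y {x, y} (m y)"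
  proof (cases "x = w")
    case True
    then have "?L = {}" using not_above_w by auto
    \<comment> \<open>Over the empty set the extensional function with value
      \<open>undefined\<close> is the only section.\<close>
    then show ?thesis by (intro bexI[of _ "\<lambda>_. undefined"]) (auto simp: \<Gamma>_iff arrow_def)
  next
    case False
    have "rho_delta G B x p \<in> dmap x ` \<Gamma> ?L" using delta_stalk_carrier[OF x False] p by blast
    then obtain m where "m \<in> \<Gamma> ?L" "rho_delta G B x p = dmap x m" by blast
    then show ?thesis unfolding rho_delta_eq_dmap by blast
  qed
  then obtain m where m: "m \<in> \<Gamma> ?L" "\<And>y. arrow x y \<Longrightarrow> rho B x {x, y} p = rho B y {x, y} (m y)" by blast
  have "m(x := p) \<in> \<Gamma> (insert x ?L)"
    by (rule \<Gamma>_insert[OF up m(1) x _ p m(2)]) (simp add: below_not_refl)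
  moreover have "upclosed (insert x ?L)" using up x by (auto simp: upclosed_def)
  ultimately obtain m' where m': "m' \<in> \<Gamma> (verts G)" "\<forall>y \<in> insert x ?L. m' y = (m(x := p)) y"
    using extend_section[of "insert x ?L" "m(x := p)"] by blast
  then have "m' x = p" by simp
  with m'(1) show ?thesis by (rule that)
qed

lemma \<Gamma>_verts_closed: "m \<in> \<Gamma> (verts G) \<Longrightarrow> x \<in> verts G \<Longrightarrow> m x \<in> carrier (stalk B x)"
  by (auto simp: \<Gamma>_iff)

lemma \<Gamma>_verts_arrow: "m \<in> \<Gamma> (verts G) \<Longrightarrow> arrow x y \<Longrightarrow> rho B x {x, y} (m x) = rho B y {x, y} (m y)"
  using arrow_verts[of x y] unfolding \<Gamma>_iff by blast

section \<open>Non-negative degrees and the degree 0 section\<close>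

lemma edge_hpart_lift:
  assumes "arrow x y" "q \<in> hpart (edge_stalk B {x, y}) n"
  obtains p where "p \<in> hpart (stalk B y) n" "rho B y {x, y} p = q"
proof -
  interpret Q: graded_mod S "edge_stalk B {x, y}" by (rule edge_mod[OF arrow_edge[OF assms(1)]])
  interpret P: graded_mod S "stalk B y" using stalk_mod arrow_verts[OF assms(1)] by blast
  obtain p where p: "p \<in> carrier (stalk B y)" "rho B y {x, y} p = q"
    using rho_surj[OF assms(1)] Q.M.hpart_carrier[OF assms(2)] by blast
  have "rho B y {x, y} (gcomp (stalk B y) n p) = q"
    using rho_gcomp[OF arrow_edge[OF assms(1)], of y p n] p Q.M.gcomp_hom[OF assms(2)] by simp
  then show ?thesis using that P.M.gcomp_hpart[OF p(1)] by blast
qed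

lemma stalk_w_iso: "graded_iso S (stalk B w) S"
  using BM by (simp add: is_Braden_MacPherson_def Let_def)

text \<open>By minimality of the projective cover, stalks live in non-negative degrees.\<close>

lemma stalk_neg:
  assumes "x \<in> verts G" "n < 0"
  shows "hpart (stalk B x) n = {\<zero>\<^bsub>stalk B x\<^esub>}"
  using assms
proof (induction x arbitrary: n rule: arrow_induct)
  case (step x)
  interpret P: graded_mod S "stalk B x" by (rule stalk_mod[OF step(1)])
  show ?case
  proof (cases "x = w")
    case True
    obtain f where f: "f \<in> graded_hom S (stalk B x) S" "inj_on f (carrier (stalk B x))"
      using stalk_w_iso True unfolding graded_iso_def bij_betw_def by blast
    have f0: "f \<zero>\<^bsub>stalk B x\<^esub> = \<zero>\<^bsub>S\<^esub>"
      by (rule additive_on_zero[OF graded_hom_additive[OF f(1)] P.M.abelian_group_axioms S.abelian_group_axioms])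
    have "p = \<zero>\<^bsub>stalk B x\<^esub>" if p: "p \<in> hpart (stalk B x) n" for p
    proof -
      have "f p \<in> hpart S n" using f(1) p unfolding graded_hom_def by blast
      then have "f p = \<zero>\<^bsub>S\<^esub>" using S.hpart_neg[OF step(3)] by simp
      then show ?thesis using f0 inj_onD[OF f(2)] P.M.hpart_carrier[OF p] by simp
    qed
    then show ?thesis by auto
  next
    case False
    \<comment> \<open>All non-negative degrees and nothing below. The restriction of an element of
      negative degree to an upper edge lifts to the same degree of the upper stalk, which is zero by
      induction; so dropping negative degrees does not change the image.\<close>
    define U where "U n = (if n < 0 then {\<zero>\<^bsub>stalk B x\<^esub>} else hpart (stalk B x) n)" for n
    have "U n = hpart (stalk B x) n"
    proof (rule S.projective_cover_family[OF cover[OF step(1) False]])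
      show "U n \<subseteq> hpart (stalk B x) n" for n by (auto simp: U_def)
      show "\<zero>\<^bsub>stalk B x\<^esub> \<in> U n" for n by (simp add: U_def)
      show "u \<oplus>\<^bsub>stalk B x\<^esub> v \<in> U n" if "u \<in> U n" "v \<in> U n" for n u v
        using that by (auto simp: U_def P.M.hpart_add split: if_splits)
      show "a \<odot>\<^bsub>stalk B x\<^esub> u \<in> U (i + n)" if au: "a \<in> hpart S i" "u \<in> U n" for i n a u
      proof -
        have ac: "a \<in> carrier S" by (rule S.S.hpart_carrier[OF au(1)])
        show ?thesis
        proof (cases "n < 0")
          case True
          then show ?thesis using au ac by (simp add: U_def)
        next
          case n: False
          then have u: "u \<in> hpart (stalk B x) n" using au by (simp add: U_def)
          show ?thesis
          proof (cases "i + n < 0")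
            case True
            then have "a = \<zero>\<^bsub>S\<^esub>" using n S.hpart_neg[of i] au(1) by simp
            then show ?thesis using P.M.hpart_carrier[OF u] True by (simp add: U_def)
          qed (simp add: U_def P.smult_hpart[OF au(1) u])
        qed
      qed
      show "\<exists>u \<in> U n. rho_delta G B x p = rho_delta G B x u" if p: "p \<in> hpart (stalk B x) n" for n p
      proof (cases "n < 0")
        case True
        have "rho_delta G B x p = rho_delta G B x \<zero>\<^bsub>stalk B x\<^esub>"
        proof (rule rho_delta_eqI)
          fix y assume xy: "arrow x y"
          have E: "{x, y} \<in> edges G" by (rule arrow_edge[OF xy])
          have "rho B x {x, y} p \<in> hpart (edge_stalk B {x, y}) n" using rho_hpart[OF E _ p] by simp
          then obtain q where q: "q \<in> hpart (stalk B y) n" "rho B y {x, y} q = rho B x {x, y} p"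
            by (rule edge_hpart_lift[OF xy])
          have "below G x y" using xy by (simp add: arrow_def)
          then have "q = \<zero>\<^bsub>stalk B y\<^esub>" using step(2)[of y n] q(1) True by simp
          then show "rho B x {x, y} p = rho B x {x, y} \<zero>\<^bsub>stalk B x\<^esub>"
            using q(2) rho_zero[OF E, of x] rho_zero[OF E, of y] by simp
        qed
        then show ?thesis using True by (simp add: U_def)
      qed (use p in \<open>auto simp: U_def\<close>)
    qed
    then show ?thesis using step(3) by (simp add: U_def)
  qed
qed

text \<open>A degree 0 element of \<open>stalk B y\<close> cannot lie in \<open>\<alpha>(E) (stalk B y)\<close>.\<close>

lemma rho_hpart_0_nonzero:
  assumes "arrow x y" "p \<in> hpart (stalk B y) 0" "p \<noteq> \<zero>\<^bsub>stalk B y\<^esub>"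
  shows "rho B y {x, y} p \<noteq> \<zero>\<^bsub>edge_stalk B {x, y}\<^esub>"
proof
  assume *: "rho B y {x, y} p = \<zero>\<^bsub>edge_stalk B {x, y}\<^esub>"
  have y: "y \<in> verts G" using arrow_verts[OF assms(1)] by simp
  interpret P: graded_mod S "stalk B y" by (rule stalk_mod[OF y])
  obtain q where q: "q \<in> carrier (stalk B y)" "p = lab {x, y} \<odot>\<^bsub>stalk B y\<^esub> q"
    using rho_kernel[OF assms(1) P.M.hpart_carrier[OF assms(2)] *] by blast
  have "q \<in> hpart (stalk B y) (- 1)"
    by (rule P.smult_reflects_hpart[OF stalk_tf[OF y] lab_hpart lab_nonzero[OF arrow_edge[OF assms(1)]] q(1)])
      (use assms(2) q(2) in simp)
  then show False using stalk_neg[OF y, of "- 1"] q(2) assms(3) by simp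
qed

lemma \<Gamma>_gcomp:
  assumes m: "m \<in> \<Gamma> (verts G)"
  shows "(\<lambda>x\<in>verts G. gcomp (stalk B x) n (m x)) \<in> \<Gamma> (verts G)"
  unfolding \<Gamma>_iff
proof (intro conjI ballI impI)
  show "(\<lambda>x\<in>verts G. gcomp (stalk B x) n (m x)) \<in> (\<Pi>\<^sub>E x\<in>verts G. carrier (stalk B x))"
  proof (rule restrict_PiE_iff[THEN iffD2], rule ballI)
    fix x assume x: "x \<in> verts G"
    interpret P: graded_mod S "stalk B x" by (rule stalk_mod[OF x])
    show "gcomp (stalk B x) n (m x) \<in> carrier (stalk B x)"
      by (rule P.M.gcomp_closed[OF \<Gamma>_verts_closed[OF m x]])
  qed
  fix x y assume xy: "x \<in> verts G" "y \<in> verts G" "arrow x y"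
  have "rho B x {x, y} (gcomp (stalk B x) n (m x)) = rho B y {x, y} (gcomp (stalk B y) n (m y))"
    using xy \<Gamma>_verts_closed[OF m] \<Gamma>_verts_arrow[OF m xy(3)]
    by (simp add: rho_gcomp[OF arrow_edge[OF xy(3)]])
  then show "rho B x {x, y} ((\<lambda>x\<in>verts G. gcomp (stalk B x) n (m x)) x) =
      rho B y {x, y} ((\<lambda>x\<in>verts G. gcomp (stalk B x) n (m x)) y)" using xy by simp
qed

text \<open>The degree 0 component of a global section through a generator of the stalk at
  \<open>w\<close>. Nonvanishing spreads downwards: every other vertex has an upper neighbour
  \<open>y\<close>, and a nonzero element of degree 0 at \<open>y\<close> survives restriction to
  the edge, so the value at the lower end cannot be zero either.\<close>

lemma normalized_section:
  obtains \<beta> where "\<beta> \<in> \<Gamma> (verts G)" "\<And>x. x \<in> verts G \<Longrightarrow> \<beta> x \<in> hpart (stalk B x) 0"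
    "\<And>x. x \<in> verts G \<Longrightarrow> \<beta> x \<noteq> \<zero>\<^bsub>stalk B x\<^esub>"
proof -
  interpret W: graded_mod S "stalk B w" by (rule stalk_mod[OF w_vert])
  obtain f where f: "f \<in> graded_hom S (stalk B w) S" "bij_betw f (carrier (stalk B w)) (carrier S)"
    using stalk_w_iso unfolding graded_iso_def by blast
  have f0: "f \<zero>\<^bsub>stalk B w\<^esub> = \<zero>\<^bsub>S\<^esub>"
    by (rule additive_on_zero[OF graded_hom_additive[OF f(1)] W.M.abelian_group_axioms S.abelian_group_axioms])
  obtain u where u: "u \<in> carrier (stalk B w)" "f u = \<one>\<^bsub>S\<^esub>"
    using f(2) S.one_closed unfolding bij_betw_def by (metis imageE)
  have "u \<in> hpart (stalk B w) 0"
  proof (rule additive_on_reflects_hpart[where d = 0, OF graded_hom_additive[OF f(1)] W.M.graded_group_axioms S.S.graded_group_axioms _ _ u(1)])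
    show "f ` hpart (stalk B w) n \<subseteq> hpart S (n + 0)" for n using f(1) by (simp add: graded_hom_def)
    show "m = \<zero>\<^bsub>stalk B w\<^esub>" if "m \<in> carrier (stalk B w)" "f m = \<zero>\<^bsub>S\<^esub>" for m
      using f(2) f0 that unfolding bij_betw_def by (metis W.M.zero_closed inj_onD)
  qed (simp add: u(2) S.one_hpart)
  obtain m where m: "m \<in> \<Gamma> (verts G)" "m w = u" by (rule global_section_through[OF w_vert u(1)])
  define \<beta> where "\<beta> = (\<lambda>x \<in> verts G. gcomp (stalk B x) 0 (m x))"
  have hp: "\<beta> x \<in> hpart (stalk B x) 0" if x: "x \<in> verts G" for x
  proof -
    interpret P: graded_mod S "stalk B x" by (rule stalk_mod[OF x])
    show ?thesis using P.M.gcomp_hpart \<Gamma>_verts_closed[OF m(1) x] x by (simp add: \<beta>_def)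
  qed
  have \<beta>: "\<beta> \<in> \<Gamma> (verts G)" unfolding \<beta>_def by (rule \<Gamma>_gcomp[OF m(1)])
  have "\<beta> x \<noteq> \<zero>\<^bsub>stalk B x\<^esub>" if "x \<in> verts G" for x
    using that
  proof (induction x rule: arrow_induct)
    case (step x)
    show ?case
    proof (cases "x = w")
      case True
      have "\<beta> w = u" using \<open>u \<in> hpart _ 0\<close> m(2) w_vert by (simp add: \<beta>_def W.M.gcomp_hom)
      moreover have "u \<noteq> \<zero>\<^bsub>stalk B w\<^esub>" using u(2) f0 S.one_not_zero by auto
      ultimately show ?thesis using True by simp
    next
      case False
      then obtain y where xy: "arrow x y" using exists_arrow step(1) by blast
      then have "rho B y {x, y} (\<beta> y) \<noteq> \<zero>\<^bsub>edge_stalk B {x, y}\<^esub>"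
        using step(2)[of y] hp[of y] arrow_verts[OF xy] by (intro rho_hpart_0_nonzero) (auto simp: arrow_def)
      then have "rho B x {x, y} (\<beta> x) \<noteq> rho B x {x, y} \<zero>\<^bsub>stalk B x\<^esub>"
        using \<Gamma>_verts_arrow[OF \<beta> xy] rho_zero[OF arrow_edge[OF xy], of x] by simp
      then show ?thesis by auto
    qed
  qed
  with \<beta> hp show ?thesis using that by blast
qed

end

section \<open>Smooth vertices\<close>

locale normalized_BM_sheaf = BM_sheaf scale Basis G B w
  for scale :: "'k::field \<Rightarrow> 'v::ab_group_add \<Rightarrow> 'v" and Basis
    and G :: "('x, 'v) moment_graph" and B :: "('x, ('k, 'v) sym, 'm, 'n) sheaf" and w +
  fixes \<beta> :: "'x \<Rightarrow> 'm"
  assumes \<beta>_section: "\<beta> \<in> \<Gamma> (verts G)"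
    and \<beta>_hpart: "x \<in> verts G \<Longrightarrow> \<beta> x \<in> hpart (stalk B x) 0"
    and \<beta>_nonzero: "x \<in> verts G \<Longrightarrow> \<beta> x \<noteq> \<zero>\<^bsub>stalk B x\<^esub>"
begin

definition smooth :: "'x \<Rightarrow> bool" where
  "smooth x \<longleftrightarrow> (\<forall>m \<in> carrier (stalk B x). \<exists>s \<in> carrier S. m = s \<odot>\<^bsub>stalk B x\<^esub> \<beta> x)"

lemma smoothE:
  assumes "smooth x" "m \<in> carrier (stalk B x)"
  obtains s where "s \<in> carrier S" "m = s \<odot>\<^bsub>stalk B x\<^esub> \<beta> x"
  using assms unfolding smooth_def by blast

lemma \<beta>_closed: "x \<in> verts G \<Longrightarrow> \<beta> x \<in> carrier (stalk B x)"
  using \<Gamma>_verts_closed[OF \<beta>_section] .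

lemma \<beta>_arrow: "arrow x y \<Longrightarrow> rho B x {x, y} (\<beta> x) = rho B y {x, y} (\<beta> y)"
  using \<Gamma>_verts_arrow[OF \<beta>_section] .

lemma smult_\<beta>_cancel:
  assumes "x \<in> verts G" "s \<in> carrier S" "t \<in> carrier S"
    and "s \<odot>\<^bsub>stalk B x\<^esub> \<beta> x = t \<odot>\<^bsub>stalk B x\<^esub> \<beta> x"
  shows "s = t"
  by (rule graded_mod.smult_eq_cancel[OF stalk_mod[OF assms(1)] stalk_tf[OF assms(1)] assms(2,3)
    \<beta>_closed[OF assms(1)] \<beta>_nonzero[OF assms(1)] assms(4)])

lemma smult_\<beta>_hom: "x \<in> verts G \<Longrightarrow> (\<lambda>s. s \<odot>\<^bsub>stalk B x\<^esub> \<beta> x) \<in> graded_hom S S (stalk B x)"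
proof -
  assume x: "x \<in> verts G"
  interpret P: graded_mod S "stalk B x" by (rule stalk_mod[OF x])
  have "s \<odot>\<^bsub>stalk B x\<^esub> \<beta> x \<in> hpart (stalk B x) n" if "s \<in> hpart S n" for s n
    using P.smult_hpart[OF that \<beta>_hpart[OF x]] by simp
  then show ?thesis
    using \<beta>_closed[OF x]
    by (simp add: graded_hom_def linear_maps_def P.M.smult_l_distr P.M.smult_assoc1 S.smult_S image_subset_iff)
qed

lemma smult_\<beta>_hpart:
  assumes x: "x \<in> verts G" and s: "s \<in> carrier S" "s \<odot>\<^bsub>stalk B x\<^esub> \<beta> x \<in> hpart (stalk B x) n"
  shows "s \<in> hpart S n"
proof -
  interpret P: graded_mod S "stalk B x" by (rule stalk_mod[OF x])
  show ?thesis
  proof (rule additive_on_reflects_hpart[where d = 0, OF graded_hom_additive[OF smult_\<beta>_hom[OF x]]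
      S.S.graded_group_axioms P.M.graded_group_axioms _ _ s(1)])
    show "(\<lambda>s. s \<odot>\<^bsub>stalk B x\<^esub> \<beta> x) ` hpart S n \<subseteq> hpart (stalk B x) (n + 0)" for n
      using smult_\<beta>_hom[OF x] by (simp add: graded_hom_def)
    show "m = \<zero>\<^bsub>S\<^esub>" if "m \<in> carrier S" "m \<odot>\<^bsub>stalk B x\<^esub> \<beta> x = \<zero>\<^bsub>stalk B x\<^esub>" for m
      by (rule smult_\<beta>_cancel[OF x that(1) S.zero_closed]) (simp add: that(2) \<beta>_closed[OF x])
  qed (simp add: s(2))
qed

text \<open>The inverse of multiplying \<beta>_x by scalars, which is injective by torsion-freeness,
  surjective by smoothness, and respects degrees because \<beta>_x has degree 0.\<close>

lemma smooth_coordinate: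
  assumes x: "x \<in> verts G" and sm: "smooth x"
  obtains f where "f \<in> graded_hom S (stalk B x) S" "bij_betw f (carrier (stalk B x)) (carrier S)"
    "f (\<beta> x) = \<one>\<^bsub>S\<^esub>"
proof -
  interpret P: graded_mod S "stalk B x" by (rule stalk_mod[OF x])
  define g where "g s = s \<odot>\<^bsub>stalk B x\<^esub> \<beta> x" for s
  define f where "f = inv_into (carrier S) g"
  have inj: "inj_on g (carrier S)" unfolding g_def by (intro inj_onI) (rule smult_\<beta>_cancel[OF x])
  have img: "g ` carrier S = carrier (stalk B x)"
  proof
    show "g ` carrier S \<subseteq> carrier (stalk B x)" using \<beta>_closed[OF x] by (auto simp: g_def)
    show "carrier (stalk B x) \<subseteq> g ` carrier S" using sm unfolding smooth_def g_def by blast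
  qed
  have bij: "bij_betw f (carrier (stalk B x)) (carrier S)"
    unfolding f_def using inj img by (intro bij_betw_inv_into) (simp add: bij_betw_def)
  have fg: "f (g s) = s" if "s \<in> carrier S" for s
    unfolding f_def by (rule inv_into_f_f[OF inj that])
  have ex: "\<exists>s \<in> carrier S. m = g s" if "m \<in> carrier (stalk B x)" for m
    using sm that unfolding smooth_def g_def by blast
  have g_add: "g s \<oplus>\<^bsub>stalk B x\<^esub> g t = g (s \<oplus>\<^bsub>S\<^esub> t)" if "s \<in> carrier S" "t \<in> carrier S" for s t
    using that \<beta>_closed[OF x] by (simp add: g_def P.M.smult_l_distr)
  have g_smult: "a \<odot>\<^bsub>stalk B x\<^esub> g s = g (a \<otimes>\<^bsub>S\<^esub> s)" if "a \<in> carrier S" "s \<in> carrier S" for a s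
    using that \<beta>_closed[OF x] by (simp add: g_def P.M.smult_assoc1)
  have "f m \<in> carrier S" if "m \<in> carrier (stalk B x)" for m
    using bij that by (rule bij_betwE[THEN bspec])
  moreover have "f (m \<oplus>\<^bsub>stalk B x\<^esub> m') = f m \<oplus>\<^bsub>S\<^esub> f m'"
    if mm: "m \<in> carrier (stalk B x)" "m' \<in> carrier (stalk B x)" for m m'
  proof -
    obtain s t where "s \<in> carrier S" "m = g s" "t \<in> carrier S" "m' = g t" using ex[OF mm(1)] ex[OF mm(2)] by blast
    then show ?thesis by (simp add: g_add fg)
  qed
  moreover have "f (a \<odot>\<^bsub>stalk B x\<^esub> m) = a \<otimes>\<^bsub>S\<^esub> f m"
    if am: "a \<in> carrier S" "m \<in> carrier (stalk B x)" for a m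
  proof -
    obtain s where "s \<in> carrier S" "m = g s" using ex[OF am(2)] by blast
    then show ?thesis using am(1) by (simp add: g_smult fg)
  qed
  moreover have "f m \<in> hpart S n" if mn: "m \<in> hpart (stalk B x) n" for m n
  proof -
    obtain s where s: "s \<in> carrier S" "m = g s" using ex[OF P.M.hpart_carrier[OF mn]] by blast
    have "s \<in> hpart S n" by (rule smult_\<beta>_hpart[OF x s(1)]) (use mn s(2) in \<open>simp add: g_def\<close>)
    then show ?thesis using s by (simp add: fg)
  qed
  ultimately have "f \<in> graded_hom S (stalk B x) S"
    by (simp add: graded_hom_def linear_maps_def S.smult_S image_subset_iff)
  moreover have "f (\<beta> x) = \<one>\<^bsub>S\<^esub>" using fg[OF S.one_closed] \<beta>_closed[OF x] by (simp add: g_def)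
  ultimately show ?thesis using that bij by blast
qed

text \<open>An isomorphism onto \<open>S\<close> takes \<beta>_x to a nonzero element of degree 0,
  which is a unit; therefore \<beta>_x is a generator as soon as any generator exists.\<close>

lemma graded_iso_iff_smooth:
  assumes x: "x \<in> verts G"
  shows "graded_iso S (stalk B x) S \<longleftrightarrow> smooth x"
proof
  assume "smooth x"
  from smooth_coordinate[OF x this] obtain f where "f \<in> graded_hom S (stalk B x) S"
    "bij_betw f (carrier (stalk B x)) (carrier S)" by blast
  then show "graded_iso S (stalk B x) S" unfolding graded_iso_def by blast
next
  assume "graded_iso S (stalk B x) S"
  then obtain f where f: "f \<in> graded_hom S (stalk B x) S" and bij: "bij_betw f (carrier (stalk B x)) (carrier S)"
    unfolding graded_iso_def by (rule bexE)
  interpret P: graded_mod S "stalk B x" by (rule stalk_mod[OF x])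
  have inj: "inj_on f (carrier (stalk B x))" using bij by (rule bij_betw_imp_inj_on)
  have f0: "f \<zero>\<^bsub>stalk B x\<^esub> = \<zero>\<^bsub>S\<^esub>"
    by (rule additive_on_zero[OF graded_hom_additive[OF f] P.M.abelian_group_axioms S.abelian_group_axioms])
  have f_closed: "f m \<in> carrier S" if "m \<in> carrier (stalk B x)" for m
    using bij that by (rule bij_betwE[THEN bspec])
  have f_smult: "f (a \<odot>\<^bsub>stalk B x\<^esub> m) = a \<otimes>\<^bsub>S\<^esub> f m"
    if "a \<in> carrier S" "m \<in> carrier (stalk B x)" for a m
    using f that by (simp add: graded_hom_def linear_maps_def S.smult_S)
  have "f (\<beta> x) \<in> hpart S 0" using f \<beta>_hpart[OF x] by (auto simp: graded_hom_def)
  moreover have "f (\<beta> x) \<noteq> \<zero>\<^bsub>S\<^esub>"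
    using inj_onD[OF inj _ \<beta>_closed[OF x] P.M.zero_closed] f0 \<beta>_nonzero[OF x] by auto
  ultimately obtain c where c: "c \<in> hpart S 0" "c \<otimes>\<^bsub>S\<^esub> f (\<beta> x) = \<one>\<^bsub>S\<^esub>" using S.hpart_0_inv by blast
  have cc: "c \<in> carrier S" by (rule S.S.hpart_carrier[OF c(1)])
  show "smooth x"
    unfolding smooth_def
  proof
    fix m assume m: "m \<in> carrier (stalk B x)"
    let ?s = "f m \<otimes>\<^bsub>S\<^esub> c"
    have s: "?s \<in> carrier S" using f_closed[OF m] cc by simp
    have "f (?s \<odot>\<^bsub>stalk B x\<^esub> \<beta> x) = f m \<otimes>\<^bsub>S\<^esub> (c \<otimes>\<^bsub>S\<^esub> f (\<beta> x))"
      using f_smult[OF s \<beta>_closed[OF x]] f_closed[OF m] cc f_closed[OF \<beta>_closed[OF x]]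
      by (simp add: S.m_assoc)
    then have "f m = f (?s \<odot>\<^bsub>stalk B x\<^esub> \<beta> x)" using c(2) f_closed[OF m] by simp
    then have "m = ?s \<odot>\<^bsub>stalk B x\<^esub> \<beta> x"
      using inj_onD[OF inj] m s \<beta>_closed[OF x] by simp
    then show "\<exists>s \<in> carrier S. m = s \<odot>\<^bsub>stalk B x\<^esub> \<beta> x" using s by (rule bexI)
  qed
qed

lemma smooth_w: "smooth w"
  using graded_iso_iff_smooth[OF w_vert] stalk_w_iso by simp

text \<open>At the smooth upper end \<open>z\<close> the kernel of the restriction is the label
  times \<open>S\<close> \<beta>_z, and \<beta>_z can be cancelled by torsion-freeness. Both ends
  are allowed for \<open>v\<close>, since \<beta> restricts to the same element of the edge from
  either side.\<close>

lemma \<beta>_annihilator: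
  assumes yz: "arrow y z" and sm: "smooth z" and v: "v = y \<or> v = z" and s: "s \<in> carrier S"
    and zero: "s \<odot>\<^bsub>edge_stalk B {y, z}\<^esub> rho B v {y, z} (\<beta> v) = \<zero>\<^bsub>edge_stalk B {y, z}\<^esub>"
  shows "s \<in> PIdl\<^bsub>S\<^esub> (lab {y, z})"
proof -
  have z: "z \<in> verts G" using arrow_verts[OF yz] by simp
  interpret P: graded_mod S "stalk B z" by (rule stalk_mod[OF z])
  have "rho B v {y, z} (\<beta> v) = rho B z {y, z} (\<beta> z)"
    using v
  proof
    assume "v = y"
    then show ?thesis using \<beta>_arrow[OF yz] by simp
  qed simp
  then have zb: "rho B z {y, z} (s \<odot>\<^bsub>stalk B z\<^esub> \<beta> z) = \<zero>\<^bsub>edge_stalk B {y, z}\<^esub>"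
    using zero rho_smult[OF arrow_edge[OF yz], of z s "\<beta> z"] s \<beta>_closed[OF z] by simp
  have cb: "s \<odot>\<^bsub>stalk B z\<^esub> \<beta> z \<in> carrier (stalk B z)" using s \<beta>_closed[OF z] by simp
  obtain q where q: "q \<in> carrier (stalk B z)"
    "s \<odot>\<^bsub>stalk B z\<^esub> \<beta> z = lab {y, z} \<odot>\<^bsub>stalk B z\<^esub> q"
    by (rule rho_kernel[OF yz cb zb])
  obtain t where t: "t \<in> carrier S" "q = t \<odot>\<^bsub>stalk B z\<^esub> \<beta> z" by (rule smoothE[OF sm q(1)])
  have "s \<odot>\<^bsub>stalk B z\<^esub> \<beta> z = (t \<otimes>\<^bsub>S\<^esub> lab {y, z}) \<odot>\<^bsub>stalk B z\<^esub> \<beta> z"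
    using q(2) t \<beta>_closed[OF z] by (simp add: P.M.smult_assoc1[symmetric] S.m_comm)
  then have "s = t \<otimes>\<^bsub>S\<^esub> lab {y, z}" by (intro smult_\<beta>_cancel[OF z s]) (simp_all add: t(1))
  then show ?thesis unfolding S.PIdl_iff using t(1) by blast
qed

text \<open>A graded Nakayama argument, by induction on the degree.\<close>

lemma smooth_arrow:
  assumes xy: "arrow x y" and sm: "smooth x"
  shows "smooth y"
proof -
  have x: "x \<in> verts G" and y: "y \<in> verts G" using arrow_verts[OF xy] by simp_all
  interpret P: graded_mod S "stalk B y" by (rule stalk_mod[OF y])
  have E: "{x, y} \<in> edges G" by (rule arrow_edge[OF xy])
  interpret Q: graded_mod S "edge_stalk B {x, y}" by (rule edge_mod[OF E])
  note cy = \<beta>_closed[OF y] and cx = \<beta>_closed[OF x]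
  \<comment> \<open>Every \<open>m\<close> at \<open>y\<close> lies on a global section, whose value
    at \<open>x\<close> is a multiple of \<beta>_x. So on the edge \<open>m\<close> agrees with a
    multiple of \<beta>_y, and the difference lies in the kernel of the restriction.\<close>
  have decomp: "\<exists>s \<in> carrier S. \<exists>q \<in> carrier (stalk B y).
      m = s \<odot>\<^bsub>stalk B y\<^esub> \<beta> y \<oplus>\<^bsub>stalk B y\<^esub> lab {x, y} \<odot>\<^bsub>stalk B y\<^esub> q"
    if m: "m \<in> carrier (stalk B y)" for m
  proof -
    obtain g where g: "g \<in> \<Gamma> (verts G)" "g y = m" by (rule global_section_through[OF y m])
    obtain s where s: "s \<in> carrier S" "g x = s \<odot>\<^bsub>stalk B x\<^esub> \<beta> x"
      by (rule smoothE[OF sm \<Gamma>_verts_closed[OF g(1) x]])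
    have "rho B y {x, y} m = rho B x {x, y} (g x)" using \<Gamma>_verts_arrow[OF g(1) xy] g(2) by simp
    also have "\<dots> = s \<odot>\<^bsub>edge_stalk B {x, y}\<^esub> rho B x {x, y} (\<beta> x)"
      unfolding s(2) by (rule rho_smult[OF E _ s(1) cx]) simp
    also have "\<dots> = rho B y {x, y} (s \<odot>\<^bsub>stalk B y\<^esub> \<beta> y)"
      unfolding \<beta>_arrow[OF xy] by (rule rho_smult[OF E _ s(1) cy, symmetric]) simp
    finally have eq: "rho B y {x, y} m = rho B y {x, y} (s \<odot>\<^bsub>stalk B y\<^esub> \<beta> y)" .
    let ?sb = "s \<odot>\<^bsub>stalk B y\<^esub> \<beta> y"
    let ?d = "m \<oplus>\<^bsub>stalk B y\<^esub> (\<ominus>\<^bsub>S\<^esub> \<one>\<^bsub>S\<^esub>) \<odot>\<^bsub>stalk B y\<^esub> ?sb"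
    have sb: "?sb \<in> carrier (stalk B y)" using s(1) cy by simp
    have nb: "(\<ominus>\<^bsub>S\<^esub> \<one>\<^bsub>S\<^esub>) \<odot>\<^bsub>stalk B y\<^esub> ?sb = \<ominus>\<^bsub>stalk B y\<^esub> ?sb"
      using sb by (simp add: P.M.smult_l_minus)
    have d: "?d \<in> carrier (stalk B y)" using m sb by simp
    have rc: "rho B y {x, y} ?sb \<in> carrier (edge_stalk B {x, y})" by (rule rho_closed[OF E _ sb]) simp
    have "rho B y {x, y} ?d = rho B y {x, y} m \<oplus>\<^bsub>edge_stalk B {x, y}\<^esub>
        (\<ominus>\<^bsub>S\<^esub> \<one>\<^bsub>S\<^esub>) \<odot>\<^bsub>edge_stalk B {x, y}\<^esub> rho B y {x, y} ?sb"
      using m sb by (simp add: rho_add[OF E] rho_smult[OF E])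
    also have "\<dots> = \<zero>\<^bsub>edge_stalk B {x, y}\<^esub>"
      unfolding eq using rc by (simp add: Q.M.smult_l_minus Q.M.r_neg)
    finally obtain q where q: "q \<in> carrier (stalk B y)" "?d = lab {x, y} \<odot>\<^bsub>stalk B y\<^esub> q"
      by (rule rho_kernel[OF xy d])
    have "?sb \<oplus>\<^bsub>stalk B y\<^esub> ?d = m"
      unfolding nb using P.M.a_lcomm[OF sb m, of "\<ominus>\<^bsub>stalk B y\<^esub> ?sb"] m sb by (simp add: P.M.r_neg)
    then have "m = ?sb \<oplus>\<^bsub>stalk B y\<^esub> lab {x, y} \<odot>\<^bsub>stalk B y\<^esub> q" unfolding q(2) by (rule sym)
    then show ?thesis using s(1) q(1) by blast
  qed
  \<comment> \<open>The degree \<open>int n - 1\<close> starts the induction at -1, where the stalk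
    vanishes. In the induction step the correction term is the label times an element one degree
    lower.\<close>
  have hom: "\<exists>s \<in> carrier S. m = s \<odot>\<^bsub>stalk B y\<^esub> \<beta> y" if "m \<in> hpart (stalk B y) (int n - 1)" for m n
    using that
  proof (induction n arbitrary: m)
    case 0
    then have "m = \<zero>\<^bsub>stalk B y\<^esub>" using stalk_neg[OF y, of "- 1"] by simp
    then show ?case using cy by (intro bexI[of _ "\<zero>\<^bsub>S\<^esub>"]) simp_all
  next
    case (Suc n)
    then have md: "m \<in> hpart (stalk B y) (int n)" by simp
    obtain s q where sq: "s \<in> carrier S" "q \<in> carrier (stalk B y)"
      "m = s \<odot>\<^bsub>stalk B y\<^esub> \<beta> y \<oplus>\<^bsub>stalk B y\<^esub> lab {x, y} \<odot>\<^bsub>stalk B y\<^esub> q"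
      using decomp[OF P.M.hpart_carrier[OF md]] by blast
    have "gcomp (stalk B y) (int n) m = gcomp (stalk B y) (int n) (s \<odot>\<^bsub>stalk B y\<^esub> \<beta> y) \<oplus>\<^bsub>stalk B y\<^esub>
        gcomp (stalk B y) (int n) (lab {x, y} \<odot>\<^bsub>stalk B y\<^esub> q)"
      unfolding sq(3) using sq(1,2) cy by (intro P.M.gcomp_add) simp_all
    moreover have "gcomp (stalk B y) (int n) m = m" using P.M.gcomp_hom[OF md] by simp
    moreover have "gcomp (stalk B y) (int n) (s \<odot>\<^bsub>stalk B y\<^esub> \<beta> y) = gcomp S (int n) s \<odot>\<^bsub>stalk B y\<^esub> \<beta> y"
      using P.gcomp_smult_right[OF sq(1) \<beta>_hpart[OF y], of "int n"] by simp
    moreover have "gcomp (stalk B y) (int n) (lab {x, y} \<odot>\<^bsub>stalk B y\<^esub> q) =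
        lab {x, y} \<odot>\<^bsub>stalk B y\<^esub> gcomp (stalk B y) (int n - 1) q"
      using P.gcomp_smult_left[OF lab_hpart sq(2), of "int n - 1"] by simp
    ultimately have m: "m = gcomp S (int n) s \<odot>\<^bsub>stalk B y\<^esub> \<beta> y \<oplus>\<^bsub>stalk B y\<^esub>
        lab {x, y} \<odot>\<^bsub>stalk B y\<^esub> gcomp (stalk B y) (int n - 1) q" by simp
    obtain t where t: "t \<in> carrier S" "gcomp (stalk B y) (int n - 1) q = t \<odot>\<^bsub>stalk B y\<^esub> \<beta> y"
      using Suc.IH[OF P.M.gcomp_hpart[OF sq(2)]] by blast
    let ?u = "gcomp S (int n) s \<oplus>\<^bsub>S\<^esub> lab {x, y} \<otimes>\<^bsub>S\<^esub> t"
    have "m = ?u \<odot>\<^bsub>stalk B y\<^esub> \<beta> y"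
      using S.S.gcomp_closed[OF sq(1), of "int n"] t(1) cy unfolding m t(2)
      by (simp add: P.M.smult_l_distr P.M.smult_assoc1)
    moreover have "?u \<in> carrier S" using S.S.gcomp_closed[OF sq(1), of "int n"] t(1) by simp
    ultimately show ?case by (rule bexI)
  qed
  have hom': "\<exists>s \<in> carrier S. m = s \<odot>\<^bsub>stalk B y\<^esub> \<beta> y" if m: "m \<in> hpart (stalk B y) n" for m n
  proof (cases "n < 0")
    case True
    then have "m \<in> hpart (stalk B y) (int 0 - 1)" using m stalk_neg[OF y] by simp
    then show ?thesis by (rule hom)
  next
    case False
    then have "m \<in> hpart (stalk B y) (int (nat (n + 1)) - 1)" using m by simp
    then show ?thesis by (rule hom)
  qed
  show ?thesis
    unfolding smooth_def
  proof
    fix m assume "m \<in> carrier (stalk B y)"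
    then show "\<exists>s \<in> carrier S. m = s \<odot>\<^bsub>stalk B y\<^esub> \<beta> y"
    proof (induction m rule: P.M.graded_induct)
      case (add m m')
      then obtain s t where st: "s \<in> carrier S" "t \<in> carrier S" "m = s \<odot>\<^bsub>stalk B y\<^esub> \<beta> y"
        "m' = t \<odot>\<^bsub>stalk B y\<^esub> \<beta> y" by blast
      have "m \<oplus>\<^bsub>stalk B y\<^esub> m' = (s \<oplus>\<^bsub>S\<^esub> t) \<odot>\<^bsub>stalk B y\<^esub> \<beta> y"
        unfolding st(3,4) by (rule P.M.smult_l_distr[OF st(1,2) cy, symmetric])
      then show ?case using st(1,2) by (intro bexI[of _ "s \<oplus>\<^bsub>S\<^esub> t"]) simp_all
    next
      case (hom n m)
      then show ?case by (rule hom')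
    qed
  qed
qed

lemma smooth_above:
  assumes "(x, y) \<in> le G" "x \<in> verts G" "smooth x"
  shows "smooth y"
  using assms by (induction rule: le_induct) (simp_all add: smooth_arrow)

end

subsection \<open>Duality\<close>

locale self_dual_BM_sheaf = normalized_BM_sheaf scale Basis G B w \<beta>
  for scale :: "'k::field \<Rightarrow> 'v::ab_group_add \<Rightarrow> 'v" and Basis
    and G :: "('x, 'v) moment_graph" and B :: "('x, ('k, 'v) sym, 'm, 'n) sheaf" and w \<beta> +
  fixes l :: int and F
  assumes F_hom: "F \<in> graded_hom (structure_algebra scale G)
      (graded_dual (sym_alg scale) (sections G B (verts G)) (Z_action G B)) (shift (global_sections G B) l)"
    and F_bij: "bij_betw F (carrier (graded_dual (sym_alg scale) (sections G B (verts G)) (Z_action G B)))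
      (carrier (shift (global_sections G B) l))"
begin

abbreviation "Sec \<equiv> sections G B (verts G)"
abbreviation "D \<equiv> graded_dual (sym_alg scale) (sections G B (verts G)) (Z_action G B)"
abbreviation "Z \<equiv> structure_algebra scale G"
abbreviation "\<Gamma>G \<equiv> \<Gamma> (verts G)"

lemma Sec_simps:
  "carrier Sec = \<Gamma>G" "m \<oplus>\<^bsub>Sec\<^esub> m' = (\<lambda>x\<in>verts G. m x \<oplus>\<^bsub>stalk B x\<^esub> m' x)"
  "a \<odot>\<^bsub>Sec\<^esub> m = (\<lambda>x\<in>verts G. a \<odot>\<^bsub>stalk B x\<^esub> m x)"
  "hpart Sec n = \<Gamma>G \<inter> (\<Pi>\<^sub>E x\<in>verts G. hpart (stalk B x) n)"
  by (simp_all add: \<Gamma>_def sections_def Let_def)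

lemma Z_iff: "z \<in> carrier Z \<longleftrightarrow> z \<in> (\<Pi>\<^sub>E x\<in>verts G. carrier S) \<and>
  (\<forall>x y. {x, y} \<in> edges G \<longrightarrow> z x \<ominus>\<^bsub>S\<^esub> z y \<in> PIdl\<^bsub>S\<^esub> (lab {x, y}))"
  by (simp add: structure_algebra_def Let_def lab_def)

lemma Z_closed: "z \<in> carrier Z \<Longrightarrow> x \<in> verts G \<Longrightarrow> z x \<in> carrier S"
  by (auto simp: Z_iff)

lemma zero_PIdl: "\<zero>\<^bsub>S\<^esub> \<in> PIdl\<^bsub>S\<^esub> (lab E)"
  unfolding S.PIdl_iff by (intro bexI[of _ "\<zero>\<^bsub>S\<^esub>"]) simp_all

lemma const_Z: "s \<in> carrier S \<Longrightarrow> (\<lambda>x\<in>verts G. s) \<in> carrier Z"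
  unfolding Z_iff
proof (intro conjI allI impI)
  fix x y assume s: "s \<in> carrier S" and xy: "{x, y} \<in> edges G"
  have "x \<in> verts G" "y \<in> verts G" using edge_vert[OF xy] by simp_all
  then show "(\<lambda>x\<in>verts G. s) x \<ominus>\<^bsub>S\<^esub> (\<lambda>x\<in>verts G. s) y \<in> PIdl\<^bsub>S\<^esub> (lab {x, y})"
    using zero_PIdl s by (simp add: S.minus_eq S.r_neg)
qed simp

lemma Z_action_const: "Z_action G B (\<lambda>x\<in>verts G. s) m = s \<odot>\<^bsub>Sec\<^esub> m"
  unfolding Z_action_def Sec_simps by (rule restrict_ext) simp

lemma \<Gamma>_add: "m \<in> \<Gamma>G \<Longrightarrow> m' \<in> \<Gamma>G \<Longrightarrow> m \<oplus>\<^bsub>Sec\<^esub> m' \<in> \<Gamma>G"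
proof -
  assume m: "m \<in> \<Gamma>G" "m' \<in> \<Gamma>G"
  note c = \<Gamma>_verts_closed[OF m(1)] \<Gamma>_verts_closed[OF m(2)]
  show ?thesis
    unfolding Sec_simps \<Gamma>_iff
  proof (intro conjI ballI impI)
    show "(\<lambda>x\<in>verts G. m x \<oplus>\<^bsub>stalk B x\<^esub> m' x) \<in> (\<Pi>\<^sub>E x\<in>verts G. carrier (stalk B x))"
    proof (rule restrict_PiE_iff[THEN iffD2], rule ballI)
      fix x assume x: "x \<in> verts G"
      interpret P: graded_mod S "stalk B x" by (rule stalk_mod[OF x])
      show "m x \<oplus>\<^bsub>stalk B x\<^esub> m' x \<in> carrier (stalk B x)" using c x by simp
    qed
    fix x y assume xy: "x \<in> verts G" "y \<in> verts G" "arrow x y"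
    have E: "{x, y} \<in> edges G" by (rule arrow_edge[OF xy(3)])
    show "rho B x {x, y} ((\<lambda>x\<in>verts G. m x \<oplus>\<^bsub>stalk B x\<^esub> m' x) x) =
        rho B y {x, y} ((\<lambda>x\<in>verts G. m x \<oplus>\<^bsub>stalk B x\<^esub> m' x) y)"
      using xy c \<Gamma>_verts_arrow[OF m(1) xy(3)] \<Gamma>_verts_arrow[OF m(2) xy(3)]
      by (simp add: rho_add[OF E])
  qed
qed

lemma \<Gamma>_act: "z \<in> carrier Z \<Longrightarrow> m \<in> \<Gamma>G \<Longrightarrow> Z_action G B z m \<in> \<Gamma>G"
proof -
  assume z: "z \<in> carrier Z" and m: "m \<in> \<Gamma>G"
  note c = \<Gamma>_verts_closed[OF m] Z_closed[OF z]
  show ?thesis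
    unfolding Z_action_def \<Gamma>_iff
  proof (intro conjI ballI impI)
    show "(\<lambda>x\<in>verts G. z x \<odot>\<^bsub>stalk B x\<^esub> m x) \<in> (\<Pi>\<^sub>E x\<in>verts G. carrier (stalk B x))"
    proof (rule restrict_PiE_iff[THEN iffD2], rule ballI)
      fix x assume x: "x \<in> verts G"
      interpret P: graded_mod S "stalk B x" by (rule stalk_mod[OF x])
      show "z x \<odot>\<^bsub>stalk B x\<^esub> m x \<in> carrier (stalk B x)" using c x by simp
    qed
    fix x y assume xy: "x \<in> verts G" "y \<in> verts G" "arrow x y"
    have E: "{x, y} \<in> edges G" by (rule arrow_edge[OF xy(3)])
    have r: "rho B y {x, y} (m y) \<in> carrier (edge_stalk B {x, y})"
      by (rule rho_closed[OF E _ c(1)[OF xy(2)]]) simp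
    have "z x \<ominus>\<^bsub>S\<^esub> z y \<in> PIdl\<^bsub>S\<^esub> (lab {x, y})" using z E unfolding Z_iff by blast
    then have "z x \<odot>\<^bsub>edge_stalk B {x, y}\<^esub> rho B y {x, y} (m y) =
        z y \<odot>\<^bsub>edge_stalk B {x, y}\<^esub> rho B y {x, y} (m y)"
      using graded_mod.smult_diff_zero[OF edge_mod[OF E] c(2)[OF xy(1)] c(2)[OF xy(2)] r]
        PIdl_lab_kills[OF E r] by simp
    then show "rho B x {x, y} ((\<lambda>x\<in>verts G. z x \<odot>\<^bsub>stalk B x\<^esub> m x) x) =
        rho B y {x, y} ((\<lambda>x\<in>verts G. z x \<odot>\<^bsub>stalk B x\<^esub> m x) y)"
      using xy c \<Gamma>_verts_arrow[OF m xy(3)] by (simp add: rho_smult[OF E])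
  qed
qed

lemma \<Gamma>_smult: "s \<in> carrier S \<Longrightarrow> m \<in> \<Gamma>G \<Longrightarrow> s \<odot>\<^bsub>Sec\<^esub> m \<in> \<Gamma>G"
  using \<Gamma>_act[OF const_Z] unfolding Z_action_const .

section \<open>The graded dual of the global sections\<close>

lemma D_linear: "f \<in> carrier D \<Longrightarrow> f \<in> linear_maps S Sec S"
  and D_ext: "f \<in> carrier D \<Longrightarrow> f \<in> extensional \<Gamma>G"
  by (simp_all add: graded_dual_def Sec_simps)

lemma linear_simps:
  assumes "f \<in> linear_maps S Sec S"
  shows "m \<in> \<Gamma>G \<Longrightarrow> f m \<in> carrier S"
    and "m \<in> \<Gamma>G \<Longrightarrow> m' \<in> \<Gamma>G \<Longrightarrow> f (m \<oplus>\<^bsub>Sec\<^esub> m') = f m \<oplus>\<^bsub>S\<^esub> f m'"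
    and "s \<in> carrier S \<Longrightarrow> m \<in> \<Gamma>G \<Longrightarrow> f (s \<odot>\<^bsub>Sec\<^esub> m) = s \<otimes>\<^bsub>S\<^esub> f m"
  using assms unfolding linear_maps_def Sec_simps(1) S.smult_S by auto

lemmas D_simps = linear_simps[OF D_linear]

lemma linearI:
  assumes "\<And>m. m \<in> \<Gamma>G \<Longrightarrow> f m \<in> carrier S"
    and "\<And>m m'. m \<in> \<Gamma>G \<Longrightarrow> m' \<in> \<Gamma>G \<Longrightarrow> f (m \<oplus>\<^bsub>Sec\<^esub> m') = f m \<oplus>\<^bsub>S\<^esub> f m'"
    and "\<And>s m. s \<in> carrier S \<Longrightarrow> m \<in> \<Gamma>G \<Longrightarrow> f (s \<odot>\<^bsub>Sec\<^esub> m) = s \<otimes>\<^bsub>S\<^esub> f m"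
  shows "f \<in> linear_maps S Sec S"
  using assms unfolding linear_maps_def Sec_simps(1) S.smult_S by auto

lemma graded_hom_Sec_iff: "f \<in> graded_hom S Sec (shift S n) \<longleftrightarrow>
  f \<in> linear_maps S Sec S \<and> (\<forall>i. \<forall>m \<in> hpart Sec i. f m \<in> hpart S (n + i))"
  unfolding graded_hom_def linear_maps_def by (auto simp: image_subset_iff)

lemma hpart_D_iff: "f \<in> hpart D n \<longleftrightarrow> f \<in> graded_hom S Sec (shift S n) \<and> f \<in> extensional \<Gamma>G"
  by (simp add: graded_dual_def Sec_simps)

lemma D_carrier_iff: "f \<in> carrier D \<longleftrightarrow> f \<in> linear_maps S Sec S \<and> f \<in> extensional \<Gamma>G \<and>
  (\<exists>N c. finite N \<and> (\<forall>n \<in> N. c n \<in> graded_hom S Sec (shift S n)) \<and>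
    (\<forall>m \<in> \<Gamma>G. f m = (\<Oplus>\<^bsub>S\<^esub> n\<in>N. c n m)))"
  by (simp add: graded_dual_def Sec_simps)

lemma D_carrierI:
  assumes "f \<in> linear_maps S Sec S" "f \<in> extensional \<Gamma>G" "finite N"
    and "\<And>n. n \<in> N \<Longrightarrow> c n \<in> graded_hom S Sec (shift S n)"
    and "\<And>m. m \<in> \<Gamma>G \<Longrightarrow> f m = (\<Oplus>\<^bsub>S\<^esub> n\<in>N. c n m)"
  shows "f \<in> carrier D"
  unfolding D_carrier_iff using assms by (intro conjI exI[of _ N] exI[of _ c]) simp_all

lemma D_carrierE:
  assumes "f \<in> carrier D"
  obtains N c where "finite N" "\<forall>n \<in> N. c n \<in> graded_hom S Sec (shift S n)"
    "\<forall>m \<in> \<Gamma>G. f m = (\<Oplus>\<^bsub>S\<^esub> n\<in>N. c n m)"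
  using assms unfolding D_carrier_iff by (elim conjE exE) (rule that)

lemma hpart_D_carrier: "f \<in> hpart D n \<Longrightarrow> f \<in> carrier D"
proof -
  assume f: "f \<in> hpart D n"
  then have fl: "f \<in> linear_maps S Sec S" "f \<in> extensional \<Gamma>G" "f \<in> graded_hom S Sec (shift S n)"
    by (simp_all add: hpart_D_iff graded_hom_Sec_iff)
  show ?thesis
  proof (rule D_carrierI[where N = "{n}" and c = "\<lambda>_. f", OF fl(1,2)])
    fix m assume "m \<in> \<Gamma>G"
    then show "f m = (\<Oplus>\<^bsub>S\<^esub> n\<in>{n}. f m)" using linear_simps(1)[OF fl(1)] by simp
  qed (use fl(3) in simp_all)
qed

lemma D_add:
  assumes f: "f \<in> carrier D" and g: "g \<in> carrier D"
  shows "(\<lambda>m\<in>\<Gamma>G. f m \<oplus>\<^bsub>S\<^esub> g m) \<in> carrier D"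
proof -
  obtain N c where c_all: "finite N" "\<forall>n \<in> N. c n \<in> graded_hom S Sec (shift S n)"
    "\<forall>m \<in> \<Gamma>G. f m = (\<Oplus>\<^bsub>S\<^esub> n\<in>N. c n m)" by (rule D_carrierE[OF f])
  note c = c_all(1) bspec[OF c_all(2)] bspec[OF c_all(3)]
  obtain N' c' where c'_all: "finite N'" "\<forall>n \<in> N'. c' n \<in> graded_hom S Sec (shift S n)"
    "\<forall>m \<in> \<Gamma>G. g m = (\<Oplus>\<^bsub>S\<^esub> n\<in>N'. c' n m)" by (rule D_carrierE[OF g])
  note c' = c'_all(1) bspec[OF c'_all(2)] bspec[OF c'_all(3)]
  \<comment> \<open>Both families of homogeneous summands are padded by zero to have a common index
    set.\<close>
  define b where "b n = (if n \<in> N then c n else (\<lambda>m. \<zero>\<^bsub>S\<^esub>))" for n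
  define b' where "b' n = (if n \<in> N' then c' n else (\<lambda>m. \<zero>\<^bsub>S\<^esub>))" for n
  have zero: "(\<lambda>m. \<zero>\<^bsub>S\<^esub>) \<in> graded_hom S Sec (shift S n)" for n
    unfolding graded_hom_Sec_iff by (intro conjI linearI) simp_all
  have b: "b n \<in> graded_hom S Sec (shift S n)" "b' n \<in> graded_hom S Sec (shift S n)" for n
    using zero c(2)[of n] c'(2)[of n] by (simp_all add: b_def b'_def)
  have bl: "b n \<in> linear_maps S Sec S" "b' n \<in> linear_maps S Sec S" for n
    using b[of n] by (simp_all add: graded_hom_Sec_iff)
  note bc = linear_simps(1)[OF bl(1)] linear_simps(1)[OF bl(2)]
  show ?thesis
  proof (rule D_carrierI[where N = "N \<union> N'" and c = "\<lambda>n m. b n m \<oplus>\<^bsub>S\<^esub> b' n m"])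
    show "(\<lambda>m\<in>\<Gamma>G. f m \<oplus>\<^bsub>S\<^esub> g m) \<in> linear_maps S Sec S"
    proof (rule linearI)
      fix m m' assume m: "m \<in> \<Gamma>G" "m' \<in> \<Gamma>G"
      show "(\<lambda>m\<in>\<Gamma>G. f m \<oplus>\<^bsub>S\<^esub> g m) (m \<oplus>\<^bsub>Sec\<^esub> m') =
          (\<lambda>m\<in>\<Gamma>G. f m \<oplus>\<^bsub>S\<^esub> g m) m \<oplus>\<^bsub>S\<^esub> (\<lambda>m\<in>\<Gamma>G. f m \<oplus>\<^bsub>S\<^esub> g m) m'"
        using m \<Gamma>_add[OF m] D_simps(1)[OF f] D_simps(1)[OF g] D_simps(2)[OF f m] D_simps(2)[OF g m]
        by (simp add: S.add.m_ac)
    next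
      fix s m assume sm: "s \<in> carrier S" "m \<in> \<Gamma>G"
      show "(\<lambda>m\<in>\<Gamma>G. f m \<oplus>\<^bsub>S\<^esub> g m) (s \<odot>\<^bsub>Sec\<^esub> m) = s \<otimes>\<^bsub>S\<^esub> (\<lambda>m\<in>\<Gamma>G. f m \<oplus>\<^bsub>S\<^esub> g m) m"
        using sm \<Gamma>_smult[OF sm] D_simps(1)[OF f] D_simps(1)[OF g] D_simps(3)[OF f sm] D_simps(3)[OF g sm]
        by (simp add: S.r_distr)
    qed (use D_simps(1)[OF f] D_simps(1)[OF g] in simp)
    show "(\<lambda>m. b n m \<oplus>\<^bsub>S\<^esub> b' n m) \<in> graded_hom S Sec (shift S n)" for n
      unfolding graded_hom_Sec_iff
    proof (intro conjI linearI allI ballI)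
      fix m m' assume m: "m \<in> \<Gamma>G" "m' \<in> \<Gamma>G"
      show "b n (m \<oplus>\<^bsub>Sec\<^esub> m') \<oplus>\<^bsub>S\<^esub> b' n (m \<oplus>\<^bsub>Sec\<^esub> m') = (b n m \<oplus>\<^bsub>S\<^esub> b' n m) \<oplus>\<^bsub>S\<^esub> (b n m' \<oplus>\<^bsub>S\<^esub> b' n m')"
        using m bc linear_simps(2)[OF bl(1) m] linear_simps(2)[OF bl(2) m] by (simp add: S.add.m_ac)
    next
      fix s m assume sm: "s \<in> carrier S" "m \<in> \<Gamma>G"
      show "b n (s \<odot>\<^bsub>Sec\<^esub> m) \<oplus>\<^bsub>S\<^esub> b' n (s \<odot>\<^bsub>Sec\<^esub> m) = s \<otimes>\<^bsub>S\<^esub> (b n m \<oplus>\<^bsub>S\<^esub> b' n m)"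
        using sm bc linear_simps(3)[OF bl(1) sm] linear_simps(3)[OF bl(2) sm] by (simp add: S.r_distr)
    next
      fix i m assume "m \<in> hpart Sec i"
      then show "b n m \<oplus>\<^bsub>S\<^esub> b' n m \<in> hpart S (n + i)"
        using b[of n] unfolding graded_hom_Sec_iff by (intro S.S.hpart_add) simp_all
    qed (simp add: bc)
    fix m assume m: "m \<in> \<Gamma>G"
    have "(\<Oplus>\<^bsub>S\<^esub> n\<in>N. c n m) = (\<Oplus>\<^bsub>S\<^esub> n\<in>N \<union> N'. b n m)"
      using c(1) c'(1) bc(1)[OF m] by (intro S.add.finprod_mono_neutral_cong_left) (auto simp: b_def)
    moreover have "(\<Oplus>\<^bsub>S\<^esub> n\<in>N'. c' n m) = (\<Oplus>\<^bsub>S\<^esub> n\<in>N \<union> N'. b' n m)"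
      using c(1) c'(1) bc(2)[OF m] by (intro S.add.finprod_mono_neutral_cong_left) (auto simp: b'_def)
    moreover have "(\<Oplus>\<^bsub>S\<^esub> n\<in>N \<union> N'. b n m \<oplus>\<^bsub>S\<^esub> b' n m) = (\<Oplus>\<^bsub>S\<^esub> n\<in>N \<union> N'. b n m) \<oplus>\<^bsub>S\<^esub> (\<Oplus>\<^bsub>S\<^esub> n\<in>N \<union> N'. b' n m)"
      using bc[OF m] by (intro S.finsum_addf) simp_all
    ultimately show "(\<lambda>m\<in>\<Gamma>G. f m \<oplus>\<^bsub>S\<^esub> g m) m = (\<Oplus>\<^bsub>S\<^esub> n\<in>N \<union> N'. b n m \<oplus>\<^bsub>S\<^esub> b' n m)"
      using m c(3)[OF m] c'(3)[OF m] by simp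
  qed (use c(1) c'(1) in simp_all)
qed

lemma Z_action_add:
  assumes "z \<in> carrier Z" "m \<in> \<Gamma>G" "m' \<in> \<Gamma>G"
  shows "Z_action G B z (m \<oplus>\<^bsub>Sec\<^esub> m') = Z_action G B z m \<oplus>\<^bsub>Sec\<^esub> Z_action G B z m'"
  unfolding Z_action_def Sec_simps
proof (rule restrict_ext)
  fix x assume x: "x \<in> verts G"
  interpret P: graded_mod S "stalk B x" by (rule stalk_mod[OF x])
  show "z x \<odot>\<^bsub>stalk B x\<^esub> (\<lambda>x\<in>verts G. m x \<oplus>\<^bsub>stalk B x\<^esub> m' x) x =
      (\<lambda>x\<in>verts G. z x \<odot>\<^bsub>stalk B x\<^esub> m x) x \<oplus>\<^bsub>stalk B x\<^esub> (\<lambda>x\<in>verts G. z x \<odot>\<^bsub>stalk B x\<^esub> m' x) x"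
    using x Z_closed[OF assms(1) x] \<Gamma>_verts_closed[OF assms(2) x] \<Gamma>_verts_closed[OF assms(3) x]
    by (simp add: P.M.smult_r_distr)
qed

lemma Z_action_smult:
  assumes "z \<in> carrier Z" "s \<in> carrier S" "m \<in> \<Gamma>G"
  shows "Z_action G B z (s \<odot>\<^bsub>Sec\<^esub> m) = s \<odot>\<^bsub>Sec\<^esub> Z_action G B z m"
  unfolding Z_action_def Sec_simps
proof (rule restrict_ext)
  fix x assume x: "x \<in> verts G"
  interpret P: graded_mod S "stalk B x" by (rule stalk_mod[OF x])
  show "z x \<odot>\<^bsub>stalk B x\<^esub> (\<lambda>x\<in>verts G. s \<odot>\<^bsub>stalk B x\<^esub> m x) x =
      s \<odot>\<^bsub>stalk B x\<^esub> (\<lambda>x\<in>verts G. z x \<odot>\<^bsub>stalk B x\<^esub> m x) x"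
    using x Z_closed[OF assms(1) x] \<Gamma>_verts_closed[OF assms(3) x] assms(2)
    by (simp add: P.M.smult_assoc1[symmetric] S.m_comm)
qed

text \<open>For \<open>z\<close> homogeneous of a single degree \<open>d\<close>, the homogeneous
  summands of \<open>f\<close> composed with the action are those of \<open>f\<close>, each moved up
  by \<open>d\<close>. Only such \<open>z\<close> are needed: homogeneous scalars placed at every
  vertex, and the element \<open>off x\<close> introduced for support at \<open>x\<close>.\<close>

lemma D_act:
  assumes f: "f \<in> carrier D" and z: "z \<in> carrier Z" and d: "\<And>x. x \<in> verts G \<Longrightarrow> z x \<in> hpart S d"
  shows "(\<lambda>m\<in>\<Gamma>G. f (Z_action G B z m)) \<in> carrier D"
proof -
  note act = \<Gamma>_act[OF z]
  have lin: "(\<lambda>m. g (Z_action G B z m)) \<in> linear_maps S Sec S" if g: "g \<in> linear_maps S Sec S" for g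
  proof (rule linearI)
    show "g (Z_action G B z m) \<in> carrier S" if "m \<in> \<Gamma>G" for m
      using linear_simps(1)[OF g act[OF that]] .
    show "g (Z_action G B z (m \<oplus>\<^bsub>Sec\<^esub> m')) = g (Z_action G B z m) \<oplus>\<^bsub>S\<^esub> g (Z_action G B z m')"
      if "m \<in> \<Gamma>G" "m' \<in> \<Gamma>G" for m m'
      unfolding Z_action_add[OF z that] by (rule linear_simps(2)[OF g act[OF that(1)] act[OF that(2)]])
    show "g (Z_action G B z (s \<odot>\<^bsub>Sec\<^esub> m)) = s \<otimes>\<^bsub>S\<^esub> g (Z_action G B z m)"
      if "s \<in> carrier S" "m \<in> \<Gamma>G" for s m
      unfolding Z_action_smult[OF z that] by (rule linear_simps(3)[OF g that(1) act[OF that(2)]])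
  qed
  obtain N c where c_all: "finite N" "\<forall>n \<in> N. c n \<in> graded_hom S Sec (shift S n)"
    "\<forall>m \<in> \<Gamma>G. f m = (\<Oplus>\<^bsub>S\<^esub> n\<in>N. c n m)" by (rule D_carrierE[OF f])
  note c = c_all(1) bspec[OF c_all(2)] bspec[OF c_all(3)]
  show ?thesis
  proof (rule D_carrierI[where N = "(\<lambda>n. n + d) ` N" and c = "\<lambda>n m. c (n - d) (Z_action G B z m)"])
    show "(\<lambda>m\<in>\<Gamma>G. f (Z_action G B z m)) \<in> linear_maps S Sec S"
      using lin[OF D_linear[OF f]] \<Gamma>_add \<Gamma>_smult unfolding linear_maps_def
      by (simp add: Sec_simps(1) Pi_iff)
    fix n assume "n \<in> (\<lambda>n. n + d) ` N"
    then have n: "c (n - d) \<in> graded_hom S Sec (shift S (n - d))" using c(2) by auto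
    have "c (n - d) (Z_action G B z m) \<in> hpart S (n + i)" if m: "m \<in> hpart Sec i" for i m
    proof -
      have mG: "m \<in> \<Gamma>G" using m by (simp add: Sec_simps(4))
      have "Z_action G B z m \<in> hpart Sec (d + i)"
        unfolding Sec_simps(4)
      proof (rule IntI[OF act[OF mG]])
        show "Z_action G B z m \<in> (\<Pi>\<^sub>E x\<in>verts G. hpart (stalk B x) (d + i))"
          unfolding Z_action_def
        proof (rule restrict_PiE_iff[THEN iffD2], rule ballI)
          fix x assume x: "x \<in> verts G"
          have "m x \<in> hpart (stalk B x) i" using m x by (auto simp: Sec_simps(4))
          then show "z x \<odot>\<^bsub>stalk B x\<^esub> m x \<in> hpart (stalk B x) (d + i)"
            by (rule graded_mod.smult_hpart[OF stalk_mod[OF x] d[OF x]])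
        qed
      qed
      then have "c (n - d) (Z_action G B z m) \<in> hpart S (n - d + (d + i))"
        using n unfolding graded_hom_Sec_iff by blast
      then show ?thesis by simp
    qed
    then show "(\<lambda>m. c (n - d) (Z_action G B z m)) \<in> graded_hom S Sec (shift S n)"
      using lin[of "c (n - d)"] n unfolding graded_hom_Sec_iff by blast
  next
    fix m assume m: "m \<in> \<Gamma>G"
    have cm: "c n (Z_action G B z m) \<in> carrier S" if "n \<in> N" for n
      using c(2)[OF that] linear_simps(1) act[OF m] unfolding graded_hom_Sec_iff by blast
    have "(\<Oplus>\<^bsub>S\<^esub> n\<in>(\<lambda>n. n + d) ` N. c (n - d) (Z_action G B z m)) =
        (\<Oplus>\<^bsub>S\<^esub> n\<in>N. c (n + d - d) (Z_action G B z m))"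
      using cm by (intro S.finsum_reindex) (auto simp: inj_on_def)
    then show "(\<lambda>m\<in>\<Gamma>G. f (Z_action G B z m)) m = (\<Oplus>\<^bsub>S\<^esub> n\<in>(\<lambda>n. n + d) ` N. c (n - d) (Z_action G B z m))"
      using c(3)[OF act[OF m]] m by simp
  qed (use c(1) in simp_all)
qed

lemma D_scale:
  assumes s: "s \<in> carrier S" and f: "f \<in> carrier D"
  shows "(\<lambda>m\<in>\<Gamma>G. s \<otimes>\<^bsub>S\<^esub> f m) \<in> carrier D"
  using s
proof (induction s rule: S.S.graded_induct)
  case (add s t)
  have "(\<lambda>m\<in>\<Gamma>G. (s \<oplus>\<^bsub>S\<^esub> t) \<otimes>\<^bsub>S\<^esub> f m) =
      (\<lambda>m\<in>\<Gamma>G. (\<lambda>m\<in>\<Gamma>G. s \<otimes>\<^bsub>S\<^esub> f m) m \<oplus>\<^bsub>S\<^esub> (\<lambda>m\<in>\<Gamma>G. t \<otimes>\<^bsub>S\<^esub> f m) m)"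
    using add(1,2) D_simps(1)[OF f] by (intro restrict_ext) (simp add: S.l_distr)
  then show ?case using D_add[OF add(3,4)] by (simp only:)
next
  case (hom n s)
  have sc: "s \<in> carrier S" by (rule S.S.hpart_carrier[OF hom])
  have "(\<lambda>m\<in>\<Gamma>G. f (Z_action G B (\<lambda>x\<in>verts G. s) m)) \<in> carrier D"
    by (rule D_act[where d = n, OF f const_Z[OF sc]]) (simp add: hom)
  moreover have "(\<lambda>m\<in>\<Gamma>G. f (Z_action G B (\<lambda>x\<in>verts G. s) m)) = (\<lambda>m\<in>\<Gamma>G. s \<otimes>\<^bsub>S\<^esub> f m)"
    unfolding Z_action_const by (rule restrict_ext) (rule D_simps(3)[OF f sc])
  ultimately show ?case by (simp only:)
qed

section \<open>The duality isomorphism\<close>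

lemma F_closed: "f \<in> carrier D \<Longrightarrow> F f \<in> \<Gamma>G"
  using F_hom by (auto simp: graded_hom_def linear_maps_def global_sections_def with_scalars_def \<Gamma>_def)

lemma F_add:
  assumes "f \<in> carrier D" "g \<in> carrier D" "y \<in> verts G"
  shows "F (\<lambda>m\<in>\<Gamma>G. f m \<oplus>\<^bsub>S\<^esub> g m) y = F f y \<oplus>\<^bsub>stalk B y\<^esub> F g y"
proof -
  have "F (f \<oplus>\<^bsub>D\<^esub> g) = F f \<oplus>\<^bsub>shift (global_sections G B) l\<^esub> F g"
    using F_hom assms unfolding graded_hom_def linear_maps_def by blast
  moreover have "f \<oplus>\<^bsub>D\<^esub> g = (\<lambda>m\<in>\<Gamma>G. f m \<oplus>\<^bsub>S\<^esub> g m)"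
    by (simp add: graded_dual_def Sec_simps)
  moreover have "F f \<oplus>\<^bsub>shift (global_sections G B) l\<^esub> F g = F f \<oplus>\<^bsub>Sec\<^esub> F g"
    by (simp add: global_sections_def with_scalars_def)
  ultimately show ?thesis using assms(3) by (simp add: Sec_simps)
qed

lemma F_act:
  assumes "z \<in> carrier Z" "f \<in> carrier D" "y \<in> verts G"
  shows "F (\<lambda>m\<in>\<Gamma>G. f (Z_action G B z m)) y = z y \<odot>\<^bsub>stalk B y\<^esub> F f y"
proof -
  have "F (z \<odot>\<^bsub>D\<^esub> f) = z \<odot>\<^bsub>shift (global_sections G B) l\<^esub> F f"
    using F_hom assms unfolding graded_hom_def linear_maps_def by blast
  moreover have "z \<odot>\<^bsub>D\<^esub> f = (\<lambda>m\<in>\<Gamma>G. f (Z_action G B z m))"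
    by (simp add: graded_dual_def Sec_simps)
  moreover have "z \<odot>\<^bsub>shift (global_sections G B) l\<^esub> F f = Z_action G B z (F f)"
    by (simp add: global_sections_def with_scalars_def)
  ultimately show ?thesis using assms(3) by (simp add: Z_action_def)
qed

lemma F_scale:
  assumes "s \<in> carrier S" "f \<in> carrier D" "y \<in> verts G"
  shows "F (\<lambda>m\<in>\<Gamma>G. s \<otimes>\<^bsub>S\<^esub> f m) y = s \<odot>\<^bsub>stalk B y\<^esub> F f y"
proof -
  have "(\<lambda>m\<in>\<Gamma>G. f (Z_action G B (\<lambda>x\<in>verts G. s) m)) = (\<lambda>m\<in>\<Gamma>G. s \<otimes>\<^bsub>S\<^esub> f m)"
    unfolding Z_action_const by (rule restrict_ext) (rule D_simps(3)[OF assms(2,1)])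
  then show ?thesis using F_act[OF const_Z[OF assms(1)] assms(2,3)] assms(3) by simp
qed

lemma F_hpart:
  assumes "f \<in> hpart D n" "y \<in> verts G"
  shows "F f y \<in> hpart (stalk B y) (l + n)"
proof -
  have "F f \<in> hpart (shift (global_sections G B) l) n"
    using F_hom assms(1) unfolding graded_hom_def by blast
  then have "F f \<in> hpart Sec (l + n)" by (simp add: global_sections_def with_scalars_def)
  then show ?thesis using assms(2) by (auto simp: Sec_simps(4))
qed

lemma F_inj:
  assumes "f \<in> carrier D" "g \<in> carrier D" "\<And>y. y \<in> verts G \<Longrightarrow> F f y = F g y"
  shows "f = g"
proof (rule inj_onD[OF bij_betw_imp_inj_on[OF F_bij] _ assms(1,2)])
  show "F f = F g"
  proof (rule extensionalityI[where A = "verts G"])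
    show "F f \<in> extensional (verts G)" "F g \<in> extensional (verts G)"
      using F_closed[OF assms(1)] F_closed[OF assms(2)] unfolding \<Gamma>_iff by (simp_all add: PiE_def)
  qed (rule assms(3))
qed

lemma F_surj:
  assumes "m \<in> \<Gamma>G"
  obtains f where "f \<in> carrier D" "F f = m"
proof -
  have "m \<in> carrier (shift (global_sections G B) l)"
    using assms by (simp add: global_sections_def with_scalars_def \<Gamma>_def)
  then have "m \<in> F ` carrier D" using bij_betw_imp_surj_on[OF F_bij] by simp
  then show ?thesis using that by blast
qed

definition D0 :: "('x \<Rightarrow> 'm) \<Rightarrow> ('k, 'v) sym" where
  "D0 = (\<lambda>m\<in>\<Gamma>G. \<zero>\<^bsub>S\<^esub>)"

lemma D0_hpart: "D0 \<in> hpart D n"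
  unfolding hpart_D_iff graded_hom_Sec_iff D0_def
proof (intro conjI linearI allI ballI)
  fix i m assume "m \<in> hpart Sec i"
  then show "(\<lambda>m\<in>\<Gamma>G. \<zero>\<^bsub>S\<^esub>) m \<in> hpart S (n + i)" by (simp add: Sec_simps(4))
qed (simp_all add: \<Gamma>_add \<Gamma>_smult)

lemmas D0_carrier = hpart_D_carrier[OF D0_hpart]

lemma F_D0: "y \<in> verts G \<Longrightarrow> F D0 y = \<zero>\<^bsub>stalk B y\<^esub>"
proof -
  assume y: "y \<in> verts G"
  interpret P: graded_mod S "stalk B y" by (rule stalk_mod[OF y])
  have "(\<lambda>m\<in>\<Gamma>G. D0 m \<oplus>\<^bsub>S\<^esub> D0 m) = D0" unfolding D0_def by (rule restrict_ext) simp
  then have "F D0 y = F D0 y \<oplus>\<^bsub>stalk B y\<^esub> F D0 y" using F_add[OF D0_carrier D0_carrier y] by simp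
  moreover have "F D0 y \<in> carrier (stalk B y)" by (rule \<Gamma>_verts_closed[OF F_closed[OF D0_carrier] y])
  ultimately show ?thesis by (simp add: P.M.add.l_cancel_one')
qed

lemma F_zero_imp: "f \<in> carrier D \<Longrightarrow> (\<And>y. y \<in> verts G \<Longrightarrow> F f y = \<zero>\<^bsub>stalk B y\<^esub>) \<Longrightarrow> f = D0"
  using F_inj[OF _ D0_carrier] F_D0 by simp

text \<open>The summand of \<open>f\<close> in degree \<open>i\<close> is sent into degree
  \<open>l + i\<close> of every stalk. As the total has degree \<open>l + n\<close>, the images of
  all other summands vanish, and injectivity of \<open>F\<close> removes the summands
  themselves.\<close>

lemma F_reflects_hpart:
  assumes f: "f \<in> carrier D" and h: "\<And>y. y \<in> verts G \<Longrightarrow> F f y \<in> hpart (stalk B y) (l + n)"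
  shows "f \<in> hpart D n"
proof -
  obtain N c where c_all: "finite N" "\<forall>n \<in> N. c n \<in> graded_hom S Sec (shift S n)"
    "\<forall>m \<in> \<Gamma>G. f m = (\<Oplus>\<^bsub>S\<^esub> n\<in>N. c n m)" by (rule D_carrierE[OF f])
  note c = c_all(1) bspec[OF c_all(2)] bspec[OF c_all(3)]
  \<comment> \<open>Members of \<open>graded_dual\<close> are extensional, which the summands
    \<open>c i\<close> need not be.\<close>
  define b where "b i = (\<lambda>m\<in>\<Gamma>G. c i m)" for i
  have cl: "c i \<in> linear_maps S Sec S" if "i \<in> N" for i
    using c(2)[OF that] by (simp add: graded_hom_Sec_iff)
  have b: "b i \<in> hpart D i" if i: "i \<in> N" for i
    unfolding hpart_D_iff graded_hom_Sec_iff b_def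
  proof (intro conjI linearI allI ballI)
    fix k m assume "m \<in> hpart Sec k"
    moreover from this have "m \<in> \<Gamma>G" by (simp add: Sec_simps(4))
    ultimately show "(\<lambda>m\<in>\<Gamma>G. c i m) m \<in> hpart S (i + k)" using c(2)[OF i] by (simp add: graded_hom_Sec_iff)
  qed (simp_all add: \<Gamma>_add \<Gamma>_smult linear_simps[OF cl[OF i]])
  note bD = hpart_D_carrier[OF b]
  have sum: "(\<lambda>m\<in>\<Gamma>G. \<Oplus>\<^bsub>S\<^esub> i\<in>A. c i m) \<in> carrier D \<and>
      (\<forall>y \<in> verts G. F (\<lambda>m\<in>\<Gamma>G. \<Oplus>\<^bsub>S\<^esub> i\<in>A. c i m) y = (\<Oplus>\<^bsub>stalk B y\<^esub> i\<in>A. F (b i) y))"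
    if "finite A" "A \<subseteq> N" for A
    using that
  proof (induction A rule: finite_induct)
    case empty
    have "(\<lambda>m\<in>\<Gamma>G. \<Oplus>\<^bsub>S\<^esub> i\<in>{}. c i m) = D0" by (simp add: D0_def)
    moreover have "(\<Oplus>\<^bsub>stalk B y\<^esub> i\<in>{}. F (b i) y) = \<zero>\<^bsub>stalk B y\<^esub>" if "y \<in> verts G" for y
    proof -
      interpret P: graded_mod S "stalk B y" by (rule stalk_mod[OF that])
      show ?thesis by simp
    qed
    ultimately show ?case using D0_carrier F_D0 by simp
  next
    case (insert i A)
    let ?g = "\<lambda>m\<in>\<Gamma>G. \<Oplus>\<^bsub>S\<^esub> i\<in>A. c i m"
    have i: "i \<in> N" using insert.prems by simp
    have "A \<subseteq> N" using insert.prems by simp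
    note IH = conjunct1[OF insert.IH[OF this]] bspec[OF conjunct2[OF insert.IH[OF this]]]
    have eq: "(\<lambda>m\<in>\<Gamma>G. \<Oplus>\<^bsub>S\<^esub> i\<in>insert i A. c i m) = (\<lambda>m\<in>\<Gamma>G. b i m \<oplus>\<^bsub>S\<^esub> ?g m)"
    proof (rule restrict_ext)
      fix m assume m: "m \<in> \<Gamma>G"
      have "(\<lambda>i. c i m) \<in> A \<rightarrow> carrier S" "c i m \<in> carrier S"
        using linear_simps(1)[OF cl m] insert.prems by auto
      then show "(\<Oplus>\<^bsub>S\<^esub> i\<in>insert i A. c i m) = b i m \<oplus>\<^bsub>S\<^esub> ?g m"
        using insert.hyps m by (simp add: b_def)
    qed
    have "F (\<lambda>m\<in>\<Gamma>G. b i m \<oplus>\<^bsub>S\<^esub> ?g m) y = (\<Oplus>\<^bsub>stalk B y\<^esub> i\<in>insert i A. F (b i) y)" if y: "y \<in> verts G" for y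
    proof -
      interpret P: graded_mod S "stalk B y" by (rule stalk_mod[OF y])
      have Fb: "F (b j) y \<in> carrier (stalk B y)" if "j \<in> N" for j
        by (rule \<Gamma>_verts_closed[OF F_closed[OF bD[OF that]] y])
      have "(\<lambda>i. F (b i) y) \<in> A \<rightarrow> carrier (stalk B y)" using Fb insert.prems by auto
      then show ?thesis
        unfolding F_add[OF bD[OF i] IH(1) y] IH(2)[OF y] using insert.hyps Fb[OF i] by simp
    qed
    then show ?case unfolding eq by (intro conjI ballI D_add[OF bD[OF i] IH(1)])
  qed
  have f_eq: "f = (\<lambda>m\<in>\<Gamma>G. \<Oplus>\<^bsub>S\<^esub> i\<in>N. c i m)"
    using D_ext[OF f] c(3) by (intro extensionalityI[of _ \<Gamma>G]) simp_all
  have b0: "b i = D0" if i: "i \<in> N" "i \<noteq> n" for i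
  proof (rule F_zero_imp[OF bD[OF i(1)]])
    fix y assume y: "y \<in> verts G"
    interpret P: graded_mod S "stalk B y" by (rule stalk_mod[OF y])
    have "(\<Oplus>\<^bsub>stalk B y\<^esub> i\<in>N. F (b i) y) = F f y" using sum[OF c(1)] y f_eq by simp
    then have "(\<Oplus>\<^bsub>stalk B y\<^esub> i\<in>N. F (b i) y) \<in> hpart (stalk B y) (n + l)"
      using h[OF y] by (simp add: add.commute)
    moreover have "F (b j) y \<in> hpart (stalk B y) (j + l)" if "j \<in> N" for j
      using F_hpart[OF b[OF that] y] by (simp add: add.commute)
    ultimately show "F (b i) y = \<zero>\<^bsub>stalk B y\<^esub>"
      using P.M.finsum_hpart_imp_zero[OF c(1), of "\<lambda>i. F (b i) y" l n i] i by simp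
  qed
  have c0: "c i m = \<zero>\<^bsub>S\<^esub>" if "i \<in> N" "i \<noteq> n" "m \<in> \<Gamma>G" for i m
    using fun_cong[OF b0[OF that(1,2)], of m] that(3) by (simp add: b_def D0_def)
  have "f = (if n \<in> N then b n else D0)"
  proof (rule extensionalityI[where A = \<Gamma>G])
    fix m assume m: "m \<in> \<Gamma>G"
    have cm: "c i m \<in> carrier S" if "i \<in> N" for i by (rule linear_simps(1)[OF cl[OF that] m])
    have "f m = (\<Oplus>\<^bsub>S\<^esub> i\<in>N. if n = i then c i m else \<zero>\<^bsub>S\<^esub>)"
      unfolding c(3)[OF m] using cm c0[OF _ _ m] by (intro S.finsum_cong') auto
    also have "\<dots> = (if n \<in> N then c n m else \<zero>\<^bsub>S\<^esub>)"
    proof (cases "n \<in> N")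
      case True
      have "(\<Oplus>\<^bsub>S\<^esub> i\<in>N. if n = i then c i m else \<zero>\<^bsub>S\<^esub>) = c n m"
        using S.add.finprod_singleton[OF True c(1), of "\<lambda>i. c i m"] cm by auto
      then show ?thesis using True by simp
    next
      case False
      then have "(\<Oplus>\<^bsub>S\<^esub> i\<in>N. if n = i then c i m else \<zero>\<^bsub>S\<^esub>) = (\<Oplus>\<^bsub>S\<^esub> i\<in>N. \<zero>\<^bsub>S\<^esub>)"
        by (intro S.finsum_cong') auto
      then show ?thesis using False by simp
    qed
    finally show "f m = (if n \<in> N then b n else D0) m" using m by (simp add: b_def D0_def)
  qed (use D_ext[OF f] in \<open>simp_all add: b_def D0_def\<close>)
  then show ?thesis using b D0_hpart by simp
qed

section \<open>Sections and forms supported at a vertex\<close>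

definition star :: "'x \<Rightarrow> 'x set set" where
  "star x = {E \<in> edges G. x \<in> E}"

definition delta :: "'x \<Rightarrow> 'm \<Rightarrow> 'x \<Rightarrow> 'm" where
  "delta x p = (\<lambda>y\<in>verts G. if y = x then p else \<zero>\<^bsub>stalk B y\<^esub>)"

text \<open>These are exactly the values at \<open>x\<close> of the global sections that vanish at
  all other vertices, by \<open>delta_\<Gamma>\<close> and \<open>supported_at\<close>.\<close>

definition K :: "'x \<Rightarrow> 'm set" where
  "K x = {p \<in> carrier (stalk B x). \<forall>E \<in> star x. rho B x E p = \<zero>\<^bsub>edge_stalk B E\<^esub>}"

text \<open>The element of \<open>Z\<close> that detects support at \<open>x\<close>: it kills
  whatever lives at \<open>x\<close> alone, and by torsion-freeness nothing nonzero at another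
  vertex. It belongs to \<open>Z\<close> because its nonzero value is divisible by the label of
  every edge at \<open>x\<close> and is constant along all other edges.\<close>

definition off :: "'x \<Rightarrow> 'x \<Rightarrow> ('k, 'v) sym" where
  "off x = (\<lambda>y\<in>verts G. if y = x then \<zero>\<^bsub>S\<^esub> else lprod (star x))"

lemma star_edges: "star x \<subseteq> edges G" and finite_star: "finite (star x)"
  using finite_edges by (auto simp: star_def)

lemma lprod_PIdl:
  assumes "finite A" "E \<in> A"
  shows "lprod A \<in> PIdl\<^bsub>S\<^esub> (lab E)"
  unfolding S.PIdl_iff lprod_remove[OF assms]
  by (intro bexI[of _ "lprod (A - {E})"]) (simp_all add: S.m_comm)

lemma PIdl_mult: "s \<in> carrier S \<Longrightarrow> t \<in> PIdl\<^bsub>S\<^esub> (lab E) \<Longrightarrow> s \<otimes>\<^bsub>S\<^esub> t \<in> PIdl\<^bsub>S\<^esub> (lab E)"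
  unfolding S.PIdl_iff
proof (elim bexE)
  fix r assume "s \<in> carrier S" "r \<in> carrier S" "t = r \<otimes>\<^bsub>S\<^esub> lab E"
  then show "\<exists>r\<in>carrier S. s \<otimes>\<^bsub>S\<^esub> t = r \<otimes>\<^bsub>S\<^esub> lab E"
    by (intro bexI[of _ "s \<otimes>\<^bsub>S\<^esub> r"]) (simp_all add: S.m_assoc)
qed

lemma PIdl_uminus: "t \<in> PIdl\<^bsub>S\<^esub> (lab E) \<Longrightarrow> \<ominus>\<^bsub>S\<^esub> t \<in> PIdl\<^bsub>S\<^esub> (lab E)"
proof -
  assume t: "t \<in> PIdl\<^bsub>S\<^esub> (lab E)"
  then have "t \<in> carrier S" by (auto simp: S.PIdl_iff)
  then have "\<ominus>\<^bsub>S\<^esub> t = (\<ominus>\<^bsub>S\<^esub> \<one>\<^bsub>S\<^esub>) \<otimes>\<^bsub>S\<^esub> t" by (simp add: S.l_minus)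
  then show ?thesis using PIdl_mult[OF _ t, of "\<ominus>\<^bsub>S\<^esub> \<one>\<^bsub>S\<^esub>"] by simp
qed

lemma off_Z: "off x \<in> carrier Z"
  unfolding Z_iff
proof (intro conjI allI impI)
  show "off x \<in> (\<Pi>\<^sub>E x\<in>verts G. carrier S)" by (simp add: off_def)
  fix u v assume uv: "{u, v} \<in> edges G"
  have verts: "u \<in> verts G" "v \<in> verts G" using edge_vert[OF uv] by simp_all
  consider "u = x" "v = x" | "u = x" "v \<noteq> x" | "u \<noteq> x" "v = x" | "u \<noteq> x" "v \<noteq> x" by blast
  then show "off x u \<ominus>\<^bsub>S\<^esub> off x v \<in> PIdl\<^bsub>S\<^esub> (lab {u, v})"
  proof cases
    case 1
    then show ?thesis using verts zero_PIdl by (simp add: off_def S.minus_eq)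
  next
    case 2
    then have "{u, v} \<in> star x" using uv by (simp add: star_def)
    from PIdl_uminus[OF lprod_PIdl[OF finite_star this]] show ?thesis
      using 2 verts by (simp add: off_def S.minus_eq)
  next
    case 3
    then have "{u, v} \<in> star x" using uv by (simp add: star_def)
    from lprod_PIdl[OF finite_star this] show ?thesis
      using 3 verts by (simp add: off_def S.minus_eq)
  next
    case 4
    then show ?thesis using verts zero_PIdl by (simp add: off_def S.minus_eq S.r_neg)
  qed
qed

lemma off_hpart: "y \<in> verts G \<Longrightarrow> off x y \<in> hpart S (int (card (star x)))"
  using lprod_hpart[OF finite_star] by (simp add: off_def)

lemma K_closed: "p \<in> K x \<Longrightarrow> p \<in> carrier (stalk B x)"
  by (simp add: K_def)

lemma K_rho: "p \<in> K x \<Longrightarrow> E \<in> edges G \<Longrightarrow> x \<in> E \<Longrightarrow> rho B x E p = \<zero>\<^bsub>edge_stalk B E\<^esub>"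
  by (simp add: K_def star_def)

lemma K_add:
  assumes x: "x \<in> verts G" and p: "p \<in> K x" "q \<in> K x"
  shows "p \<oplus>\<^bsub>stalk B x\<^esub> q \<in> K x"
proof -
  interpret P: graded_mod S "stalk B x" by (rule stalk_mod[OF x])
  note c = K_closed[OF p(1)] K_closed[OF p(2)]
  have "rho B x E (p \<oplus>\<^bsub>stalk B x\<^esub> q) = \<zero>\<^bsub>edge_stalk B E\<^esub>" if "E \<in> star x" for E
  proof -
    have E: "E \<in> edges G" "x \<in> E" using that by (simp_all add: star_def)
    interpret Q: graded_mod S "edge_stalk B E" by (rule edge_mod[OF E(1)])
    show ?thesis unfolding rho_add[OF E c] K_rho[OF p(1) E] K_rho[OF p(2) E] by simp
  qed
  then show ?thesis using c by (simp add: K_def)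
qed

lemma K_smult:
  assumes x: "x \<in> verts G" and p: "p \<in> K x" and s: "s \<in> carrier S"
  shows "s \<odot>\<^bsub>stalk B x\<^esub> p \<in> K x"
proof -
  interpret P: graded_mod S "stalk B x" by (rule stalk_mod[OF x])
  note c = K_closed[OF p]
  have "rho B x E (s \<odot>\<^bsub>stalk B x\<^esub> p) = \<zero>\<^bsub>edge_stalk B E\<^esub>" if "E \<in> star x" for E
  proof -
    have E: "E \<in> edges G" "x \<in> E" using that by (simp_all add: star_def)
    interpret Q: graded_mod S "edge_stalk B E" by (rule edge_mod[OF E(1)])
    show ?thesis unfolding rho_smult[OF E s c] K_rho[OF p E] using s by simp
  qed
  then show ?thesis using c s by (simp add: K_def)
qed

lemma lprod_K:
  assumes x: "x \<in> verts G" and p: "p \<in> carrier (stalk B x)"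
  shows "lprod (star x) \<odot>\<^bsub>stalk B x\<^esub> p \<in> K x"
proof -
  interpret P: graded_mod S "stalk B x" by (rule stalk_mod[OF x])
  have "rho B x E (lprod (star x) \<odot>\<^bsub>stalk B x\<^esub> p) = \<zero>\<^bsub>edge_stalk B E\<^esub>" if "E \<in> star x" for E
  proof -
    have E: "E \<in> edges G" "x \<in> E" using that by (simp_all add: star_def)
    show ?thesis unfolding rho_smult[OF E lprod_closed p]
      by (rule PIdl_lab_kills[OF E(1) rho_closed[OF E p] lprod_PIdl[OF finite_star that]])
  qed
  then show ?thesis using p by (simp add: K_def)
qed

lemma delta_\<Gamma>:
  assumes x: "x \<in> verts G" and p: "p \<in> K x"
  shows "delta x p \<in> \<Gamma>G"
  unfolding \<Gamma>_iff
proof (intro conjI ballI impI)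
  show "delta x p \<in> (\<Pi>\<^sub>E y\<in>verts G. carrier (stalk B y))"
    unfolding delta_def
  proof (rule restrict_PiE_iff[THEN iffD2], rule ballI)
    fix y assume y: "y \<in> verts G"
    interpret P: graded_mod S "stalk B y" by (rule stalk_mod[OF y])
    show "(if y = x then p else \<zero>\<^bsub>stalk B y\<^esub>) \<in> carrier (stalk B y)" using K_closed[OF p] by simp
  qed
  have 0: "rho B y E (delta x p y) = \<zero>\<^bsub>edge_stalk B E\<^esub>" if "E \<in> edges G" "y \<in> E" "y \<in> verts G" for y E
  proof (cases "y = x")
    case True
    then show ?thesis using K_rho[OF p that(1)] that by (simp add: delta_def)
  next
    case False
    then show ?thesis using rho_zero[OF that(1,2)] that(3) by (simp add: delta_def)
  qed
  fix u v assume uv: "u \<in> verts G" "v \<in> verts G" "arrow u v"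
  have E: "{u, v} \<in> edges G" by (rule arrow_edge[OF uv(3)])
  show "rho B u {u, v} (delta x p u) = rho B v {u, v} (delta x p v)"
    using 0[OF E _ uv(1)] 0[OF E _ uv(2)] by simp
qed

lemma supported_at:
  assumes x: "x \<in> verts G" and m: "m \<in> \<Gamma>G" and 0: "\<And>y. y \<in> verts G \<Longrightarrow> y \<noteq> x \<Longrightarrow> m y = \<zero>\<^bsub>stalk B y\<^esub>"
  shows "m x \<in> K x" and "m = delta x (m x)"
proof -
  have "rho B x E (m x) = \<zero>\<^bsub>edge_stalk B E\<^esub>" if "E \<in> star x" for E
  proof -
    have E: "E \<in> edges G" "x \<in> E" using that by (simp_all add: star_def)
    from edge_cases[OF E] show ?thesis
    proof (elim disjE exE conjE)
      fix y assume y: "E = {x, y}" "arrow x y"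
      then have "y \<noteq> x" "y \<in> verts G" using arrow_verts[OF y(2)] by (auto simp: arrow_def below_def)
      then show ?thesis using \<Gamma>_verts_arrow[OF m y(2)] 0[of y] rho_zero[OF E(1), of y] y(1) by simp
    next
      fix y assume y: "E = {y, x}" "arrow y x"
      then have "y \<noteq> x" "y \<in> verts G" using arrow_verts[OF y(2)] by (auto simp: arrow_def below_def)
      then show ?thesis using \<Gamma>_verts_arrow[OF m y(2)] 0[of y] rho_zero[OF E(1), of y] y(1) by simp
    qed
  qed
  then show "m x \<in> K x" using \<Gamma>_verts_closed[OF m x] by (simp add: K_def)
  show "m = delta x (m x)"
  proof (rule extensionalityI[where A = "verts G"])
    show "m \<in> extensional (verts G)" using m unfolding \<Gamma>_iff by (simp add: PiE_def)
    show "delta x (m x) \<in> extensional (verts G)" by (simp add: delta_def)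
    show "m y = delta x (m x) y" if "y \<in> verts G" for y using that 0 by (simp add: delta_def)
  qed
qed

text \<open>The product of \<open>off x\<close> with any section vanishes at \<open>x\<close>, so
  \<open>off x\<close> annihilates \<open>f\<close>, and by \<open>Z\<close>-linearity it
  annihilates \<open>F f\<close>. Away from \<open>x\<close> it acts on the torsion-free stalks as a
  nonzero scalar.\<close>

lemma F_supported:
  assumes x: "x \<in> verts G" and f: "f \<in> carrier D"
    and van: "\<And>m. m \<in> \<Gamma>G \<Longrightarrow> m x = \<zero>\<^bsub>stalk B x\<^esub> \<Longrightarrow> f m = \<zero>\<^bsub>S\<^esub>"
  shows "F f x \<in> K x" and "F f = delta x (F f x)"
proof -
  have eq: "(\<lambda>m\<in>\<Gamma>G. f (Z_action G B (off x) m)) = D0"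
    unfolding D0_def
  proof (rule restrict_ext)
    fix m assume m: "m \<in> \<Gamma>G"
    interpret P: graded_mod S "stalk B x" by (rule stalk_mod[OF x])
    have "Z_action G B (off x) m x = \<zero>\<^bsub>stalk B x\<^esub>"
      using x \<Gamma>_verts_closed[OF m x] by (simp add: Z_action_def off_def)
    then show "f (Z_action G B (off x) m) = \<zero>\<^bsub>S\<^esub>" by (rule van[OF \<Gamma>_act[OF off_Z m]])
  qed
  have 0: "F f y = \<zero>\<^bsub>stalk B y\<^esub>" if y: "y \<in> verts G" "y \<noteq> x" for y
  proof -
    have "off x y \<odot>\<^bsub>stalk B y\<^esub> F f y = \<zero>\<^bsub>stalk B y\<^esub>"
      using F_act[OF off_Z f y(1), of x] F_D0[OF y(1)] unfolding eq by simp
    then have "lprod (star x) \<odot>\<^bsub>stalk B y\<^esub> F f y = \<zero>\<^bsub>stalk B y\<^esub>" using y by (simp add: off_def)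
    moreover have "F f y \<in> carrier (stalk B y)" by (rule \<Gamma>_verts_closed[OF F_closed[OF f] y(1)])
    moreover have "lprod (star x) \<noteq> \<zero>\<^bsub>S\<^esub>" by (rule lprod_nonzero[OF finite_star star_edges])
    ultimately show ?thesis using stalk_tf[OF y(1)] lprod_closed unfolding torsion_free_def by blast
  qed
  show "F f x \<in> K x" "F f = delta x (F f x)" using supported_at[OF x F_closed[OF f]] 0 by blast+
qed

text \<open>Here \<open>off x\<close> annihilates \<open>F f\<close>, hence \<open>f\<close> by
  injectivity. On a section that is zero at \<open>x\<close> it acts as the product of the labels at
  \<open>x\<close>, and this nonzero scalar can be cancelled from the value of
  \<open>f\<close>.\<close>

lemma F_supported_vanishes:
  assumes x: "x \<in> verts G" and f: "f \<in> carrier D" "F f = delta x p" and p: "p \<in> K x"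
    and m: "m \<in> \<Gamma>G" "m x = \<zero>\<^bsub>stalk B x\<^esub>"
  shows "f m = \<zero>\<^bsub>S\<^esub>"
proof -
  let ?g = "\<lambda>m\<in>\<Gamma>G. f (Z_action G B (off x) m)"
  have "?g = D0"
  proof (rule F_zero_imp[OF D_act[OF f(1) off_Z off_hpart]])
    fix y assume y: "y \<in> verts G"
    interpret P: graded_mod S "stalk B y" by (rule stalk_mod[OF y])
    interpret X: graded_mod S "stalk B x" by (rule stalk_mod[OF x])
    show "F ?g y = \<zero>\<^bsub>stalk B y\<^esub>"
      unfolding F_act[OF off_Z f(1) y] f(2) using y K_closed[OF p]
      by (cases "y = x") (auto simp: delta_def off_def)
  qed
  from fun_cong[OF this, of m] have 0: "f (Z_action G B (off x) m) = \<zero>\<^bsub>S\<^esub>"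
    using m(1) by (simp add: D0_def)
  have "Z_action G B (off x) m = lprod (star x) \<odot>\<^bsub>Sec\<^esub> m"
    unfolding Z_action_def Sec_simps
  proof (rule restrict_ext)
    fix y assume y: "y \<in> verts G"
    interpret P: graded_mod S "stalk B y" by (rule stalk_mod[OF y])
    interpret X: graded_mod S "stalk B x" by (rule stalk_mod[OF x])
    show "off x y \<odot>\<^bsub>stalk B y\<^esub> m y = lprod (star x) \<odot>\<^bsub>stalk B y\<^esub> m y"
      using y m(2) by (cases "y = x") (auto simp: off_def)
  qed
  then have "lprod (star x) \<otimes>\<^bsub>S\<^esub> f m = \<zero>\<^bsub>S\<^esub>" using 0 D_simps(3)[OF f(1) lprod_closed m(1)] by simp
  then show ?thesis
    using S.integral[OF _ lprod_closed D_simps(1)[OF f(1) m(1)]] lprod_nonzero[OF finite_star star_edges] by blast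
qed

definition ev :: "'x \<Rightarrow> ('m \<Rightarrow> ('k, 'v) sym) \<Rightarrow> ('x \<Rightarrow> 'm) \<Rightarrow> ('k, 'v) sym" where
  "ev x g = (\<lambda>m\<in>\<Gamma>G. g (m x))"

lemma ev_hpart:
  assumes x: "x \<in> verts G" and g: "g \<in> graded_hom S (stalk B x) (shift S n)"
  shows "ev x g \<in> hpart D n"
  unfolding hpart_D_iff graded_hom_Sec_iff ev_def
proof (intro conjI linearI allI ballI)
  have gl: "\<And>p. p \<in> carrier (stalk B x) \<Longrightarrow> g p \<in> carrier S"
    "\<And>p q. p \<in> carrier (stalk B x) \<Longrightarrow> q \<in> carrier (stalk B x) \<Longrightarrow> g (p \<oplus>\<^bsub>stalk B x\<^esub> q) = g p \<oplus>\<^bsub>S\<^esub> g q"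
    "\<And>s p. s \<in> carrier S \<Longrightarrow> p \<in> carrier (stalk B x) \<Longrightarrow> g (s \<odot>\<^bsub>stalk B x\<^esub> p) = s \<otimes>\<^bsub>S\<^esub> g p"
    using g by (auto simp: graded_hom_def linear_maps_def S.smult_S)
  note c = \<Gamma>_verts_closed[OF _ x]
  show "(\<lambda>m\<in>\<Gamma>G. g (m x)) m \<in> carrier S" if "m \<in> \<Gamma>G" for m using gl(1)[OF c[OF that]] that by simp
  show "(\<lambda>m\<in>\<Gamma>G. g (m x)) (m \<oplus>\<^bsub>Sec\<^esub> m') = (\<lambda>m\<in>\<Gamma>G. g (m x)) m \<oplus>\<^bsub>S\<^esub> (\<lambda>m\<in>\<Gamma>G. g (m x)) m'"
    if "m \<in> \<Gamma>G" "m' \<in> \<Gamma>G" for m m'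
    using gl(2)[OF c[OF that(1)] c[OF that(2)]] that \<Gamma>_add[OF that] x by (simp add: Sec_simps(2))
  show "(\<lambda>m\<in>\<Gamma>G. g (m x)) (s \<odot>\<^bsub>Sec\<^esub> m) = s \<otimes>\<^bsub>S\<^esub> (\<lambda>m\<in>\<Gamma>G. g (m x)) m"
    if "s \<in> carrier S" "m \<in> \<Gamma>G" for s m
    using gl(3)[OF that(1) c[OF that(2)]] that \<Gamma>_smult[OF that] x by (simp add: Sec_simps(3))
  show "(\<lambda>m\<in>\<Gamma>G. g (m x)) m \<in> hpart S (n + i)" if m: "m \<in> hpart Sec i" for i m
  proof -
    have mG: "m \<in> \<Gamma>G" and "m x \<in> hpart (stalk B x) i" using m x by (auto simp: Sec_simps(4))
    then have "g (m x) \<in> hpart S (n + i)" using g by (auto simp: graded_hom_def)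
    then show ?thesis using mG by simp
  qed
qed simp

text \<open>The pullback of \<open>g\<close> along evaluation at \<open>x\<close> vanishes on
  sections that are zero at \<open>x\<close>, so its image under the duality is supported at
  \<open>x\<close>.\<close>

lemma ev_F:
  assumes x: "x \<in> verts G" and g: "g \<in> graded_hom S (stalk B x) (shift S n)"
  shows "F (ev x g) x \<in> K x" "F (ev x g) x \<in> hpart (stalk B x) (l + n)"
    "F (ev x g) = delta x (F (ev x g) x)"
proof -
  interpret P: graded_mod S "stalk B x" by (rule stalk_mod[OF x])
  have e: "ev x g \<in> carrier D" by (rule hpart_D_carrier[OF ev_hpart[OF x g]])
  have ga: "additive_on (stalk B x) S g"
    using graded_hom_additive[OF g] by (simp add: additive_on_def)
  have g0: "g \<zero>\<^bsub>stalk B x\<^esub> = \<zero>\<^bsub>S\<^esub>"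
    by (rule additive_on_zero[OF ga P.M.abelian_group_axioms S.abelian_group_axioms])
  have van: "ev x g m = \<zero>\<^bsub>S\<^esub>" if "m \<in> \<Gamma>G" "m x = \<zero>\<^bsub>stalk B x\<^esub>" for m
    using that g0 by (simp add: ev_def)
  show "F (ev x g) x \<in> K x" by (rule F_supported(1)[OF x e van])
  show "F (ev x g) = delta x (F (ev x g) x)" by (rule F_supported(2)[OF x e van])
  show "F (ev x g) x \<in> hpart (stalk B x) (l + n)" by (rule F_hpart[OF ev_hpart[OF x g] x])
qed

text \<open>The form that the duality attaches to the section with value \<open>p\<close> at
  \<open>x\<close> and zero elsewhere. It is meaningful for \<open>p\<close> in \<open>K x\<close>,
  and then depends only on the value at \<open>x\<close> of its argument.\<close>

definition co :: "'x \<Rightarrow> 'm \<Rightarrow> ('x \<Rightarrow> 'm) \<Rightarrow> ('k, 'v) sym" where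
  "co x p = inv_into (carrier D) F (delta x p)"

context
  fixes x assumes x: "x \<in> verts G"
begin

lemma co_D: "p \<in> K x \<Longrightarrow> co x p \<in> carrier D" and F_co: "p \<in> K x \<Longrightarrow> F (co x p) = delta x p"
proof -
  assume p: "p \<in> K x"
  obtain f where "f \<in> carrier D" "F f = delta x p" by (rule F_surj[OF delta_\<Gamma>[OF x p]])
  then have "delta x p \<in> F ` carrier D" by (metis imageI)
  then show "co x p \<in> carrier D" "F (co x p) = delta x p"
    unfolding co_def by (rule inv_into_into, rule f_inv_into_f)
qed

lemma co_unique: "f \<in> carrier D \<Longrightarrow> p \<in> K x \<Longrightarrow> (\<And>y. y \<in> verts G \<Longrightarrow> F f y = delta x p y) \<Longrightarrow> co x p = f"
  by (rule F_inj[OF co_D]) (simp_all add: F_co)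

lemma co_hpart:
  assumes p: "p \<in> K x" "p \<in> hpart (stalk B x) d"
  shows "co x p \<in> hpart D (d - l)"
proof (rule F_reflects_hpart[OF co_D[OF p(1)]])
  fix y assume y: "y \<in> verts G"
  interpret P: graded_mod S "stalk B y" by (rule stalk_mod[OF y])
  show "F (co x p) y \<in> hpart (stalk B y) (l + (d - l))"
    unfolding F_co[OF p(1)] using y p(2) by (simp add: delta_def)
qed

text \<open>The section m - s m' vanishes at \<open>x\<close>, and a form dual to a section
  supported at \<open>x\<close> is zero on such sections. The scalar \<open>s\<close> comes out
  although it relates the two sections at \<open>x\<close> only.\<close>

lemma co_val:
  assumes p: "p \<in> K x" and m: "m \<in> \<Gamma>G" "m' \<in> \<Gamma>G" and s: "s \<in> carrier S" "m x = s \<odot>\<^bsub>stalk B x\<^esub> m' x"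
  shows "co x p m = s \<otimes>\<^bsub>S\<^esub> co x p m'"
proof -
  interpret P: graded_mod S "stalk B x" by (rule stalk_mod[OF x])
  note f = co_D[OF p]
  have ns: "\<ominus>\<^bsub>S\<^esub> s \<in> carrier S" using s(1) by simp
  let ?m = "m \<oplus>\<^bsub>Sec\<^esub> ((\<ominus>\<^bsub>S\<^esub> s) \<odot>\<^bsub>Sec\<^esub> m')"
  have "?m x = \<zero>\<^bsub>stalk B x\<^esub>"
    using x s \<Gamma>_verts_closed[OF m(2) x] by (simp add: Sec_simps(2,3) P.M.smult_l_minus P.M.r_neg)
  then have "co x p ?m = \<zero>\<^bsub>S\<^esub>"
    by (rule F_supported_vanishes[OF x f F_co[OF p] p \<Gamma>_add[OF m(1) \<Gamma>_smult[OF ns m(2)]]])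
  then have "co x p m \<oplus>\<^bsub>S\<^esub> \<ominus>\<^bsub>S\<^esub> (s \<otimes>\<^bsub>S\<^esub> co x p m') = \<zero>\<^bsub>S\<^esub>"
    unfolding D_simps(2)[OF f m(1) \<Gamma>_smult[OF ns m(2)]] D_simps(3)[OF f ns m(2)]
    using s(1) D_simps(1)[OF f m(2)] by (simp add: S.l_minus)
  then show ?thesis
    using S.minus_equality[of "co x p m" "\<ominus>\<^bsub>S\<^esub> (s \<otimes>\<^bsub>S\<^esub> co x p m')"] s(1) D_simps(1)[OF f m(1)] D_simps(1)[OF f m(2)]
    by simp
qed

lemma co_add:
  assumes p: "p \<in> K x" "q \<in> K x" and m: "m \<in> \<Gamma>G"
  shows "co x (p \<oplus>\<^bsub>stalk B x\<^esub> q) m = co x p m \<oplus>\<^bsub>S\<^esub> co x q m"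
proof -
  have "co x (p \<oplus>\<^bsub>stalk B x\<^esub> q) = (\<lambda>m\<in>\<Gamma>G. co x p m \<oplus>\<^bsub>S\<^esub> co x q m)"
  proof (rule co_unique[OF D_add[OF co_D[OF p(1)] co_D[OF p(2)]] K_add[OF x p]])
    fix y assume y: "y \<in> verts G"
    interpret P: graded_mod S "stalk B y" by (rule stalk_mod[OF y])
    show "F (\<lambda>m\<in>\<Gamma>G. co x p m \<oplus>\<^bsub>S\<^esub> co x q m) y = delta x (p \<oplus>\<^bsub>stalk B x\<^esub> q) y"
      unfolding F_add[OF co_D[OF p(1)] co_D[OF p(2)] y] F_co[OF p(1)] F_co[OF p(2)]
      using y by (simp add: delta_def)
  qed
  then show ?thesis using m by simp
qed

lemma co_smult:
  assumes p: "p \<in> K x" and s: "s \<in> carrier S" and m: "m \<in> \<Gamma>G"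
  shows "co x (s \<odot>\<^bsub>stalk B x\<^esub> p) m = s \<otimes>\<^bsub>S\<^esub> co x p m"
proof -
  have "co x (s \<odot>\<^bsub>stalk B x\<^esub> p) = (\<lambda>m\<in>\<Gamma>G. s \<otimes>\<^bsub>S\<^esub> co x p m)"
  proof (rule co_unique[OF D_scale[OF s co_D[OF p]] K_smult[OF x p s]])
    fix y assume y: "y \<in> verts G"
    interpret P: graded_mod S "stalk B y" by (rule stalk_mod[OF y])
    show "F (\<lambda>m\<in>\<Gamma>G. s \<otimes>\<^bsub>S\<^esub> co x p m) y = delta x (s \<odot>\<^bsub>stalk B x\<^esub> p) y"
      unfolding F_scale[OF s co_D[OF p] y] F_co[OF p] using y s by (simp add: delta_def)
  qed
  then show ?thesis using m by simp
qed

lemma \<beta>_Sec: "\<beta> \<in> hpart Sec 0"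
  unfolding Sec_simps(4) using \<beta>_section \<beta>_hpart by (auto simp: \<Gamma>_iff PiE_iff)

subsection \<open>Smooth vertices have valency \<open>l\<close>\<close>

text \<open>On every edge at \<open>x\<close> the annihilator of \<beta> consists of multiples of
  the label. For upper edges this uses smoothness of the other end, inherited from \<open>x\<close>;
  for lower edges \<open>x\<close> itself is the upper end. Coprimality then combines the
  labels.\<close>

lemma smooth_K:
  assumes sm: "smooth x" and s: "s \<in> carrier S" "s \<odot>\<^bsub>stalk B x\<^esub> \<beta> x \<in> K x"
  shows "\<exists>r \<in> carrier S. s = r \<otimes>\<^bsub>S\<^esub> lprod (star x)"
proof (rule lprod_divides[OF finite_star star_edges, where v = x])
  fix E assume "E \<in> star x"
  then have E: "E \<in> edges G" "x \<in> E" by (simp_all add: star_def)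
  have 0: "s \<odot>\<^bsub>edge_stalk B E\<^esub> rho B x E (\<beta> x) = \<zero>\<^bsub>edge_stalk B E\<^esub>"
    using K_rho[OF s(2) E] rho_smult[OF E s(1) \<beta>_closed[OF x]] by simp
  from edge_cases[OF E] show "s \<in> PIdl\<^bsub>S\<^esub> (lab E)"
  proof (elim disjE exE conjE)
    fix y assume y: "E = {x, y}" "arrow x y"
    show ?thesis using \<beta>_annihilator[OF y(2) smooth_arrow[OF y(2) sm] _ s(1), of x] 0 y(1) by simp
  next
    fix y assume y: "E = {y, x}" "arrow y x"
    show ?thesis using \<beta>_annihilator[OF y(2) sm _ s(1), of x] 0 y(1) by simp
  qed
qed (use s(1) in \<open>simp_all add: star_def\<close>)

text \<open>Each inequality comes from a nonzero element of \<open>S\<close>, whose degree cannot be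
  negative. The coordinate form with value 1 at \<beta>_x is dual to a multiple of \<beta>_x by a
  scalar of degree \<open>l\<close>, which the product of the labels divides; the quotient has
  degree \<open>l\<close> minus the valency. Conversely the product times \<beta>_x has a dual form
  whose value at \<beta> has degree the valency minus \<open>l\<close>; by smoothness a form
  supported at \<open>x\<close> that vanishes at \<beta> is zero.\<close>

lemma smooth_card:
  assumes sm: "smooth x"
  shows "int (card (star x)) = l"
proof (rule antisym)
  interpret P: graded_mod S "stalk B x" by (rule stalk_mod[OF x])
  let ?A = "lprod (star x)" and ?N = "int (card (star x))"
  have A0: "?A \<noteq> \<zero>\<^bsub>S\<^esub>" by (rule lprod_nonzero[OF finite_star star_edges])
  have Ah: "?A \<in> hpart S ?N" by (rule lprod_hpart[OF finite_star])
  obtain f where f: "f \<in> graded_hom S (stalk B x) S" "f (\<beta> x) = \<one>\<^bsub>S\<^esub>"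
    by (rule smooth_coordinate[OF x sm])
  then have f': "f \<in> graded_hom S (stalk B x) (shift S 0)" by (simp add: graded_hom_def linear_maps_def)
  have fD: "ev x f \<in> carrier D" by (rule hpart_D_carrier[OF ev_hpart[OF x f']])
  let ?t = "F (ev x f) x"
  note t = ev_F[OF x f']
  obtain s where s: "s \<in> carrier S" "?t = s \<odot>\<^bsub>stalk B x\<^esub> \<beta> x" by (rule smoothE[OF sm K_closed[OF t(1)]])
  have sh: "s \<in> hpart S l" by (rule smult_\<beta>_hpart[OF x s(1)]) (use t(2) s(2) in simp)
  obtain r where r: "r \<in> carrier S" "s = r \<otimes>\<^bsub>S\<^esub> ?A"
    using smooth_K[OF sm s(1)] t(1) s(2) by auto
  have s0: "s \<noteq> \<zero>\<^bsub>S\<^esub>"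
  proof
    assume "s = \<zero>\<^bsub>S\<^esub>"
    then have t0: "?t = \<zero>\<^bsub>stalk B x\<^esub>" using s(2) \<beta>_closed[OF x] by simp
    have "F (ev x f) y = \<zero>\<^bsub>stalk B y\<^esub>" if "y \<in> verts G" for y
      using fun_cong[OF t(3), of y] that unfolding t0 delta_def by simp
    from F_zero_imp[OF fD this] have "ev x f = D0" by simp
    then have "ev x f \<beta> = D0 \<beta>" by simp
    then show False using f(2) \<beta>_section S.one_not_zero by (simp add: ev_def D0_def)
  qed
  have "r \<in> hpart S (l - ?N)"
    by (rule S.mult_reflects_hpart[OF Ah A0 r(1)]) (use sh r(2) in simp)
  moreover have "r \<noteq> \<zero>\<^bsub>S\<^esub>" using s0 r(2) by auto
  ultimately show "?N \<le> l" using S.hpart_neg[of "l - ?N"] by (cases "l - ?N < 0") auto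
  let ?\<kappa> = "?A \<odot>\<^bsub>stalk B x\<^esub> \<beta> x"
  have \<kappa>: "?\<kappa> \<in> K x" by (rule lprod_K[OF x \<beta>_closed[OF x]])
  have "?\<kappa> \<in> hpart (stalk B x) (?N + 0)" by (rule P.smult_hpart[OF Ah \<beta>_hpart[OF x]])
  then have "co x ?\<kappa> \<in> hpart D (?N - l)" using co_hpart[OF \<kappa>, of ?N] by simp
  then have h: "co x ?\<kappa> \<beta> \<in> hpart S (?N - l + 0)"
    using \<beta>_Sec unfolding hpart_D_iff graded_hom_Sec_iff by blast
  have "co x ?\<kappa> \<beta> \<noteq> \<zero>\<^bsub>S\<^esub>"
  proof
    assume 0: "co x ?\<kappa> \<beta> = \<zero>\<^bsub>S\<^esub>"
    have "co x ?\<kappa> = D0"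
    proof (rule extensionalityI[where A = \<Gamma>G])
      fix m assume m: "m \<in> \<Gamma>G"
      obtain u where u: "u \<in> carrier S" "m x = u \<odot>\<^bsub>stalk B x\<^esub> \<beta> x"
        by (rule smoothE[OF sm \<Gamma>_verts_closed[OF m x]])
      show "co x ?\<kappa> m = D0 m" using co_val[OF \<kappa> m \<beta>_section u] 0 u(1) m by (simp add: D0_def)
    qed (simp_all add: D_ext[OF co_D[OF \<kappa>]] D0_def)
    then have "delta x ?\<kappa> x = \<zero>\<^bsub>stalk B x\<^esub>" using F_D0[OF x] F_co[OF \<kappa>] by simp
    then have "?A \<odot>\<^bsub>stalk B x\<^esub> \<beta> x = \<zero>\<^bsub>stalk B x\<^esub>" using x by (simp add: delta_def)
    then show False
      using stalk_tf[OF x] \<beta>_closed[OF x] \<beta>_nonzero[OF x] A0 lprod_closed unfolding torsion_free_def by blast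
  qed
  then show "l \<le> ?N" using S.hpart_neg[of "?N - l"] h by (cases "?N - l < 0") auto
qed

end

subsection \<open>Vertices of valency \<open>l\<close> are smooth\<close>

lemma eq_if_diff_zero: "a \<in> carrier S \<Longrightarrow> b \<in> carrier S \<Longrightarrow> a \<ominus>\<^bsub>S\<^esub> b = \<zero>\<^bsub>S\<^esub> \<Longrightarrow> a = b"
  using S.minus_equality[of a "\<ominus>\<^bsub>S\<^esub> b"] by (simp add: S.minus_eq)

text \<open>The constant is read off at \<open>w\<close> and carried downwards. Across an edge the
  two scalars agree modulo the label, and for scalars of degree 0 such a congruence is an
  equality.\<close>

lemma degree_0_section_constant:
  assumes g: "g \<in> \<Gamma>G" "\<And>y. y \<in> verts G \<Longrightarrow> g y \<in> hpart (stalk B y) 0"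
    and sm: "\<And>y. below G x y \<Longrightarrow> smooth y"
  shows "\<exists>s \<in> hpart S 0. \<forall>y. below G x y \<longrightarrow> g y = s \<odot>\<^bsub>stalk B y\<^esub> \<beta> y"
proof -
  obtain s where s: "s \<in> carrier S" "g w = s \<odot>\<^bsub>stalk B w\<^esub> \<beta> w"
    by (rule smoothE[OF smooth_w \<Gamma>_verts_closed[OF g(1) w_vert]])
  have sh: "s \<in> hpart S 0" by (rule smult_\<beta>_hpart[OF w_vert s(1)]) (use g(2)[OF w_vert] s(2) in simp)
  have "below G x y \<longrightarrow> g y = s \<odot>\<^bsub>stalk B y\<^esub> \<beta> y" if "y \<in> verts G" for y
    using that
  proof (induction y rule: arrow_induct)
    case (step y)
    show ?case
    proof (cases "y = w")
      case True
      then show ?thesis using s(2) by simp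
    next
      case False
      then obtain z where yz: "arrow y z" using exists_arrow[OF step(1)] by blast
      have z: "z \<in> verts G" using arrow_verts[OF yz] by simp
      have E: "{y, z} \<in> edges G" by (rule arrow_edge[OF yz])
      show ?thesis
      proof
        assume xy: "below G x y"
        have byz: "below G y z" using yz by (simp add: arrow_def)
        have xz: "below G x z" by (rule below_trans[OF xy byz])
        have gz: "g z = s \<odot>\<^bsub>stalk B z\<^esub> \<beta> z" using step(2)[OF byz] xz by simp
        obtain t where t: "t \<in> carrier S" "g y = t \<odot>\<^bsub>stalk B y\<^esub> \<beta> y"
          by (rule smoothE[OF sm[OF xy] \<Gamma>_verts_closed[OF g(1) step(1)]])
        have th: "t \<in> hpart S 0" by (rule smult_\<beta>_hpart[OF step(1) t(1)]) (use g(2)[OF step(1)] t(2) in simp)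
        interpret Q: graded_mod S "edge_stalk B {y, z}" by (rule edge_mod[OF E])
        let ?r = "rho B y {y, z} (\<beta> y)"
        have r: "?r \<in> carrier (edge_stalk B {y, z})" by (rule rho_closed[OF E _ \<beta>_closed[OF step(1)]]) simp
        have "t \<odot>\<^bsub>edge_stalk B {y, z}\<^esub> ?r = rho B y {y, z} (g y)"
          unfolding t(2) by (rule rho_smult[OF E _ t(1) \<beta>_closed[OF step(1)], symmetric]) simp
        also have "\<dots> = rho B z {y, z} (g z)" by (rule \<Gamma>_verts_arrow[OF g(1) yz])
        also have "\<dots> = s \<odot>\<^bsub>edge_stalk B {y, z}\<^esub> ?r"
          unfolding gz \<beta>_arrow[OF yz] by (rule rho_smult[OF E _ s(1) \<beta>_closed[OF z]]) simp
        finally have "(t \<ominus>\<^bsub>S\<^esub> s) \<odot>\<^bsub>edge_stalk B {y, z}\<^esub> ?r = \<zero>\<^bsub>edge_stalk B {y, z}\<^esub>"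
          using r s(1) t(1) by (simp add: S.minus_eq Q.M.smult_l_distr Q.M.smult_l_minus Q.M.r_neg)
        then have "t \<ominus>\<^bsub>S\<^esub> s \<in> PIdl\<^bsub>S\<^esub> (lab {y, z})"
          using s(1) t(1) by (intro \<beta>_annihilator[OF yz sm[OF xz], of y]) simp_all
        moreover have "t \<ominus>\<^bsub>S\<^esub> s \<in> hpart S 0"
          unfolding S.minus_eq by (intro S.S.hpart_add S.S.hpart_uminus th sh)
        ultimately have "t \<ominus>\<^bsub>S\<^esub> s = \<zero>\<^bsub>S\<^esub>" using hpart_0_PIdl_lab[OF _ _ E] by simp
        then show "g y = s \<odot>\<^bsub>stalk B y\<^esub> \<beta> y" using eq_if_diff_zero[OF t(1) s(1)] t(2) by simp
      qed
    qed
  qed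
  then show ?thesis using sh below_verts by (intro bexI[of _ s]) auto
qed

context
  fixes x assumes x: "x \<in> verts G" and xw: "x \<noteq> w" and sm: "\<And>y. below G x y \<Longrightarrow> smooth y"
begin

lemma smult_\<beta>_family:
  assumes "s \<in> hpart S i"
  shows "s \<odot>\<^bsub>stalk B x\<^esub> \<beta> x \<in> hpart (stalk B x) i"
  using graded_mod.smult_hpart[OF stalk_mod[OF x] assms \<beta>_hpart[OF x]] by simp

text \<open>A global section through \<open>p\<close> can be replaced by its degree 0 component,
  which above \<open>x\<close> is a constant multiple of \<beta>. Thus \<open>p\<close> and this
  multiple of \<beta>_x restrict alike to the upper edges, and minimality of the cover admits no
  further elements in degree 0.\<close>

lemma hpart_0_stalk:
  assumes p: "p \<in> hpart (stalk B x) 0"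
  shows "\<exists>s \<in> hpart S 0. p = s \<odot>\<^bsub>stalk B x\<^esub> \<beta> x"
proof -
  interpret P: graded_mod S "stalk B x" by (rule stalk_mod[OF x])
  define U where "U n = (if n = 0 then {s \<odot>\<^bsub>stalk B x\<^esub> \<beta> x | s. s \<in> hpart S 0} else hpart (stalk B x) n)" for n :: int
  note \<beta>c = \<beta>_closed[OF x] and Sc = S.S.hpart_carrier
  have Uh: "U n \<subseteq> hpart (stalk B x) n" for n using smult_\<beta>_family by (auto simp: U_def)
  have "U 0 = hpart (stalk B x) 0"
  proof (rule S.projective_cover_family[OF cover[OF x xw] Uh])
    show "\<zero>\<^bsub>stalk B x\<^esub> \<in> U n" for n
      using \<beta>c by (auto simp: U_def intro!: exI[of _ "\<zero>\<^bsub>S\<^esub>"])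
    show "u \<oplus>\<^bsub>stalk B x\<^esub> v \<in> U n" if uv: "u \<in> U n" "v \<in> U n" for n u v
    proof (cases "n = 0")
      case True
      then obtain s t where st: "s \<in> hpart S 0" "t \<in> hpart S 0" "u = s \<odot>\<^bsub>stalk B x\<^esub> \<beta> x" "v = t \<odot>\<^bsub>stalk B x\<^esub> \<beta> x"
        using uv by (auto simp: U_def)
      have "u \<oplus>\<^bsub>stalk B x\<^esub> v = (s \<oplus>\<^bsub>S\<^esub> t) \<odot>\<^bsub>stalk B x\<^esub> \<beta> x"
        unfolding st(3,4) by (rule P.M.smult_l_distr[OF Sc[OF st(1)] Sc[OF st(2)] \<beta>c, symmetric])
      then show ?thesis using True S.S.hpart_add[OF st(1,2)] by (auto simp: U_def)
    next
      case False
      then show ?thesis using uv P.M.hpart_add by (simp add: U_def)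
    qed
    show "a \<odot>\<^bsub>stalk B x\<^esub> u \<in> U (i + n)" if au: "a \<in> hpart S i" "u \<in> U n" for i n a u
    proof (cases "i + n = 0")
      case False
      then show ?thesis using P.smult_hpart[OF au(1)] au(2) Uh[of n] by (auto simp: U_def)
    next
      case True
      have u: "u \<in> hpart (stalk B x) n" using au(2) Uh by blast
      show ?thesis
      proof (cases "n = 0")
        case n: True
        then obtain s where s: "s \<in> hpart S 0" "u = s \<odot>\<^bsub>stalk B x\<^esub> \<beta> x" using au(2) by (auto simp: U_def)
        have "a \<odot>\<^bsub>stalk B x\<^esub> u = (a \<otimes>\<^bsub>S\<^esub> s) \<odot>\<^bsub>stalk B x\<^esub> \<beta> x"
          unfolding s(2) by (rule P.M.smult_assoc1[OF Sc[OF au(1)] Sc[OF s(1)] \<beta>c, symmetric])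
        moreover have "a \<otimes>\<^bsub>S\<^esub> s \<in> hpart S 0" using S.hpart_mult[OF au(1) s(1)] True n by simp
        ultimately show ?thesis using True by (auto simp: U_def)
      next
        case False
        \<comment> \<open>One of the opposite degrees \<open>i\<close> and \<open>n\<close> is
          negative, and both \<open>S\<close> and the stalk vanish there.\<close>
        have "a = \<zero>\<^bsub>S\<^esub> \<or> u = \<zero>\<^bsub>stalk B x\<^esub>"
        proof (cases "n < 0")
          case True
          then show ?thesis using u stalk_neg[OF x] by simp
        next
          case False
          then have "i < 0" using \<open>i + n = 0\<close> \<open>n \<noteq> 0\<close> by simp
          then show ?thesis using S.hpart_neg au(1) by simp
        qed
        then have "a \<odot>\<^bsub>stalk B x\<^esub> u = \<zero>\<^bsub>stalk B x\<^esub>"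
          using Sc[OF au(1)] P.M.hpart_carrier[OF u] by auto
        then show ?thesis using \<beta>c True by (auto simp: U_def intro!: exI[of _ "\<zero>\<^bsub>S\<^esub>"])
      qed
    qed
    show "\<exists>u \<in> U n. rho_delta G B x p = rho_delta G B x u" if p: "p \<in> hpart (stalk B x) n" for n p
    proof (cases "n = 0")
      case True
      have p0: "p \<in> hpart (stalk B x) 0" using p True by simp
      obtain g where g: "g \<in> \<Gamma>G" "g x = p" by (rule global_section_through[OF x P.M.hpart_carrier[OF p]])
      define h where "h = (\<lambda>y\<in>verts G. gcomp (stalk B y) 0 (g y))"
      have h: "h \<in> \<Gamma>G" unfolding h_def by (rule \<Gamma>_gcomp[OF g(1)])
      have hx: "h x = p" using x g(2) P.M.gcomp_hom[OF p0] by (simp add: h_def)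
      have h0: "h y \<in> hpart (stalk B y) 0" if y: "y \<in> verts G" for y
      proof -
        interpret Y: graded_mod S "stalk B y" by (rule stalk_mod[OF y])
        show ?thesis using Y.M.gcomp_hpart[OF \<Gamma>_verts_closed[OF g(1) y]] y by (simp add: h_def)
      qed
      obtain s where s: "s \<in> hpart S 0" "\<forall>y. below G x y \<longrightarrow> h y = s \<odot>\<^bsub>stalk B y\<^esub> \<beta> y"
        using degree_0_section_constant[OF h h0 sm] by blast
      have "rho_delta G B x p = rho_delta G B x (s \<odot>\<^bsub>stalk B x\<^esub> \<beta> x)"
      proof (rule rho_delta_eqI)
        fix y assume xy: "arrow x y"
        have E: "{x, y} \<in> edges G" by (rule arrow_edge[OF xy])
        have y: "y \<in> verts G" and "below G x y" using arrow_verts[OF xy] xy by (simp_all add: arrow_def)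
        have "rho B x {x, y} p = rho B y {x, y} (h y)" using \<Gamma>_verts_arrow[OF h xy] hx by simp
        also have "\<dots> = rho B y {x, y} (s \<odot>\<^bsub>stalk B y\<^esub> \<beta> y)" using s(2) \<open>below G x y\<close> by simp
        also have "\<dots> = s \<odot>\<^bsub>edge_stalk B {x, y}\<^esub> rho B y {x, y} (\<beta> y)"
          by (rule rho_smult[OF E _ Sc[OF s(1)] \<beta>_closed[OF y]]) simp
        also have "\<dots> = rho B x {x, y} (s \<odot>\<^bsub>stalk B x\<^esub> \<beta> x)"
          unfolding \<beta>_arrow[OF xy, symmetric] by (rule rho_smult[OF E _ Sc[OF s(1)] \<beta>c, symmetric]) simp
        finally show "rho B x {x, y} p = rho B x {x, y} (s \<odot>\<^bsub>stalk B x\<^esub> \<beta> x)" .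
      qed
      then show ?thesis using s(1) True by (auto simp: U_def)
    next
      case False
      then show ?thesis using p by (auto simp: U_def)
    qed
  qed
  then show ?thesis using p by (auto simp: U_def)
qed

section \<open>Values at \<beta> of the forms dual to a stalk\<close>

definition H :: "'m \<Rightarrow> ('k, 'v) sym" where
  "H p = co x (lprod (star x) \<odot>\<^bsub>stalk B x\<^esub> p) \<beta>"

lemma H_closed: "p \<in> carrier (stalk B x) \<Longrightarrow> H p \<in> carrier S"
  unfolding H_def by (rule D_simps(1)[OF co_D[OF x lprod_K[OF x]] \<beta>_section])

lemma H_add:
  assumes "p \<in> carrier (stalk B x)" "q \<in> carrier (stalk B x)"
  shows "H (p \<oplus>\<^bsub>stalk B x\<^esub> q) = H p \<oplus>\<^bsub>S\<^esub> H q"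
proof -
  interpret P: graded_mod S "stalk B x" by (rule stalk_mod[OF x])
  show ?thesis
    unfolding H_def P.M.smult_r_distr[OF lprod_closed assms]
    by (rule co_add[OF x lprod_K[OF x assms(1)] lprod_K[OF x assms(2)] \<beta>_section])
qed

lemma H_smult:
  assumes "s \<in> carrier S" "p \<in> carrier (stalk B x)"
  shows "H (s \<odot>\<^bsub>stalk B x\<^esub> p) = s \<otimes>\<^bsub>S\<^esub> H p"
proof -
  interpret P: graded_mod S "stalk B x" by (rule stalk_mod[OF x])
  have "lprod (star x) \<odot>\<^bsub>stalk B x\<^esub> (s \<odot>\<^bsub>stalk B x\<^esub> p) = s \<odot>\<^bsub>stalk B x\<^esub> (lprod (star x) \<odot>\<^bsub>stalk B x\<^esub> p)"
    using assms by (simp add: P.M.smult_assoc1[symmetric] S.m_comm)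
  then show ?thesis unfolding H_def using co_smult[OF x lprod_K[OF x assms(2)] assms(1) \<beta>_section] by simp
qed

lemma H_hpart:
  assumes p: "p \<in> hpart (stalk B x) i" and card: "int (card (star x)) = l"
  shows "H p \<in> hpart S i"
proof -
  interpret P: graded_mod S "stalk B x" by (rule stalk_mod[OF x])
  have "lprod (star x) \<odot>\<^bsub>stalk B x\<^esub> p \<in> hpart (stalk B x) (l + i)"
    using P.smult_hpart[OF lprod_hpart[OF finite_star[of x]] p] card by simp
  from co_hpart[OF x lprod_K[OF x P.M.hpart_carrier[OF p]] this]
  have "co x (lprod (star x) \<odot>\<^bsub>stalk B x\<^esub> p) \<in> hpart D i" by simp
  then have "H p \<in> hpart S (i + 0)"
    unfolding H_def hpart_D_iff graded_hom_Sec_iff using \<beta>_Sec[OF x] by blast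
  then show ?thesis by simp
qed

text \<open>As \<open>p\<close> already vanishes on the edge to \<open>y\<close>, the product of the
  remaining labels suffices to bring it into \<open>K x\<close>. The omitted label is therefore an
  honest factor in front of the dual form.\<close>

lemma H_kernel:
  assumes xy: "arrow x y" and p: "p \<in> carrier (stalk B x)" "rho B x {x, y} p = \<zero>\<^bsub>edge_stalk B {x, y}\<^esub>"
  shows "H p \<in> PIdl\<^bsub>S\<^esub> (lab {x, y})"
proof -
  interpret P: graded_mod S "stalk B x" by (rule stalk_mod[OF x])
  have E: "{x, y} \<in> edges G" by (rule arrow_edge[OF xy])
  have st: "{x, y} \<in> star x" using E by (simp add: star_def)
  let ?a = "lprod (star x - {{x, y}})"
  let ?\<kappa> = "?a \<odot>\<^bsub>stalk B x\<^esub> p"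
  have "rho B x E' ?\<kappa> = \<zero>\<^bsub>edge_stalk B E'\<^esub>" if "E' \<in> star x" for E'
  proof -
    have E': "E' \<in> edges G" "x \<in> E'" using that by (simp_all add: star_def)
    interpret Q: graded_mod S "edge_stalk B E'" by (rule edge_mod[OF E'(1)])
    show ?thesis
    proof (cases "E' = {x, y}")
      case True
      have "rho B x E' p = \<zero>\<^bsub>edge_stalk B E'\<^esub>" using p(2) True by simp
      then show ?thesis unfolding rho_smult[OF E' lprod_closed p(1)] by simp
    next
      case False
      have "?a \<in> PIdl\<^bsub>S\<^esub> (lab E')" using False that finite_star by (intro lprod_PIdl) simp_all
      then show ?thesis
        unfolding rho_smult[OF E' lprod_closed p(1)]
        by (rule PIdl_lab_kills[OF E'(1) rho_closed[OF E' p(1)]])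
    qed
  qed
  then have \<kappa>: "?\<kappa> \<in> K x" using p(1) by (simp add: K_def)
  have "lprod (star x) \<odot>\<^bsub>stalk B x\<^esub> p = lab {x, y} \<odot>\<^bsub>stalk B x\<^esub> ?\<kappa>"
    unfolding lprod_remove[OF finite_star st] by (rule P.M.smult_assoc1) (simp_all add: p(1))
  then have "H p = lab {x, y} \<otimes>\<^bsub>S\<^esub> co x ?\<kappa> \<beta>"
    unfolding H_def using co_smult[OF x \<kappa> lab_closed \<beta>_section] by simp
  then show ?thesis
    unfolding S.PIdl_iff using D_simps(1)[OF co_D[OF x \<kappa>] \<beta>_section]
    by (intro bexI[of _ "co x ?\<kappa> \<beta>"]) (simp_all add: S.m_comm)
qed

text \<open>Smoothness of \<open>y\<close> gives a scalar \<open>s\<close> for which p - s \<beta>_x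
  vanishes on the edge, and \<open>H_kernel\<close> applies to this difference.\<close>

lemma H_mod_lab:
  assumes xy: "arrow x y" and p: "p \<in> carrier (stalk B x)"
  obtains s where "s \<in> carrier S"
    "rho B x {x, y} p = s \<odot>\<^bsub>edge_stalk B {x, y}\<^esub> rho B x {x, y} (\<beta> x)"
    "H p \<ominus>\<^bsub>S\<^esub> s \<otimes>\<^bsub>S\<^esub> H (\<beta> x) \<in> PIdl\<^bsub>S\<^esub> (lab {x, y})"
proof -
  interpret P: graded_mod S "stalk B x" by (rule stalk_mod[OF x])
  have E: "{x, y} \<in> edges G" by (rule arrow_edge[OF xy])
  interpret Q: graded_mod S "edge_stalk B {x, y}" by (rule edge_mod[OF E])
  have y: "y \<in> verts G" and bxy: "below G x y" using arrow_verts[OF xy] xy by (simp_all add: arrow_def)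
  have Ex: "x \<in> {x, y}" and Ey: "y \<in> {x, y}" by simp_all
  obtain q where q: "q \<in> carrier (stalk B y)" "rho B y {x, y} q = rho B x {x, y} p"
    by (rule rho_surj[OF xy rho_closed[OF E Ex p]])
  obtain s where s: "s \<in> carrier S" "q = s \<odot>\<^bsub>stalk B y\<^esub> \<beta> y" by (rule smoothE[OF sm[OF bxy] q(1)])
  have eq: "rho B x {x, y} p = s \<odot>\<^bsub>edge_stalk B {x, y}\<^esub> rho B x {x, y} (\<beta> x)"
    unfolding q(2)[symmetric] s(2) \<beta>_arrow[OF xy] by (rule rho_smult[OF E Ey s(1) \<beta>_closed[OF y]])
  have ns: "\<ominus>\<^bsub>S\<^esub> s \<in> carrier S" using s(1) by simp
  note \<beta>c = \<beta>_closed[OF x]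
  let ?q = "(\<ominus>\<^bsub>S\<^esub> s) \<odot>\<^bsub>stalk B x\<^esub> \<beta> x"
  have qc: "?q \<in> carrier (stalk B x)" using ns \<beta>c by simp
  have "rho B x {x, y} (p \<oplus>\<^bsub>stalk B x\<^esub> ?q) = \<zero>\<^bsub>edge_stalk B {x, y}\<^esub>"
    unfolding rho_add[OF E Ex p qc] rho_smult[OF E Ex ns \<beta>c] eq
    using s(1) rho_closed[OF E Ex \<beta>c] by (simp add: Q.M.smult_l_minus Q.M.r_neg)
  from H_kernel[OF xy _ this] have "H (p \<oplus>\<^bsub>stalk B x\<^esub> ?q) \<in> PIdl\<^bsub>S\<^esub> (lab {x, y})" using p qc by simp
  moreover have "H (p \<oplus>\<^bsub>stalk B x\<^esub> ?q) = H p \<ominus>\<^bsub>S\<^esub> s \<otimes>\<^bsub>S\<^esub> H (\<beta> x)"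
    unfolding H_add[OF p qc] H_smult[OF ns \<beta>c] S.minus_eq using s(1) H_closed[OF \<beta>c] by (simp add: S.l_minus)
  ultimately show ?thesis using that[OF s(1) eq] by simp
qed

text \<open>The scalars from \<open>H_mod_lab\<close> vary with the upper edge, but dividing
  \<open>H p\<close> by the invertible constant \<open>H (\<beta> x)\<close> gives one scalar
  congruent to each of them modulo the corresponding label. So a single multiple of \<beta>_x has
  the same restriction as \<open>p\<close>, and minimality of the cover finishes.\<close>

lemma smooth_if_H_nonzero:
  assumes card: "int (card (star x)) = l" and c0: "H (\<beta> x) \<noteq> \<zero>\<^bsub>S\<^esub>"
  shows "smooth x"
proof -
  interpret P: graded_mod S "stalk B x" by (rule stalk_mod[OF x])
  note \<beta>c = \<beta>_closed[OF x] and Sc = S.S.hpart_carrier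
  let ?c = "H (\<beta> x)"
  have cc: "?c \<in> carrier S" by (rule H_closed[OF \<beta>c])
  obtain c' where c': "c' \<in> hpart S 0" "c' \<otimes>\<^bsub>S\<^esub> ?c = \<one>\<^bsub>S\<^esub>"
    using S.hpart_0_inv[OF H_hpart[OF \<beta>_hpart[OF x] card] c0] by blast
  have c'c: "c' \<in> carrier S" by (rule Sc[OF c'(1)])
  define U where "U n = {s \<odot>\<^bsub>stalk B x\<^esub> \<beta> x | s. s \<in> hpart S n}" for n
  have U: "U n = hpart (stalk B x) n" for n
  proof (rule S.projective_cover_family[OF cover[OF x xw]])
    show "U n \<subseteq> hpart (stalk B x) n" for n using smult_\<beta>_family by (auto simp: U_def)
    show "\<zero>\<^bsub>stalk B x\<^esub> \<in> U n" for n using \<beta>c by (auto simp: U_def intro!: exI[of _ "\<zero>\<^bsub>S\<^esub>"])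
    show "u \<oplus>\<^bsub>stalk B x\<^esub> v \<in> U n" if uv: "u \<in> U n" "v \<in> U n" for n u v
    proof -
      obtain s t where st: "s \<in> hpart S n" "t \<in> hpart S n" "u = s \<odot>\<^bsub>stalk B x\<^esub> \<beta> x" "v = t \<odot>\<^bsub>stalk B x\<^esub> \<beta> x"
        using uv by (auto simp: U_def)
      have "u \<oplus>\<^bsub>stalk B x\<^esub> v = (s \<oplus>\<^bsub>S\<^esub> t) \<odot>\<^bsub>stalk B x\<^esub> \<beta> x"
        unfolding st(3,4) by (rule P.M.smult_l_distr[OF Sc[OF st(1)] Sc[OF st(2)] \<beta>c, symmetric])
      then show ?thesis using S.S.hpart_add[OF st(1,2)] by (auto simp: U_def)
    qed
    show "a \<odot>\<^bsub>stalk B x\<^esub> u \<in> U (i + n)" if au: "a \<in> hpart S i" "u \<in> U n" for i n a u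
    proof -
      obtain s where s: "s \<in> hpart S n" "u = s \<odot>\<^bsub>stalk B x\<^esub> \<beta> x" using au(2) by (auto simp: U_def)
      have "a \<odot>\<^bsub>stalk B x\<^esub> u = (a \<otimes>\<^bsub>S\<^esub> s) \<odot>\<^bsub>stalk B x\<^esub> \<beta> x"
        unfolding s(2) by (rule P.M.smult_assoc1[OF Sc[OF au(1)] Sc[OF s(1)] \<beta>c, symmetric])
      then show ?thesis using S.hpart_mult[OF au(1) s(1)] by (auto simp: U_def)
    qed
    show "\<exists>u \<in> U n. rho_delta G B x p = rho_delta G B x u" if p: "p \<in> hpart (stalk B x) n" for n p
    proof -
      let ?s = "c' \<otimes>\<^bsub>S\<^esub> H p"
      have pc: "p \<in> carrier (stalk B x)" by (rule P.M.hpart_carrier[OF p])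
      have Hp: "H p \<in> carrier S" by (rule H_closed[OF pc])
      have sh: "?s \<in> hpart S n" using S.hpart_mult[OF c'(1) H_hpart[OF p card]] by simp
      have "rho_delta G B x p = rho_delta G B x (?s \<odot>\<^bsub>stalk B x\<^esub> \<beta> x)"
      proof (rule rho_delta_eqI)
        fix y assume xy: "arrow x y"
        have E: "{x, y} \<in> edges G" "x \<in> {x, y}" using arrow_edge[OF xy] by simp_all
        have r: "rho B x {x, y} (\<beta> x) \<in> carrier (edge_stalk B {x, y})" by (rule rho_closed[OF E \<beta>c])
        obtain t where t: "t \<in> carrier S"
          "rho B x {x, y} p = t \<odot>\<^bsub>edge_stalk B {x, y}\<^esub> rho B x {x, y} (\<beta> x)"
          "H p \<ominus>\<^bsub>S\<^esub> t \<otimes>\<^bsub>S\<^esub> ?c \<in> PIdl\<^bsub>S\<^esub> (lab {x, y})" by (rule H_mod_lab[OF xy pc])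
        have "c' \<otimes>\<^bsub>S\<^esub> (t \<otimes>\<^bsub>S\<^esub> ?c) = t \<otimes>\<^bsub>S\<^esub> (c' \<otimes>\<^bsub>S\<^esub> ?c)" by (rule S.m_lcomm[OF c'c t(1) cc])
        then have "c' \<otimes>\<^bsub>S\<^esub> (H p \<ominus>\<^bsub>S\<^esub> t \<otimes>\<^bsub>S\<^esub> ?c) = ?s \<ominus>\<^bsub>S\<^esub> t"
          using c'c Hp t(1) cc c'(2) by (simp add: S.minus_eq S.r_distr S.r_minus)
        then have "?s \<ominus>\<^bsub>S\<^esub> t \<in> PIdl\<^bsub>S\<^esub> (lab {x, y})" using PIdl_mult[OF c'c t(3)] by simp
        then have "?s \<odot>\<^bsub>edge_stalk B {x, y}\<^esub> rho B x {x, y} (\<beta> x) =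
            t \<odot>\<^bsub>edge_stalk B {x, y}\<^esub> rho B x {x, y} (\<beta> x)"
          by (intro graded_mod.smult_diff_zero[OF edge_mod[OF E(1)] Sc[OF sh] t(1) r] PIdl_lab_kills[OF E(1) r])
        then show "rho B x {x, y} p = rho B x {x, y} (?s \<odot>\<^bsub>stalk B x\<^esub> \<beta> x)"
          unfolding rho_smult[OF E Sc[OF sh] \<beta>c] t(2) by simp
      qed
      then show ?thesis using sh by (auto simp: U_def)
    qed
  qed
  show ?thesis
    unfolding smooth_def
  proof
    fix m assume "m \<in> carrier (stalk B x)"
    then show "\<exists>s \<in> carrier S. m = s \<odot>\<^bsub>stalk B x\<^esub> \<beta> x"
    proof (induction m rule: P.M.graded_induct)
      case (add m m')
      then obtain s t where st: "s \<in> carrier S" "t \<in> carrier S" "m = s \<odot>\<^bsub>stalk B x\<^esub> \<beta> x"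
        "m' = t \<odot>\<^bsub>stalk B x\<^esub> \<beta> x" by blast
      have "m \<oplus>\<^bsub>stalk B x\<^esub> m' = (s \<oplus>\<^bsub>S\<^esub> t) \<odot>\<^bsub>stalk B x\<^esub> \<beta> x"
        unfolding st(3,4) by (rule P.M.smult_l_distr[OF st(1,2) \<beta>c, symmetric])
      then show ?case using st(1,2) by (intro bexI[of _ "s \<oplus>\<^bsub>S\<^esub> t"]) simp_all
    next
      case (hom n m)
      then have "m \<in> U n" unfolding U .
      then obtain s where "s \<in> hpart S n" "m = s \<odot>\<^bsub>stalk B x\<^esub> \<beta> x" by (auto simp: U_def)
      then show ?case using Sc by blast
    qed
  qed
qed

lemma up_down:
  defines "down \<equiv> star x - up_edges G x"
  shows "finite (up_edges G x)" "finite down" "up_edges G x \<subseteq> star x" "star x = up_edges G x \<union> down"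
    and "E \<in> down \<Longrightarrow> \<exists>y. E = {y, x} \<and> arrow y x"
proof -
  show sub: "up_edges G x \<subseteq> star x" using up_edges_iff arrow_edge by (auto simp: star_def)
  show "finite (up_edges G x)" by (rule finite_subset[OF sub finite_star])
  show "finite down" using finite_star by (simp add: down_def)
  show "star x = up_edges G x \<union> down" using sub by (auto simp: down_def)
  assume "E \<in> down"
  then have E: "E \<in> edges G" "x \<in> E" "\<not> (\<exists>y. arrow x y \<and> E = {x, y})"
    by (auto simp: down_def star_def up_edges_iff)
  from edge_cases[OF E(1,2)] E(3) show "\<exists>y. E = {y, x} \<and> arrow y x" by blast
qed

text \<open>Multiples of all labels below \<open>x\<close> are multiples of their product: this is clear in a free
  module, and follows for the projective module \<open>stalk B x\<close> from a dual basis.\<close>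

lemma down_divides:
  fixes t
  defines "down \<equiv> star x - up_edges G x"
  assumes t: "t \<in> K x"
  obtains \<kappa> where "\<kappa> \<in> carrier (stalk B x)" "t = lprod down \<odot>\<^bsub>stalk B x\<^esub> \<kappa>"
proof -
  interpret P: graded_mod S "stalk B x" by (rule stalk_mod[OF x])
  note ud = up_down[folded down_def]
  have proj: "graded_projective S (stalk B x)" using cover[OF x xw] by (simp add: projective_cover_def)
  obtain A e \<phi> where A_all: "finite A" "A \<subseteq> carrier (stalk B x)"
    "\<forall>a \<in> A. \<phi> a \<in> graded_hom S (stalk B x) (shift S (e a))"
    "\<forall>p \<in> carrier (stalk B x). p = (\<Oplus>\<^bsub>stalk B x\<^esub>a\<in>A. \<phi> a p \<odot>\<^bsub>stalk B x\<^esub> a)"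
    by (rule S.projective_dual_basis[OF proj stalk_fg[OF x]])
  note A = A_all(1,2) bspec[OF A_all(3)] bspec[OF A_all(4)]
  have \<phi>c: "\<phi> a p \<in> carrier S" if "a \<in> A" "p \<in> carrier (stalk B x)" for a p
    using A(3)[OF that(1)] that(2) by (auto simp: graded_hom_def linear_maps_def)
  have "\<exists>r \<in> carrier S. \<phi> a t = r \<otimes>\<^bsub>S\<^esub> lprod down" if a: "a \<in> A" for a
  proof (rule lprod_divides[OF ud(2), where v = x])
    show "down \<subseteq> edges G" using star_edges by (auto simp: down_def)
    show "x \<in> E" if "E \<in> down" for E using that by (simp add: down_def star_def)
    show "\<phi> a t \<in> carrier S" by (rule \<phi>c[OF a K_closed[OF t]])
    fix E assume "E \<in> down"
    then obtain y where y: "E = {y, x}" "arrow y x" using ud(5) by blast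
    have E: "{y, x} \<in> edges G" by (rule arrow_edge[OF y(2)])
    \<comment> \<open>At a lower edge \<open>x\<close> is the upper end, so an element vanishing on
      the edge is the label times an element of the stalk, and a form keeps the factor.\<close>
    obtain q where q: "q \<in> carrier (stalk B x)" "t = lab {y, x} \<odot>\<^bsub>stalk B x\<^esub> q"
      by (rule rho_kernel[OF y(2) K_closed[OF t] K_rho[OF t E]]) simp_all
    have "\<phi> a t = lab {y, x} \<otimes>\<^bsub>S\<^esub> \<phi> a q"
      unfolding q(2) using A(3)[OF a] q(1) by (simp add: graded_hom_def linear_maps_def S.smult_S)
    then show "\<phi> a t \<in> PIdl\<^bsub>S\<^esub> (lab E)"
      unfolding S.PIdl_iff y(1) using \<phi>c[OF a q(1)] by (intro bexI[of _ "\<phi> a q"]) (simp_all add: S.m_comm)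
  qed
  then obtain r where r: "\<And>a. a \<in> A \<Longrightarrow> r a \<in> carrier S" "\<And>a. a \<in> A \<Longrightarrow> \<phi> a t = r a \<otimes>\<^bsub>S\<^esub> lprod down"
    by metis
  let ?\<kappa> = "\<Oplus>\<^bsub>stalk B x\<^esub>a\<in>A. r a \<odot>\<^bsub>stalk B x\<^esub> a"
  have ra: "r a \<odot>\<^bsub>stalk B x\<^esub> a \<in> carrier (stalk B x)" if "a \<in> A" for a using r(1)[OF that] A(2) that by auto
  have "lprod down \<odot>\<^bsub>stalk B x\<^esub> ?\<kappa> = (\<Oplus>\<^bsub>stalk B x\<^esub>a\<in>A. lprod down \<odot>\<^bsub>stalk B x\<^esub> (r a \<odot>\<^bsub>stalk B x\<^esub> a))"
    using ra by (intro P.M.finsum_smult_ldistr A(1)) auto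
  also have "\<dots> = (\<Oplus>\<^bsub>stalk B x\<^esub>a\<in>A. \<phi> a t \<odot>\<^bsub>stalk B x\<^esub> a)"
  proof (intro P.M.finsum_cong' refl)
    show "(\<lambda>a. \<phi> a t \<odot>\<^bsub>stalk B x\<^esub> a) \<in> A \<rightarrow> carrier (stalk B x)" using \<phi>c[OF _ K_closed[OF t]] A(2) by auto
    fix a assume a: "a \<in> A"
    then have "a \<in> carrier (stalk B x)" using A(2) by blast
    then show "lprod down \<odot>\<^bsub>stalk B x\<^esub> (r a \<odot>\<^bsub>stalk B x\<^esub> a) = \<phi> a t \<odot>\<^bsub>stalk B x\<^esub> a"
      unfolding r(2)[OF a] using r(1)[OF a] by (simp add: P.M.smult_assoc1[symmetric] S.m_comm)
  qed
  also have "\<dots> = t" by (rule A(4)[OF K_closed[OF t], symmetric])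
  finally have "t = lprod down \<odot>\<^bsub>stalk B x\<^esub> ?\<kappa>" by (rule sym)
  moreover have "?\<kappa> \<in> carrier (stalk B x)" using ra by (intro P.M.finsum_closed) auto
  ultimately show ?thesis using that by blast
qed

text \<open>Removing the lower labels leaves degree 0, hence a constant times \<beta>_x. Since
  \<open>x\<close> is not \<open>w\<close>, there is an upper edge, on which \<open>t\<close> also
  vanishes: its label divides the constant times the lower labels, by coprimality it divides the
  constant, and so the constant is zero.\<close>

lemma K_low_degree:
  fixes t
  defines "down \<equiv> star x - up_edges G x"
  assumes t: "t \<in> K x" "t \<in> hpart (stalk B x) (int (card down))"
  shows "t = \<zero>\<^bsub>stalk B x\<^esub>"
proof -
  interpret P: graded_mod S "stalk B x" by (rule stalk_mod[OF x])
  note ud = up_down[folded down_def] and \<beta>c = \<beta>_closed[OF x]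
  have down: "down \<subseteq> edges G" "\<And>E. E \<in> down \<Longrightarrow> x \<in> E" by (auto simp: down_def star_def)
  obtain \<kappa> where \<kappa>: "\<kappa> \<in> carrier (stalk B x)" "t = lprod down \<odot>\<^bsub>stalk B x\<^esub> \<kappa>"
    by (rule down_divides[OF t(1), folded down_def])
  have "\<kappa> \<in> hpart (stalk B x) 0"
    by (rule P.smult_reflects_hpart[OF stalk_tf[OF x] lprod_hpart[OF ud(2)] lprod_nonzero[OF ud(2) down(1)] \<kappa>(1)])
      (use t(2) \<kappa>(2) in simp)
  then obtain s where s: "s \<in> hpart S 0" "\<kappa> = s \<odot>\<^bsub>stalk B x\<^esub> \<beta> x" using hpart_0_stalk by blast
  have sc: "s \<in> carrier S" by (rule S.S.hpart_carrier[OF s(1)])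
  obtain y where xy: "arrow x y" using exists_arrow[OF x xw] by blast
  have E: "{x, y} \<in> edges G" "x \<in> {x, y}" using arrow_edge[OF xy] by simp_all
  have bxy: "below G x y" using xy by (simp add: arrow_def)
  have "{x, y} \<in> up_edges G x" using xy up_edges_iff by blast
  then have nd: "{x, y} \<notin> down" by (simp add: down_def)
  have t': "t = (s \<otimes>\<^bsub>S\<^esub> lprod down) \<odot>\<^bsub>stalk B x\<^esub> \<beta> x"
    unfolding \<kappa>(2) s(2) using sc \<beta>c by (simp add: P.M.smult_assoc1[symmetric] S.m_comm)
  have sd: "s \<otimes>\<^bsub>S\<^esub> lprod down \<in> carrier S" using sc by simp
  have "(s \<otimes>\<^bsub>S\<^esub> lprod down) \<odot>\<^bsub>edge_stalk B {x, y}\<^esub> rho B x {x, y} (\<beta> x) = \<zero>\<^bsub>edge_stalk B {x, y}\<^esub>"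
    using K_rho[OF t(1) E] unfolding t' rho_smult[OF E sd \<beta>c] .
  then have dvd: "s \<otimes>\<^bsub>S\<^esub> lprod down \<in> PIdl\<^bsub>S\<^esub> (lab {x, y})"
    by (rule \<beta>_annihilator[OF xy sm[OF bxy] disjI1[OF refl] sd])
  have "s \<in> PIdl\<^bsub>S\<^esub> (lab {x, y})" by (rule lprod_coprime[OF ud(2) down E nd sc dvd])
  then have "s = \<zero>\<^bsub>S\<^esub>" by (rule hpart_0_PIdl_lab[OF s(1) _ E(1)])
  then show ?thesis unfolding t' using \<beta>c by simp
qed

lemma H_zero:
  assumes card: "int (card (star x)) = l" and c0: "H (\<beta> x) = \<zero>\<^bsub>S\<^esub>" and p: "p \<in> carrier (stalk B x)"
  shows "H p = \<zero>\<^bsub>S\<^esub>"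
proof -
  interpret P: graded_mod S "stalk B x" by (rule stalk_mod[OF x])
  define up where "up = up_edges G x"
  define down where "down = star x - up"
  note ud = up_down[folded up_def, folded down_def]
  have up: "up \<subseteq> edges G" "\<And>E. E \<in> up \<Longrightarrow> x \<in> E" using ud(3) by (auto simp: star_def)
  have \<epsilon>0: "lprod up \<noteq> \<zero>\<^bsub>S\<^esub>" by (rule lprod_nonzero[OF ud(1) up(1)])
  \<comment> \<open>With \<open>H (\<beta> x) = 0\<close> the congruence of \<open>H_mod_lab\<close>
    says that each upper label divides \<open>H p\<close>.\<close>
  have "\<exists>r \<in> carrier S. H p = r \<otimes>\<^bsub>S\<^esub> lprod up" if p: "p \<in> carrier (stalk B x)" for p
  proof (rule lprod_divides[OF ud(1) up H_closed[OF p]])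
    fix E assume "E \<in> up"
    then obtain y where y: "arrow x y" "E = {x, y}" using up_edges_iff unfolding up_def by blast
    obtain s where s: "s \<in> carrier S" "H p \<ominus>\<^bsub>S\<^esub> s \<otimes>\<^bsub>S\<^esub> H (\<beta> x) \<in> PIdl\<^bsub>S\<^esub> (lab {x, y})"
      by (rule H_mod_lab[OF y(1) p])
    then show "H p \<in> PIdl\<^bsub>S\<^esub> (lab E)" using c0 H_closed[OF p] y(2) by (simp add: S.minus_eq)
  qed
  then obtain \<psi> where \<psi>: "\<And>p. p \<in> carrier (stalk B x) \<Longrightarrow> \<psi> p \<in> carrier S"
    "\<And>p. p \<in> carrier (stalk B x) \<Longrightarrow> H p = \<psi> p \<otimes>\<^bsub>S\<^esub> lprod up" by metis
  have uniq: "\<psi> p = r" if "p \<in> carrier (stalk B x)" "r \<in> carrier S" "H p = r \<otimes>\<^bsub>S\<^esub> lprod up" for p r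
    using S.m_rcancel[OF \<epsilon>0 lprod_closed \<psi>(1)[OF that(1)] that(2)] \<psi>(2)[OF that(1)] that(3) by simp
  let ?n = "int (card up)"
  \<comment> \<open>Cancellation in the domain \<open>S\<close> makes the quotient of
    \<open>H\<close> by the upper labels unique; it is therefore linear, and its degree is lowered
    by the number of upper edges.\<close>
  have "\<psi> \<in> graded_hom S (stalk B x) (shift S (- ?n))"
  proof -
    have "\<psi> (p \<oplus>\<^bsub>stalk B x\<^esub> q) = \<psi> p \<oplus>\<^bsub>S\<^esub> \<psi> q" if pq: "p \<in> carrier (stalk B x)" "q \<in> carrier (stalk B x)" for p q
    proof (rule uniq)
      show "H (p \<oplus>\<^bsub>stalk B x\<^esub> q) = (\<psi> p \<oplus>\<^bsub>S\<^esub> \<psi> q) \<otimes>\<^bsub>S\<^esub> lprod up"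
        unfolding H_add[OF pq] \<psi>(2)[OF pq(1)] \<psi>(2)[OF pq(2)]
        using \<psi>(1)[OF pq(1)] \<psi>(1)[OF pq(2)] by (simp add: S.l_distr)
    qed (use pq \<psi>(1) in simp_all)
    moreover have "\<psi> (s \<odot>\<^bsub>stalk B x\<^esub> p) = s \<otimes>\<^bsub>S\<^esub> \<psi> p" if sp: "s \<in> carrier S" "p \<in> carrier (stalk B x)" for s p
    proof (rule uniq)
      show "H (s \<odot>\<^bsub>stalk B x\<^esub> p) = (s \<otimes>\<^bsub>S\<^esub> \<psi> p) \<otimes>\<^bsub>S\<^esub> lprod up"
        unfolding H_smult[OF sp] \<psi>(2)[OF sp(2)] using \<psi>(1)[OF sp(2)] sp(1) by (simp add: S.m_assoc)
    qed (use sp \<psi>(1) in simp_all)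
    moreover have "\<psi> p \<in> hpart S (- ?n + i)" if p: "p \<in> hpart (stalk B x) i" for p i
    proof (rule S.mult_reflects_hpart[OF lprod_hpart[OF ud(1)] \<epsilon>0 \<psi>(1)[OF P.M.hpart_carrier[OF p]]])
      show "\<psi> p \<otimes>\<^bsub>S\<^esub> lprod up \<in> hpart S (- ?n + i + ?n)"
        using H_hpart[OF p card] unfolding \<psi>(2)[OF P.M.hpart_carrier[OF p]] by simp
    qed
    ultimately show ?thesis
      using \<psi>(1) by (simp add: graded_hom_def linear_maps_def S.smult_S image_subset_iff)
  qed
  note \<psi>_hom = this
  let ?t = "F (ev x \<psi>) x"
  note t = ev_F[OF x \<psi>_hom]
  have "card (star x) = card up + card down"
    unfolding ud(4) using ud(1,2) by (intro card_Un_disjoint) (auto simp: down_def)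
  \<comment> \<open>The element dual to a form of degree \<open>- ?n\<close> has degree
    \<open>l - ?n\<close>; valency \<open>l\<close> turns this into the number of lower edges, the
    degree treated by \<open>K_low_degree\<close>.\<close>
  then have "l + - ?n = int (card down)" using card by simp
  then have "?t = \<zero>\<^bsub>stalk B x\<^esub>"
    using K_low_degree[OF t(1)] t(2) unfolding down_def up_def by simp
  then have "F (ev x \<psi>) y = \<zero>\<^bsub>stalk B y\<^esub>" if "y \<in> verts G" for y
    using fun_cong[OF t(3), of y] that unfolding delta_def by simp
  then have D0: "ev x \<psi> = D0" by (rule F_zero_imp[OF hpart_D_carrier[OF ev_hpart[OF x \<psi>_hom]]])
  \<comment> \<open>Global sections take every value at \<open>x\<close>, so a form whose pullback
    is zero is itself zero.\<close>
  obtain m where m: "m \<in> \<Gamma>G" "m x = p" by (rule global_section_through[OF x p])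
  have "\<psi> p = \<zero>\<^bsub>S\<^esub>" using fun_cong[OF D0, of m] m by (simp add: ev_def D0_def)
  then show ?thesis unfolding \<psi>(2)[OF p] by simp
qed

text \<open>The form dual to \<open>F (ev x g) x\<close> is \<open>ev x g\<close> again, and the
  product of the labels comes out by linearity.\<close>

lemma H_F_ev:
  assumes g: "g \<in> graded_hom S (stalk B x) (shift S n)"
  shows "H (F (ev x g) x) = lprod (star x) \<otimes>\<^bsub>S\<^esub> g (\<beta> x)"
proof -
  have e: "ev x g \<in> carrier D" by (rule hpart_D_carrier[OF ev_hpart[OF x g]])
  have eq: "F (ev x g) y = delta x (F (ev x g) x) y" for y by (rule fun_cong[OF ev_F(3)[OF x g]])
  have co: "co x (F (ev x g) x) = ev x g" by (rule co_unique[OF x e ev_F(1)[OF x g] eq])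
  show ?thesis
    unfolding H_def co_smult[OF x ev_F(1)[OF x g] lprod_closed \<beta>_section] co
    using \<beta>_section by (simp add: ev_def)
qed

text \<open>If \<open>H\<close> were zero, \<open>H_F_ev\<close> would make every coordinate form of
  a dual basis vanish at \<beta>_x, although these coordinates reconstruct the nonzero element
  \<beta>_x.\<close>

lemma H_nonzero:
  assumes card: "int (card (star x)) = l"
  shows "H (\<beta> x) \<noteq> \<zero>\<^bsub>S\<^esub>"
proof
  assume c0: "H (\<beta> x) = \<zero>\<^bsub>S\<^esub>"
  interpret P: graded_mod S "stalk B x" by (rule stalk_mod[OF x])
  note \<beta>c = \<beta>_closed[OF x]
  have proj: "graded_projective S (stalk B x)" using cover[OF x xw] by (simp add: projective_cover_def)
  obtain A e \<phi> where A_all: "finite A" "A \<subseteq> carrier (stalk B x)"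
    "\<forall>a \<in> A. \<phi> a \<in> graded_hom S (stalk B x) (shift S (e a))"
    "\<forall>p \<in> carrier (stalk B x). p = (\<Oplus>\<^bsub>stalk B x\<^esub>a\<in>A. \<phi> a p \<odot>\<^bsub>stalk B x\<^esub> a)"
    by (rule S.projective_dual_basis[OF proj stalk_fg[OF x]])
  have vanish: "\<phi> a (\<beta> x) = \<zero>\<^bsub>S\<^esub>" if a: "a \<in> A" for a
  proof -
    note g = bspec[OF A_all(3) a]
    have "H (F (ev x (\<phi> a)) x) = \<zero>\<^bsub>S\<^esub>" by (rule H_zero[OF card c0 K_closed[OF ev_F(1)[OF x g]]])
    then have "lprod (star x) \<otimes>\<^bsub>S\<^esub> \<phi> a (\<beta> x) = \<zero>\<^bsub>S\<^esub>" by (rule trans[OF H_F_ev[OF g, symmetric]])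
    moreover have "\<phi> a (\<beta> x) \<in> carrier S" using g \<beta>c by (auto simp: graded_hom_def linear_maps_def)
    ultimately have "lprod (star x) = \<zero>\<^bsub>S\<^esub> \<or> \<phi> a (\<beta> x) = \<zero>\<^bsub>S\<^esub>"
      by (rule S.integral[OF _ lprod_closed])
    then show ?thesis using lprod_nonzero[OF finite_star star_edges] by simp
  qed
  have A0: "a \<in> carrier (stalk B x)" if "a \<in> A" for a using A_all(2) that by (rule subsetD)
  have "(\<Oplus>\<^bsub>stalk B x\<^esub>a\<in>A. \<phi> a (\<beta> x) \<odot>\<^bsub>stalk B x\<^esub> a) = (\<Oplus>\<^bsub>stalk B x\<^esub>a\<in>A. \<zero>\<^bsub>stalk B x\<^esub>)"
  proof (rule P.M.finsum_cong'[OF refl])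
    show "(\<lambda>a. \<zero>\<^bsub>stalk B x\<^esub>) \<in> A \<rightarrow> carrier (stalk B x)" by simp
    show "\<phi> a (\<beta> x) \<odot>\<^bsub>stalk B x\<^esub> a = \<zero>\<^bsub>stalk B x\<^esub>" if "a \<in> A" for a
      by (simp add: vanish[OF that] A0[OF that])
  qed
  also have "\<dots> = \<zero>\<^bsub>stalk B x\<^esub>" by (rule P.M.finsum_zero)
  finally have "\<beta> x = \<zero>\<^bsub>stalk B x\<^esub>" by (rule trans[OF bspec[OF A_all(4) \<beta>c]])
  then show False using \<beta>_nonzero[OF x] by (rule notE[rotated])
qed

lemma smooth_if_card:
  assumes "int (card (star x)) = l"
  shows "smooth x"
  by (rule smooth_if_H_nonzero[OF assms H_nonzero[OF assms]])

end

text \<open>Valency \<open>l\<close> at \<open>x\<close> implies smoothness only once all vertices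
  above are smooth, whence the downward induction. The vertex \<open>w\<close> is treated apart: its
  stalk is free of rank one by definition and not by a projective cover.\<close>

lemma smooth_iff_card:
  assumes x: "x \<in> verts G"
  shows "smooth x \<longleftrightarrow> (\<forall>y \<in> verts G. (x, y) \<in> le G \<longrightarrow> int (card (star y)) = l)"
proof
  assume sm: "smooth x"
  show "\<forall>y \<in> verts G. (x, y) \<in> le G \<longrightarrow> int (card (star y)) = l"
  proof (intro ballI impI)
    fix y assume "y \<in> verts G" "(x, y) \<in> le G"
    then show "int (card (star y)) = l" by (intro smooth_card smooth_above[OF _ x sm])
  qed
next
  assume "\<forall>y \<in> verts G. (x, y) \<in> le G \<longrightarrow> int (card (star y)) = l"
  with x show "smooth x"
  proof (induction x rule: arrow_induct)
    case (step x)
    have po: "refl_on (verts G) (le G)" "trans (le G)"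
      using le_partial_order by (simp_all add: partial_order_on_def preorder_on_def)
    have "(x, x) \<in> le G" by (rule refl_onD[OF po(1) step(1)])
    then have card: "int (card (star x)) = l" by (rule mp[OF bspec[OF step(3) step(1)]])
    show ?case
    proof (cases "x = w")
      case True
      then show ?thesis using smooth_w by simp
    next
      case False
      have above: "smooth y" if xy: "below G x y" for y
      proof (rule step(2)[OF xy], intro ballI impI)
        fix z assume z: "z \<in> verts G" "(y, z) \<in> le G"
        have "(x, y) \<in> le G" using xy by (simp add: below_def)
        then have "(x, z) \<in> le G" by (rule transD[OF po(2) _ z(2)])
        then show "int (card (star z)) = l" by (rule mp[OF bspec[OF step(3) z(1)]])
      qed
      show ?thesis by (rule smooth_if_card[OF step(1) False above card])
    qed
  qed
qed

end

theorem mainTheorem2: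
  fixes scale :: "'k::field \<Rightarrow> 'v::ab_group_add \<Rightarrow> 'v"
    and Basis :: "'v set"
    and G :: "('x, 'v) moment_graph"
    and B :: "('x, ('k, 'v) sym, 'm, 'n) sheaf"
    and w x :: 'x and l :: int
  assumes "finite_dimensional_vector_space scale Basis"
    and "is_moment_graph G" and "finite (verts G)" and "is_connected G" and "is_GKM scale G"
    and "highest_vertex G w"
    and "is_Braden_MacPherson scale G w B"
    and "self_dual scale G B l"
    and "x \<in> verts G"
  shows "graded_iso (sym_alg scale) (stalk B x) (sym_alg scale) \<longleftrightarrow>
    (\<forall>y \<in> verts G. (x, y) \<in> le G \<longrightarrow> int (card {E \<in> edges G. y \<in> E}) = l)"
proof -
  interpret BM_sheaf scale Basis G B w
    by (intro BM_sheaf.intro symmetric_algebra.intro BM_sheaf_axioms.intro assms)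
  show ?thesis
  proof (rule normalized_section)
    fix \<beta>
    assume \<beta>: "\<beta> \<in> \<Gamma> (verts G)" "\<And>x. x \<in> verts G \<Longrightarrow> \<beta> x \<in> hpart (stalk B x) 0"
      "\<And>x. x \<in> verts G \<Longrightarrow> \<beta> x \<noteq> \<zero>\<^bsub>stalk B x\<^esub>"
    obtain F where F: "F \<in> graded_hom (structure_algebra scale G)
        (graded_dual (sym_alg scale) (sections G B (verts G)) (Z_action G B)) (shift (global_sections G B) l)"
      "bij_betw F (carrier (graded_dual (sym_alg scale) (sections G B (verts G)) (Z_action G B)))
        (carrier (shift (global_sections G B) l))"
      using assms(8)[unfolded self_dual_def graded_iso_def] by (elim bexE)
    interpret self_dual_BM_sheaf scale Basis G B w \<beta> l F
      by (intro self_dual_BM_sheaf.intro normalized_BM_sheaf.intro normalized_BM_sheaf_axioms.intro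
        self_dual_BM_sheaf_axioms.intro BM_sheaf_axioms \<beta> F)
    show ?thesis
      unfolding graded_iso_iff_smooth[OF assms(9)] smooth_iff_card[OF assms(9)] star_def ..
  qed
qed

end
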